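(* Let $R,S$ be unital associative rings, $R'\subseteq R$ and $S'\subseteq S$ unital subrings, and ${}_SM_R\neq0$ a nonzero unital $S$-$R$-bimodule. Let $A=\begin{pmatrix} R&0\\ M&S\end{pmatrix}$ be the associated triangular matrix ring and let $B=R'\times S'$, regarded as a subring of diagonal matrices in $A$ (and as a subring of $R\oplus S=R\times S$). Then $$d(B,R\oplus S)\le d_{\rm odd}(B,A)\le d_{\rm odd}(R',R)+d_{\rm odd}(S',S)+1 .$$
   Context: The ring $A$ has the obvious matrix addition and multiplication. Depth: for modules over a ring, $M\mid N$ means $N\cong M\oplus M'$ for some module $M'$, and $M\sim N$ (H-equivalent) means there are natural numbers $r,s\ge 1$ with $N\mid rM$ and $M\mid sN$, where $rM=M\oplus\cdots\oplus M$ ($r$ times). For a unital subring $B\subseteq A$ with $1_B=1_A$, put $C_0(A,B)=B$ (as a $B$-$B$-bimodule) and $C_m(A,B)=A\otimes_B\cdots\otimes_B A$ ($m$ factors $A$) for $m\ge1$, with its natural $A$-$A$-bimodule structure $a(a_1\otimes\cdots\otimes a_m)a'=aa_1\otimes\cdots\otimes a_ma'$ and its restrictions to $A$-$B$-, $B$-$A$-, $B$-$B$-bimodules. The subring $B\subseteq A$ has depth $2m+1$ ($m\ge0$) if $C_{m+1}(A,B)\sim C_m(A,B)$ as $B$-$B$-bimodules; right (resp. left) depth $2m$ ($m\ge1$) if $C_{m+1}(A,B)\sim C_m(A,B)$ as $A$-$B$-bimodules (resp. $B$-$A$-bimodules); depth $2m$ if it has both left and right depth $2m$. Left or right depth $2m$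 implies depth $2m+1$, and depth $2m+1$ implies depth $2m+2$. The minimum depth $d(B,A)$ is the least $k\ge 1$ such that $k$ is odd and $B\subseteq A$ has depth $k$, or $k$ is even and $B\subseteq A$ has left or right depth $k$; $d(B,A)=\infty$ if there is no such $k$. Odd depth: $d_{\rm odd}(B,A)$ is the smallest odd number greater than or equal to $d(B,A)$; equivalently $d_{\rm odd}(B,A)=2m+1$ where $m\ge0$ is the smallest integer with $C_{m+1}(A,B)\sim C_m(A,B)$ as $B$-$B$-bimodules ($d_{\rm odd}(B,A)=\infty$ if $d(B,A)=\infty$). *)

theory Defs
  imports "HOL-Algebra.Algebra" "HOL-Library.Extended_Nat"
begin

section \<open>Bimodules\<close>

text \<open>As for the library's record of modules, the multiplicative part of the underlying
  ring record is not used.\<close>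

record ('l, 'r, 'm) bimodule = "'m ring" +
  lact :: "'l \<Rightarrow> 'm \<Rightarrow> 'm"
  ract :: "'m \<Rightarrow> 'r \<Rightarrow> 'm"

locale bimodule = L: ring L + R: ring R + abelian_group M
  for L :: "('l, 'a) ring_scheme" (structure)
    and R :: "('r, 'b) ring_scheme" (structure)
    and M :: "('l, 'r, 'm, 'c) bimodule_scheme" (structure) +
  assumes lact_closed: "\<lbrakk>a \<in> carrier L; x \<in> carrier M\<rbrakk> \<Longrightarrow> lact M a x \<in> carrier M"
    and lact_add_left: "\<lbrakk>a \<in> carrier L; b \<in> carrier L; x \<in> carrier M\<rbrakk>
      \<Longrightarrow> lact M (a \<oplus>\<^bsub>L\<^esub> b) x = lact M a x \<oplus>\<^bsub>M\<^esub> lact M b x"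
    and lact_add_right: "\<lbrakk>a \<in> carrier L; x \<in> carrier M; y \<in> carrier M\<rbrakk>
      \<Longrightarrow> lact M a (x \<oplus>\<^bsub>M\<^esub> y) = lact M a x \<oplus>\<^bsub>M\<^esub> lact M a y"
    and lact_mult: "\<lbrakk>a \<in> carrier L; b \<in> carrier L; x \<in> carrier M\<rbrakk>
      \<Longrightarrow> lact M (a \<otimes>\<^bsub>L\<^esub> b) x = lact M a (lact M b x)"
    and lact_one: "x \<in> carrier M \<Longrightarrow> lact M \<one>\<^bsub>L\<^esub> x = x"
    and ract_closed: "\<lbrakk>x \<in> carrier M; r \<in> carrier R\<rbrakk> \<Longrightarrow> ract M x r \<in> carrier M"
    and ract_add_right: "\<lbrakk>x \<in> carrier M; r \<in> carrier R; r' \<in> carrier R\<rbrakk>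
      \<Longrightarrow> ract M x (r \<oplus>\<^bsub>R\<^esub> r') = ract M x r \<oplus>\<^bsub>M\<^esub> ract M x r'"
    and ract_add_left: "\<lbrakk>x \<in> carrier M; y \<in> carrier M; r \<in> carrier R\<rbrakk>
      \<Longrightarrow> ract M (x \<oplus>\<^bsub>M\<^esub> y) r = ract M x r \<oplus>\<^bsub>M\<^esub> ract M y r"
    and ract_mult: "\<lbrakk>x \<in> carrier M; r \<in> carrier R; r' \<in> carrier R\<rbrakk>
      \<Longrightarrow> ract M x (r \<otimes>\<^bsub>R\<^esub> r') = ract M (ract M x r) r'"
    and ract_one: "x \<in> carrier M \<Longrightarrow> ract M x \<one>\<^bsub>R\<^esub> = x"
    and lact_ract: "\<lbrakk>a \<in> carrier L; x \<in> carrier M; r \<in> carrier R\<rbrakk>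
      \<Longrightarrow> ract M (lact M a x) r = lact M a (ract M x r)"

definition bimod_iso ::
  "('l, 'a) ring_scheme \<Rightarrow> ('r, 'b) ring_scheme \<Rightarrow> ('l, 'r, 'm) bimodule \<Rightarrow> ('l, 'r, 'n) bimodule
    \<Rightarrow> ('m \<Rightarrow> 'n) set"
  where "bimod_iso L R M N = {f. bij_betw f (carrier M) (carrier N) \<and>
    (\<forall>x\<in>carrier M. \<forall>y\<in>carrier M. f (x \<oplus>\<^bsub>M\<^esub> y) = f x \<oplus>\<^bsub>N\<^esub> f y) \<and>
    (\<forall>a\<in>carrier L. \<forall>x\<in>carrier M. f (lact M a x) = lact N a (f x)) \<and>
    (\<forall>a\<in>carrier R. \<forall>x\<in>carrier M. f (ract M x a) = ract N (f x) a)}"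

definition bimod_sum ::
  "('l, 'r, 'm) bimodule \<Rightarrow> ('l, 'r, 'n) bimodule \<Rightarrow> ('l, 'r, 'm \<times> 'n) bimodule"
  where "bimod_sum M N = \<lparr>
    carrier = carrier M \<times> carrier N, monoid.mult = undefined, one = undefined,
    ring.zero = (\<zero>\<^bsub>M\<^esub>, \<zero>\<^bsub>N\<^esub>), add = (\<lambda>(x, y) (x', y'). (x \<oplus>\<^bsub>M\<^esub> x', y \<oplus>\<^bsub>N\<^esub> y')),
    lact = (\<lambda>a (x, y). (lact M a x, lact N a y)),
    ract = (\<lambda>(x, y) a. (ract M x a, ract N y a))\<rparr>"

definition bimod_copies :: "nat \<Rightarrow> ('l, 'r, 'm) bimodule \<Rightarrow> ('l, 'r, nat \<Rightarrow> 'm) bimodule"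
  where "bimod_copies k M = \<lparr>
    carrier = {..<k} \<rightarrow>\<^sub>E carrier M, monoid.mult = undefined, one = undefined,
    ring.zero = (\<lambda>i\<in>{..<k}. \<zero>\<^bsub>M\<^esub>), add = (\<lambda>x y. \<lambda>i\<in>{..<k}. x i \<oplus>\<^bsub>M\<^esub> y i),
    lact = (\<lambda>a x. \<lambda>i\<in>{..<k}. lact M a (x i)),
    ract = (\<lambda>x a. \<lambda>i\<in>{..<k}. ract M (x i) a)\<rparr>"

text \<open>\<open>M | N\<close> as \<open>L\<close>-\<open>R\<close>-bimodules. The complement \<open>M'\<close> may be taken to have elements in the
  type of \<open>N\<close>, since any complement is isomorphic to a sub-bimodule of \<open>N\<close>.\<close>

definition bimod_divides ::
  "('l, 'a) ring_scheme \<Rightarrow> ('r, 'b) ring_scheme \<Rightarrow> ('l, 'r, 'm) bimodule \<Rightarrow> ('l, 'r, 'n) bimodule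
    \<Rightarrow> bool"
  where "bimod_divides L R M N \<longleftrightarrow>
    (\<exists>M' :: ('l, 'r, 'n) bimodule. bimodule L R M' \<and> bimod_iso L R N (bimod_sum M M') \<noteq> {})"

definition H_equivalent ::
  "('l, 'a) ring_scheme \<Rightarrow> ('r, 'b) ring_scheme \<Rightarrow> ('l, 'r, 'm) bimodule \<Rightarrow> ('l, 'r, 'n) bimodule
    \<Rightarrow> bool"
  where "H_equivalent L R M N \<longleftrightarrow>
    (\<exists>r\<ge>1. \<exists>s\<ge>1. bimod_divides L R N (bimod_copies r M) \<and> bimod_divides L R M (bimod_copies s N))"


section \<open>Tensor powers of a ring over a subring\<close>

text \<open>The \<open>n\<close>-fold tensor product (\<open>n \<ge> 1\<close>) of \<open>A\<close> over \<open>B\<close> is the free abelian group on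
  \<open>n\<close>-tuples of elements of \<open>A\<close>, modulo additivity in each slot and
  \<open>(\<dots>, a b, c, \<dots>) = (\<dots>, a, b c, \<dots>)\<close> for \<open>b\<close> in \<open>B\<close>. Forming it in one step rather than
  by iterating a binary product keeps all the tensor powers in a single type.\<close>

definition tuples :: "('a, 'b) ring_scheme \<Rightarrow> nat \<Rightarrow> 'a list set"
  where "tuples A n = {xs. length xs = n \<and> set xs \<subseteq> carrier A}"

definition tensor_relations :: "'a set \<Rightarrow> ('a, 'b) ring_scheme \<Rightarrow> nat \<Rightarrow> ('a list \<Rightarrow>\<^sub>0 int) set"
  where "tensor_relations B A n =
    {frag_of (xs @ [a \<oplus>\<^bsub>A\<^esub> a'] @ ys) - frag_of (xs @ [a] @ ys) - frag_of (xs @ [a'] @ ys) | xs a a' ys.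
      xs @ [a] @ ys \<in> tuples A n \<and> a' \<in> carrier A} \<union>
    {frag_of (xs @ [a \<otimes>\<^bsub>A\<^esub> b, c] @ ys) - frag_of (xs @ [a, b \<otimes>\<^bsub>A\<^esub> c] @ ys) | xs a b c ys.
      xs @ [a, c] @ ys \<in> tuples A n \<and> b \<in> B}"

definition tensor_null :: "'a set \<Rightarrow> ('a, 'b) ring_scheme \<Rightarrow> nat \<Rightarrow> ('a list \<Rightarrow>\<^sub>0 int) set"
  where "tensor_null B A n = generate (free_Abelian_group (tuples A n)) (tensor_relations B A n)"

definition tensor_class ::
  "'a set \<Rightarrow> ('a, 'b) ring_scheme \<Rightarrow> nat \<Rightarrow> ('a list \<Rightarrow>\<^sub>0 int) \<Rightarrow> ('a list \<Rightarrow>\<^sub>0 int) set"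
  where "tensor_class B A n c = tensor_null B A n #>\<^bsub>free_Abelian_group (tuples A n)\<^esub> c"

text \<open>The scalars act on the first and on the last tensor factor. On a coset \<open>U\<close> this is the
  union, over representatives \<open>x\<close> of \<open>U\<close>, of the cosets of their images; they all agree.\<close>

definition tensor_power ::
  "'a set \<Rightarrow> ('a, 'b) ring_scheme \<Rightarrow> nat \<Rightarrow> ('a, 'a, ('a list \<Rightarrow>\<^sub>0 int) set) bimodule"
  where "tensor_power B A n = (let Q = free_Abelian_group (tuples A n) Mod tensor_null B A n in \<lparr>
    carrier = carrier Q, monoid.mult = undefined, one = undefined,
    ring.zero = \<one>\<^bsub>Q\<^esub>, add = (\<otimes>\<^bsub>Q\<^esub>),
    lact = (\<lambda>a U. \<Union>x\<in>U. tensor_class B A n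
      (frag_extend (\<lambda>xs. frag_of ((a \<otimes>\<^bsub>A\<^esub> hd xs) # tl xs)) x)),
    ract = (\<lambda>U a. \<Union>x\<in>U. tensor_class B A n
      (frag_extend (\<lambda>xs. frag_of (butlast xs @ [last xs \<otimes>\<^bsub>A\<^esub> a])) x))\<rparr>)"

definition regular_bimodule :: "('a, 'b) ring_scheme \<Rightarrow> ('a, 'a, 'a) bimodule"
  where "regular_bimodule A = \<lparr>
    carrier = carrier A, monoid.mult = (\<otimes>\<^bsub>A\<^esub>), one = \<one>\<^bsub>A\<^esub>, ring.zero = \<zero>\<^bsub>A\<^esub>, add = (\<oplus>\<^bsub>A\<^esub>),
    lact = (\<otimes>\<^bsub>A\<^esub>), ract = (\<otimes>\<^bsub>A\<^esub>)\<rparr>"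


section \<open>Depth of a subring\<close>

text \<open>In each of the following, bimodules are restricted along \<open>B \<subseteq> A\<close> by taking the subring
  \<open>A\<lparr>carrier := B\<rparr>\<close> as the ring of scalars. The case \<open>m = 0\<close> is separate only because the
  0-th tensor power \<open>B\<close> has another type.\<close>

definition depth_odd :: "'a set \<Rightarrow> ('a, 'b) ring_scheme \<Rightarrow> nat \<Rightarrow> bool"
  where "depth_odd B A m \<longleftrightarrow> (let BB = A\<lparr>carrier := B\<rparr> in
    if m = 0 then H_equivalent BB BB (tensor_power B A 1) (regular_bimodule BB)
    else H_equivalent BB BB (tensor_power B A (m + 1)) (tensor_power B A m))"

definition right_depth_even :: "'a set \<Rightarrow> ('a, 'b) ring_scheme \<Rightarrow> nat \<Rightarrow> bool"
  where "right_depth_even B A m \<longleftrightarrow>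
    H_equivalent A (A\<lparr>carrier := B\<rparr>) (tensor_power B A (m + 1)) (tensor_power B A m)"

definition left_depth_even :: "'a set \<Rightarrow> ('a, 'b) ring_scheme \<Rightarrow> nat \<Rightarrow> bool"
  where "left_depth_even B A m \<longleftrightarrow>
    H_equivalent (A\<lparr>carrier := B\<rparr>) A (tensor_power B A (m + 1)) (tensor_power B A m)"

text \<open>Infima in \<^typ>\<open>enat\<close>: the infimum of the empty set is \<open>\<infinity>\<close>.\<close>

definition min_depth :: "'a set \<Rightarrow> ('a, 'b) ring_scheme \<Rightarrow> enat"
  where "min_depth B A = Inf (
    {enat (2 * m + 1) | m. depth_odd B A m} \<union>
    {enat (2 * m) | m. m \<ge> 1 \<and> (left_depth_even B A m \<or> right_depth_even B A m)})"

definition min_odd_depth :: "'a set \<Rightarrow> ('a, 'b) ring_scheme \<Rightarrow> enat"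
  where "min_odd_depth B A = Inf {enat k | k. odd k \<and> min_depth B A \<le> enat k}"


section \<open>Triangular matrix rings\<close>

text \<open>The triple \<open>(r, x, s)\<close> stands for the matrix with rows \<open>(r, 0)\<close> and \<open>(x, s)\<close>.\<close>

definition triangular_ring ::
  "('r, 'a) ring_scheme \<Rightarrow> ('s, 'r, 'm) bimodule \<Rightarrow> ('s, 'b) ring_scheme \<Rightarrow> ('r \<times> 'm \<times> 's) ring"
  where "triangular_ring R M S = \<lparr>
    carrier = carrier R \<times> carrier M \<times> carrier S,
    monoid.mult = (\<lambda>(r, x, s) (r', x', s').
      (r \<otimes>\<^bsub>R\<^esub> r', ract M x r' \<oplus>\<^bsub>M\<^esub> lact M s x', s \<otimes>\<^bsub>S\<^esub> s')),
    one = (\<one>\<^bsub>R\<^esub>, \<zero>\<^bsub>M\<^esub>, \<one>\<^bsub>S\<^esub>),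
    ring.zero = (\<zero>\<^bsub>R\<^esub>, \<zero>\<^bsub>M\<^esub>, \<zero>\<^bsub>S\<^esub>),
    add = (\<lambda>(r, x, s) (r', x', s'). (r \<oplus>\<^bsub>R\<^esub> r', x \<oplus>\<^bsub>M\<^esub> x', s \<oplus>\<^bsub>S\<^esub> s'))\<rparr>"

definition diagonal_matrices ::
  "'r set \<Rightarrow> ('s, 'r, 'm) bimodule \<Rightarrow> 's set \<Rightarrow> ('r \<times> 'm \<times> 's) set"
  where "diagonal_matrices R' M S' = {(r, \<zero>\<^bsub>M\<^esub>, s) | r s. r \<in> R' \<and> s \<in> S'}"

end

theory Submission
  imports Defs
begin

text \<open>
  Let \<open>e\<close> and \<open>e'\<close> be the two diagonal idempotents of \<open>A\<close>; they lie in \<open>B\<close> and \<open>e A e' = 0\<close>.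

  Since a bimodule homomorphism between tensor powers of \<open>A\<close> commutes with \<open>u \<mapsto> e u + u e'\<close>, whose image is
  the corresponding tensor power of the diagonal subring \<open>R \<oplus> S\<close>, H-equivalence passes from the tensor
  powers of \<open>A\<close> to those of \<open>R \<oplus> S\<close>. This gives the first inequality.

  For the second one let \<open>2 a + 1\<close> and \<open>2 b + 1\<close> be the odd depths of \<open>R' \<subseteq> R\<close> and \<open>S' \<subseteq> S\<close>. Writing
  \<open>1 = e + e'\<close> between the factors \<open>b + 1\<close> and \<open>b + 2\<close> of a tensor of length \<open>a + b + 2\<close> splits it into a term
  whose last \<open>a + 1\<close> factors may be multiplied by \<open>e\<close> from the left (and so come from \<open>R\<close>) and a term whose
  first \<open>b + 1\<close> factors may be multiplied by \<open>e'\<close> from the right (and so come from \<open>S\<close>). In the first term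
  the \<open>a + 1\<close> factors can be shortened to \<open>a\<close>, in the second one the \<open>b + 1\<close> factors to \<open>b\<close>, so the
  identity of the tensor power of length \<open>a + b + 2\<close> is a sum of maps that factor through length \<open>a + b + 1\<close>.
\<close>

section \<open>Additive maps\<close>

text \<open>That \<open>M\<close> divides some \<open>r N\<close> is traded for the statement that
  the identity of \<open>M\<close> is a finite sum of maps \<open>M -> N -> M\<close>
  (\<open>factors\<close>). Such sums survive tensoring with \<open>A\<close>, passage to a corner
  and restriction of scalars, with no complement to carry along. From \<open>e A e' = 0\<close> and
  \<open>e + e' = 1\<close> one gets \<open>e y = e y e\<close> and \<open>y e' = e' y e'\<close>,
  so \<open>e\<close> travels through a tensor to the right and \<open>e'\<close> to the left. This
  is why the tensor is cut between two blocks: in each summand one block lies in a single corner.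
  The blocks have \<open>b + 1\<close> and \<open>a + 1\<close> factors because each of the two
  summands has to be shortened. The resulting index is \<open>a + b + 1\<close>, and
  \<open>2 (a + b + 1) + 1 = (2 a + 1) + (2 b + 1) + 1\<close>. The obstacle is \<open>a = 0\<close>
  or \<open>b = 0\<close>: the corner then shortens to its scalar ring instead of a tensor power,
  and the scalars have to be absorbed by the neighbouring block, which has at least one
  factor.\<close>

definition add_hom :: "('a, 'c) ring_scheme \<Rightarrow> ('b, 'd) ring_scheme \<Rightarrow> ('a \<Rightarrow> 'b) set"
  where "add_hom Q P = {f. (\<forall>x\<in>carrier Q. f x \<in> carrier P) \<and>
    (\<forall>x\<in>carrier Q. \<forall>y\<in>carrier Q. f (x \<oplus>\<^bsub>Q\<^esub> y) = f x \<oplus>\<^bsub>P\<^esub> f y)}"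

lemma add_homI:
  assumes "\<And>x. x \<in> carrier Q \<Longrightarrow> f x \<in> carrier P"
    and "\<And>x y. \<lbrakk>x \<in> carrier Q; y \<in> carrier Q\<rbrakk> \<Longrightarrow> f (x \<oplus>\<^bsub>Q\<^esub> y) = f x \<oplus>\<^bsub>P\<^esub> f y"
  shows "f \<in> add_hom Q P"
  using assms by (auto simp: add_hom_def)

lemma add_hom_closed: "\<lbrakk>f \<in> add_hom Q P; x \<in> carrier Q\<rbrakk> \<Longrightarrow> f x \<in> carrier P"
  and add_hom_add: "\<lbrakk>f \<in> add_hom Q P; x \<in> carrier Q; y \<in> carrier Q\<rbrakk>
    \<Longrightarrow> f (x \<oplus>\<^bsub>Q\<^esub> y) = f x \<oplus>\<^bsub>P\<^esub> f y"
  by (auto simp: add_hom_def)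

lemma add_hom_zero:
  assumes "abelian_group Q" "abelian_group P" "f \<in> add_hom Q P"
  shows "f \<zero>\<^bsub>Q\<^esub> = \<zero>\<^bsub>P\<^esub>"
proof -
  interpret Q: abelian_group Q by fact
  interpret P: abelian_group P by fact
  have "f \<zero>\<^bsub>Q\<^esub> \<oplus>\<^bsub>P\<^esub> f \<zero>\<^bsub>Q\<^esub> = f \<zero>\<^bsub>Q\<^esub> \<oplus>\<^bsub>P\<^esub> \<zero>\<^bsub>P\<^esub>"
    using add_hom_add[OF assms(3), of "\<zero>\<^bsub>Q\<^esub>" "\<zero>\<^bsub>Q\<^esub>"] add_hom_closed[OF assms(3)] by simp
  then show ?thesis
    using add_hom_closed[OF assms(3), of "\<zero>\<^bsub>Q\<^esub>"] P.add.l_cancel by blast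
qed

lemma add_hom_neg:
  assumes "abelian_group Q" "abelian_group P" "f \<in> add_hom Q P" "x \<in> carrier Q"
  shows "f (\<ominus>\<^bsub>Q\<^esub> x) = \<ominus>\<^bsub>P\<^esub> f x"
proof -
  interpret Q: abelian_group Q by fact
  interpret P: abelian_group P by fact
  have "f (\<ominus>\<^bsub>Q\<^esub> x) \<oplus>\<^bsub>P\<^esub> f x = \<zero>\<^bsub>P\<^esub>"
    using add_hom_add[OF assms(3), of "\<ominus>\<^bsub>Q\<^esub> x" x] assms(4) add_hom_zero[OF assms(1-3)]
    by (simp add: Q.l_neg)
  then show ?thesis
    using add_hom_closed[OF assms(3)] assms(4) P.minus_equality[symmetric] by simp
qed

lemma add_hom_compose:
  "\<lbrakk>f \<in> add_hom Q P; g \<in> add_hom P Z\<rbrakk> \<Longrightarrow> (\<lambda>x. g (f x)) \<in> add_hom Q Z"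
  by (auto simp: add_hom_def)

lemma add_hom_sum:
  assumes "abelian_group P" "f \<in> add_hom Q P" "g \<in> add_hom Q P"
  shows "(\<lambda>x. f x \<oplus>\<^bsub>P\<^esub> g x) \<in> add_hom Q P"
proof -
  interpret P: abelian_group P by fact
  show ?thesis
    using assms(2,3) by (auto intro!: add_homI simp: add_hom_closed add_hom_add P.add.m_ac)
qed

lemma add_hom_id: "(\<lambda>x. x) \<in> add_hom Q Q"
  by (simp add: add_hom_def)


section \<open>Universal property of the tensor powers\<close>

locale ring_pair = ring A for A (structure) +
  fixes B :: "'a set"
  assumes B_subring: "subring B A"
begin

abbreviation T :: "nat \<Rightarrow> ('a, 'a, ('a list \<Rightarrow>\<^sub>0 int) set) bimodule"
  where "T n \<equiv> tensor_power B A n"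

text \<open>The elementary tensor of the entries of \<open>xs\<close>; the length of the list
  selects the tensor power. In the comments below \<otimes> is the tensor sign and products in a
  ring are written by juxtaposition.\<close>

definition pure :: "'a list \<Rightarrow> ('a list \<Rightarrow>\<^sub>0 int) set"
  where "pure xs = tensor_class B A (length xs) (frag_of xs)"

lemma B_closed: "b \<in> B \<Longrightarrow> b \<in> carrier A"
  using subringE(1)[OF B_subring] by blast

lemma B_one: "\<one> \<in> B"
  using subringE(3)[OF B_subring] .

lemma B_ring: "ring (A\<lparr>carrier := B\<rparr>)"
  using subring_is_ring[OF B_subring] .

lemma tuples_append: "xs @ ys \<in> tuples A n \<longleftrightarrow>
  length xs + length ys = n \<and> set xs \<subseteq> carrier A \<and> set ys \<subseteq> carrier A"
  by (auto simp: tuples_def)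

lemma tensor_relations_closed: "tensor_relations B A n \<subseteq> carrier (free_Abelian_group (tuples A n))"
proof -
  have d: "Poly_Mapping.keys (x - y) \<subseteq> S"
    if "Poly_Mapping.keys x \<subseteq> S" "Poly_Mapping.keys y \<subseteq> S" for x y :: "'a list \<Rightarrow>\<^sub>0 int" and S
    using that keys_diff[of x y] by blast
  show ?thesis
  proof
    fix x assume "x \<in> tensor_relations B A n"
    then consider (1) xs a a' ys where
        "x = frag_of (xs @ [a \<oplus> a'] @ ys) - frag_of (xs @ [a] @ ys) - frag_of (xs @ [a'] @ ys)"
        "xs @ [a] @ ys \<in> tuples A n" "a' \<in> carrier A"
      | (2) xs a b c ys where "x = frag_of (xs @ [a \<otimes> b, c] @ ys) - frag_of (xs @ [a, b \<otimes> c] @ ys)"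
        "xs @ [a, c] @ ys \<in> tuples A n" "b \<in> B"
      unfolding tensor_relations_def by auto
    then show "x \<in> carrier (free_Abelian_group (tuples A n))"
    proof cases
      case 1
      then show ?thesis
        unfolding carrier_free_Abelian_group_iff 1(1) by (intro d) (auto simp: tuples_def)
    next
      case 2
      then show ?thesis
        unfolding carrier_free_Abelian_group_iff 2(1) by (intro d) (auto simp: tuples_def B_closed)
    qed
  qed
qed

lemma tensor_null_subgroup: "subgroup (tensor_null B A n) (free_Abelian_group (tuples A n))"
  unfolding tensor_null_def
  by (intro group.generate_is_subgroup group_free_Abelian_group tensor_relations_closed)

lemma tensor_null_normal: "tensor_null B A n \<lhd> free_Abelian_group (tuples A n)"
  using comm_group.normal_iff_subgroup[OF abelian_free_Abelian_group] tensor_null_subgroup by blast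

lemma tensor_power_simps:
  "carrier (T n) = tensor_class B A n ` carrier (free_Abelian_group (tuples A n))"
  "add (T n) = set_mult (free_Abelian_group (tuples A n))"
  "\<zero>\<^bsub>T n\<^esub> = tensor_null B A n"
  by (auto simp: tensor_power_def Let_def carrier_FactGroup tensor_class_def)

lemma abelian_group_T: "abelian_group (T n)"
proof -
  let ?Q = "free_Abelian_group (tuples A n) Mod tensor_null B A n"
  interpret Q: comm_group ?Q
    by (intro comm_group.abelian_FactGroup abelian_free_Abelian_group tensor_null_subgroup)
  have "carrier (T n) = carrier ?Q" "add (T n) = monoid.mult ?Q" "\<zero>\<^bsub>T n\<^esub> = one ?Q"
    by (auto simp: tensor_power_def Let_def)
  then show ?thesis
    by (intro abelian_groupI) (auto simp: Q.m_ac simp del: mult_FactGroup one_FactGroup intro: Q.l_inv_ex)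
qed

lemma tensor_class_closed:
  "Poly_Mapping.keys c \<subseteq> tuples A n \<Longrightarrow> tensor_class B A n c \<in> carrier (T n)"
  by (auto simp: tensor_power_simps)

lemma tensor_class_add:
  "\<lbrakk>Poly_Mapping.keys c \<subseteq> tuples A n; Poly_Mapping.keys d \<subseteq> tuples A n\<rbrakk>
    \<Longrightarrow> tensor_class B A n (c + d) = tensor_class B A n c \<oplus>\<^bsub>T n\<^esub> tensor_class B A n d"
  using normal.rcos_sum[OF tensor_null_normal, of c n d]
  by (simp add: tensor_class_def tensor_power_simps)

lemma tensor_class_null:
  assumes "c \<in> tensor_null B A n"
  shows "tensor_class B A n c = \<zero>\<^bsub>T n\<^esub>"
  unfolding tensor_class_def tensor_power_simps
  using group.coset_join2[OF group_free_Abelian_group _ tensor_null_subgroup assms]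
    subgroup.subset[OF tensor_null_subgroup] assms by blast

lemma free_hom_eq:
  assumes "abelian_group Q"
    and "f \<in> hom (free_Abelian_group S) (add_monoid Q)" "g \<in> hom (free_Abelian_group S) (add_monoid Q)"
    and eq: "\<And>x. x \<in> S \<Longrightarrow> f (frag_of x) = g (frag_of x)"
    and "Poly_Mapping.keys c \<subseteq> S"
  shows "f c = g c"
proof -
  interpret Q: abelian_group Q by fact
  interpret f: group_hom "free_Abelian_group S" "add_monoid Q" f
    using assms(2) by (simp add: group_hom_def group_hom_axioms_def Q.a_group)
  interpret g: group_hom "free_Abelian_group S" "add_monoid Q" g
    using assms(3) by (simp add: group_hom_def group_hom_axioms_def Q.a_group)
  show ?thesis
  proof (rule free_Abelian_group_induct[OF assms(5)])
    show "f 0 = g 0" using f.hom_one g.hom_one by simp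
    show "f (x - y) = g (x - y)"
      if "Poly_Mapping.keys x \<subseteq> S" "Poly_Mapping.keys y \<subseteq> S" "f x = g x" "f y = g y" for x y
      using f.hom_mult[of x "- y"] g.hom_mult[of x "- y"] f.hom_inv[of y] g.hom_inv[of y] that by simp
  qed (rule eq)
qed

text \<open>The multilinearity condition of the universal property: the additive extension of such a
  map to the free abelian group kills both kinds of \<open>tensor_relations\<close>.\<close>

definition balanced :: "('q, 'd) ring_scheme \<Rightarrow> nat \<Rightarrow> ('a list \<Rightarrow> 'q) \<Rightarrow> bool"
  where "balanced Q n \<phi> \<longleftrightarrow> (\<forall>xs\<in>tuples A n. \<phi> xs \<in> carrier Q) \<and>
    (\<forall>xs a a' ys. xs @ a # ys \<in> tuples A n \<longrightarrow> a' \<in> carrier A \<longrightarrow>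
      \<phi> (xs @ (a \<oplus> a') # ys) = \<phi> (xs @ a # ys) \<oplus>\<^bsub>Q\<^esub> \<phi> (xs @ a' # ys)) \<and>
    (\<forall>xs a b c ys. xs @ a # c # ys \<in> tuples A n \<longrightarrow> b \<in> B \<longrightarrow>
      \<phi> (xs @ (a \<otimes> b) # c # ys) = \<phi> (xs @ a # (b \<otimes> c) # ys))"

lemma balancedI:
  assumes "\<And>xs. xs \<in> tuples A n \<Longrightarrow> \<phi> xs \<in> carrier Q"
    and "\<And>xs a a' ys. \<lbrakk>length xs + length ys + 1 = n; set xs \<subseteq> carrier A; set ys \<subseteq> carrier A;
        a \<in> carrier A; a' \<in> carrier A\<rbrakk>
      \<Longrightarrow> \<phi> (xs @ (a \<oplus> a') # ys) = \<phi> (xs @ a # ys) \<oplus>\<^bsub>Q\<^esub> \<phi> (xs @ a' # ys)"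
    and "\<And>xs a b c ys. \<lbrakk>length xs + length ys + 2 = n; set xs \<subseteq> carrier A; set ys \<subseteq> carrier A;
        a \<in> carrier A; c \<in> carrier A; b \<in> B\<rbrakk>
      \<Longrightarrow> \<phi> (xs @ (a \<otimes> b) # c # ys) = \<phi> (xs @ a # (b \<otimes> c) # ys)"
  shows "balanced Q n \<phi>"
  using assms unfolding balanced_def by (auto simp: tuples_append Pi_iff)

section \<open>Relations between elementary tensors\<close>

lemma pure_closed: "set xs \<subseteq> carrier A \<Longrightarrow> length xs = n \<Longrightarrow> pure xs \<in> carrier (T n)"
  unfolding pure_def by (auto intro!: tensor_class_closed simp: tuples_def)

lemma pure_add:
  assumes "set xs \<subseteq> carrier A" "set ys \<subseteq> carrier A" "a \<in> carrier A" "a' \<in> carrier A"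
    and n: "n = length xs + length ys + 1"
  shows "pure (xs @ (a \<oplus> a') # ys) = pure (xs @ a # ys) \<oplus>\<^bsub>T n\<^esub> pure (xs @ a' # ys)"
proof -
  let ?c = "frag_of (xs @ (a \<oplus> a') # ys)" and ?d = "frag_of (xs @ a # ys)" and ?e = "frag_of (xs @ a' # ys)"
  interpret T: abelian_group "T n" by (rule abelian_group_T)
  have k: "Poly_Mapping.keys ?c \<subseteq> tuples A n" "Poly_Mapping.keys ?d \<subseteq> tuples A n"
    "Poly_Mapping.keys ?e \<subseteq> tuples A n"
    using assms by (auto simp: tuples_def)
  have "xs @ [a] @ ys \<in> tuples A n"
    using assms by (auto simp: tuples_def)
  then have r: "?c - ?d - ?e \<in> tensor_relations B A n"
    unfolding tensor_relations_def using assms(4)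
    by (intro UnI1 CollectI exI[of _ xs] exI[of _ a] exI[of _ a'] exI[of _ ys]) simp
  have kr: "Poly_Mapping.keys (?c - ?d - ?e) \<subseteq> tuples A n"
    using r tensor_relations_closed by fastforce
  have kde: "Poly_Mapping.keys (?d + ?e) \<subseteq> tuples A n"
    using k keys_add[of ?d ?e] by blast
  have "tensor_class B A n (?c - ?d - ?e) = \<zero>\<^bsub>T n\<^esub>"
    by (rule tensor_class_null) (simp add: tensor_null_def generate.incl r)
  \<comment> \<open>Adding a relation to \<open>?d + ?e\<close> keeps the argument within sums,
    which is what \<open>tensor_class_add\<close> speaks of.\<close>
  then have "tensor_class B A n ((?c - ?d - ?e) + (?d + ?e))
    = tensor_class B A n ?d \<oplus>\<^bsub>T n\<^esub> tensor_class B A n ?e"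
    using tensor_class_add[OF kr kde] tensor_class_add[OF k(2,3)] tensor_class_closed[OF k(2)]
      tensor_class_closed[OF k(3)] by simp
  then show ?thesis
    by (simp add: pure_def n)
qed

lemma pure_balance:
  assumes "set xs \<subseteq> carrier A" "set ys \<subseteq> carrier A" "a \<in> carrier A" "c \<in> carrier A" "b \<in> B"
  shows "pure (xs @ (a \<otimes> b) # c # ys) = pure (xs @ a # (b \<otimes> c) # ys)"
proof -
  define n where "n = length xs + length ys + 2"
  let ?c = "frag_of (xs @ (a \<otimes> b) # c # ys)" and ?d = "frag_of (xs @ a # (b \<otimes> c) # ys)"
  interpret T: abelian_group "T n" by (rule abelian_group_T)
  have k: "Poly_Mapping.keys ?c \<subseteq> tuples A n" "Poly_Mapping.keys ?d \<subseteq> tuples A n"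
    using assms by (auto simp: tuples_def n_def B_closed)
  have "xs @ [a, c] @ ys \<in> tuples A n"
    using assms by (auto simp: tuples_def n_def)
  then have r: "?c - ?d \<in> tensor_relations B A n"
    unfolding tensor_relations_def using assms(5)
    by (intro UnI2 CollectI exI[of _ xs] exI[of _ a] exI[of _ b] exI[of _ c] exI[of _ ys]) simp
  have kr: "Poly_Mapping.keys (?c - ?d) \<subseteq> tuples A n"
    using r tensor_relations_closed by fastforce
  have "tensor_class B A n (?c - ?d) = \<zero>\<^bsub>T n\<^esub>"
    by (rule tensor_class_null) (simp add: tensor_null_def generate.incl r)
  then have "tensor_class B A n ((?c - ?d) + ?d) = tensor_class B A n ?d"
    using tensor_class_add[OF kr k(2)] tensor_class_closed[OF k(2)] by simp
  then show ?thesis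
    by (simp add: pure_def n_def)
qed

text \<open>Elementary tensors generate the tensor power. Most identities between additive maps
  below are reduced to elementary tensors by this lemma or by its variants that expose the first or
  the last factor.\<close>

lemma tensor_hom_eq:
  assumes "abelian_group Q" "f \<in> add_hom (T n) Q" "g \<in> add_hom (T n) Q"
    and "\<And>xs. \<lbrakk>length xs = n; set xs \<subseteq> carrier A\<rbrakk> \<Longrightarrow> f (pure xs) = g (pure xs)"
    and "u \<in> carrier (T n)"
  shows "f u = g u"
proof -
  obtain c where c: "Poly_Mapping.keys c \<subseteq> tuples A n" "u = tensor_class B A n c"
    using assms(5) by (auto simp: tensor_power_simps)
  have "(\<lambda>c. h (tensor_class B A n c)) \<in> hom (free_Abelian_group (tuples A n)) (add_monoid Q)"
    if "h \<in> add_hom (T n) Q" for h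
    using that by (auto simp: hom_def add_hom_closed add_hom_add tensor_class_closed tensor_class_add)
  from free_hom_eq[OF assms(1) this this _ c(1), OF assms(2,3)] show ?thesis
    using assms(4) unfolding c(2) by (auto simp: tuples_def pure_def)
qed

text \<open>The additive extension \<open>H\<close> of \<phi> to the free abelian group vanishes on
  the relations, hence on the subgroup that they generate, and so descends to the quotient.\<close>

lemma tensor_universal:
  assumes Q: "abelian_group Q" and \<phi>: "balanced Q n \<phi>"
  obtains h where "h \<in> add_hom (T n) Q"
    "\<And>xs. \<lbrakk>length xs = n; set xs \<subseteq> carrier A\<rbrakk> \<Longrightarrow> h (pure xs) = \<phi> xs"
proof -
  interpret Q: abelian_group Q by fact
  interpret F: comm_group "free_Abelian_group (tuples A n)" by (rule abelian_free_Abelian_group)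
  let ?F = "free_Abelian_group (tuples A n)" and ?N = "tensor_null B A n"
  have "\<phi> ` tuples A n \<subseteq> carrier (add_monoid Q)"
    using \<phi> by (auto simp: balanced_def)
  then obtain H where H: "H \<in> hom ?F (add_monoid Q)" "\<And>xs. xs \<in> tuples A n \<Longrightarrow> H (frag_of xs) = \<phi> xs"
    using comm_group.free_Abelian_group_universal[OF Q.a_comm_group] by metis
  interpret H: group_hom ?F "add_monoid Q" H
    using H(1) by (simp add: group_hom_def group_hom_axioms_def Q.a_group)
  have Hdiff: "H (x - y) = H x \<ominus>\<^bsub>Q\<^esub> H y"
    if "Poly_Mapping.keys x \<subseteq> tuples A n" "Poly_Mapping.keys y \<subseteq> tuples A n" for x y
    using that H.hom_mult[of x "- y"] H.hom_inv[of y] by (simp add: Q.minus_eq a_inv_def)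
  have Hcl: "H x \<in> carrier Q" if "Poly_Mapping.keys x \<subseteq> tuples A n" for x
    using H.hom_closed[of x] that by simp
  have Hrel: "H x = \<zero>\<^bsub>Q\<^esub>" if "x \<in> tensor_relations B A n" for x
  proof -
    consider (1) xs a a' ys where
        "x = frag_of (xs @ [a \<oplus> a'] @ ys) - frag_of (xs @ [a] @ ys) - frag_of (xs @ [a'] @ ys)"
        "xs @ [a] @ ys \<in> tuples A n" "a' \<in> carrier A"
      | (2) xs a b c ys where "x = frag_of (xs @ [a \<otimes> b, c] @ ys) - frag_of (xs @ [a, b \<otimes> c] @ ys)"
        "xs @ [a, c] @ ys \<in> tuples A n" "b \<in> B"
      using \<open>x \<in> tensor_relations B A n\<close> unfolding tensor_relations_def by auto
    then show ?thesis
    proof cases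
      case 1
      have k: "xs @ (a \<oplus> a') # ys \<in> tuples A n" "xs @ a # ys \<in> tuples A n" "xs @ a' # ys \<in> tuples A n"
        using 1 by (auto simp: tuples_def)
      have kk: "Poly_Mapping.keys (frag_of (xs @ (a \<oplus> a') # ys) - frag_of (xs @ a # ys)) \<subseteq> tuples A n"
        using keys_diff[of "frag_of (xs @ (a \<oplus> a') # ys)" "frag_of (xs @ a # ys)"] k by auto
      have \<phi>cl: "\<phi> zs \<in> carrier Q" if "zs \<in> tuples A n" for zs
        using \<phi> that by (auto simp: balanced_def)
      have "H x = \<phi> (xs @ (a \<oplus> a') # ys) \<ominus>\<^bsub>Q\<^esub> \<phi> (xs @ a # ys) \<ominus>\<^bsub>Q\<^esub> \<phi> (xs @ a' # ys)"
        using Hdiff[OF kk, of "frag_of (xs @ a' # ys)"]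
          Hdiff[of "frag_of (xs @ (a \<oplus> a') # ys)" "frag_of (xs @ a # ys)"] k 1 H(2) by simp
      moreover have "\<phi> (xs @ (a \<oplus> a') # ys) = \<phi> (xs @ a # ys) \<oplus>\<^bsub>Q\<^esub> \<phi> (xs @ a' # ys)"
        using \<phi> k 1(3) unfolding balanced_def by blast
      ultimately show ?thesis
        using \<phi>cl[OF k(2)] \<phi>cl[OF k(3)]
        by (simp add: Q.minus_eq) (metis Q.a_assoc Q.a_comm Q.a_inv_closed Q.r_neg Q.r_zero Q.add.m_closed)
    next
      case 2
      have k: "xs @ (a \<otimes> b) # c # ys \<in> tuples A n" "xs @ a # (b \<otimes> c) # ys \<in> tuples A n"
        using 2 by (auto simp: tuples_def B_closed)
      have "H x = \<phi> (xs @ (a \<otimes> b) # c # ys) \<ominus>\<^bsub>Q\<^esub> \<phi> (xs @ a # (b \<otimes> c) # ys)"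
        using Hdiff[of "frag_of (xs @ (a \<otimes> b) # c # ys)" "frag_of (xs @ a # (b \<otimes> c) # ys)"] k 2 H(2) by simp
      moreover have "\<phi> (xs @ (a \<otimes> b) # c # ys) = \<phi> (xs @ a # (b \<otimes> c) # ys)"
        using \<phi> 2(2,3) unfolding balanced_def by simp
      moreover have "\<phi> (xs @ a # (b \<otimes> c) # ys) \<in> carrier Q"
        using \<phi> k(2) by (auto simp: balanced_def)
      ultimately show ?thesis by (simp add: Q.minus_eq Q.r_neg)
    qed
  qed
  have Nsub: "?N \<subseteq> carrier ?F"
    using tensor_null_subgroup by (rule subgroup.subset)
  have Hnull: "H x = \<zero>\<^bsub>Q\<^esub>" if "x \<in> ?N" for x
  proof -
    have "x \<in> generate ?F (tensor_relations B A n)" using that by (simp add: tensor_null_def)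
    then have "x \<in> carrier ?F \<and> H x = \<zero>\<^bsub>Q\<^esub>"
    proof induction
      case one show ?case using H.hom_one by simp
    next
      case (incl h) then show ?case using Hrel tensor_relations_closed by blast
    next
      case (inv h)
      then have "h \<in> carrier ?F" using tensor_relations_closed by blast
      then show ?case using H.hom_inv[of h] Hrel[OF inv] F.inv_closed[of h] by simp
    next
      case (eng h1 h2)
      then show ?case using H.hom_mult[of h1 h2] F.m_closed[of h1 h2] by simp
    qed
    then show ?thesis ..
  qed
  have "H x = H y" if "x \<in> carrier ?F" "y \<in> carrier ?F" "?N #>\<^bsub>?F\<^esub> x = ?N #>\<^bsub>?F\<^esub> y" for x y
  proof -
    have "x \<in> ?N #>\<^bsub>?F\<^esub> y"
      using F.rcos_self[OF that(1) tensor_null_subgroup] that(3) by simp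
    then obtain z where "z \<in> ?N" "x = z \<otimes>\<^bsub>?F\<^esub> y"
      by (auto simp: r_coset_def)
    then show ?thesis
      using H.hom_mult[of z y] Nsub that(2) Hnull Hcl[of y] by auto
  qed
  then obtain h where h: "h \<in> hom (?F Mod ?N) (add_monoid Q)" "\<And>x. x \<in> carrier ?F \<Longrightarrow> h (?N #>\<^bsub>?F\<^esub> x) = H x"
    using FactGroup_universal[OF H(1) tensor_null_normal] by metis
  show thesis
  proof
    show "h \<in> add_hom (T n) Q"
      using h(1) by (auto simp: hom_def add_hom_def tensor_power_def Let_def)
    show "h (pure xs) = \<phi> xs" if "length xs = n" "set xs \<subseteq> carrier A" for xs
      using h(2)[of "frag_of xs"] H(2)[of xs] that by (auto simp: pure_def tensor_class_def tuples_def)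
  qed
qed

end

section \<open>Bimodule homomorphisms\<close>

definition bimod_hom ::
  "('l, 'a) ring_scheme \<Rightarrow> ('r, 'b) ring_scheme \<Rightarrow> ('l, 'r, 'm) bimodule \<Rightarrow> ('l, 'r, 'n) bimodule
    \<Rightarrow> ('m \<Rightarrow> 'n) set"
  where "bimod_hom L R M N = {f \<in> add_hom M N.
    (\<forall>a\<in>carrier L. \<forall>x\<in>carrier M. f (lact M a x) = lact N a (f x)) \<and>
    (\<forall>a\<in>carrier R. \<forall>x\<in>carrier M. f (ract M x a) = ract N (f x) a)}"

lemma bimod_homI:
  assumes "f \<in> add_hom M N"
    and "\<And>a x. \<lbrakk>a \<in> carrier L; x \<in> carrier M\<rbrakk> \<Longrightarrow> f (lact M a x) = lact N a (f x)"
    and "\<And>a x. \<lbrakk>a \<in> carrier R; x \<in> carrier M\<rbrakk> \<Longrightarrow> f (ract M x a) = ract N (f x) a"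
  shows "f \<in> bimod_hom L R M N"
  using assms by (auto simp: bimod_hom_def)

lemma bimod_hom_add_hom: "f \<in> bimod_hom L R M N \<Longrightarrow> f \<in> add_hom M N"
  and bimod_hom_closed: "\<lbrakk>f \<in> bimod_hom L R M N; x \<in> carrier M\<rbrakk> \<Longrightarrow> f x \<in> carrier N"
  and bimod_hom_add: "\<lbrakk>f \<in> bimod_hom L R M N; x \<in> carrier M; y \<in> carrier M\<rbrakk>
    \<Longrightarrow> f (x \<oplus>\<^bsub>M\<^esub> y) = f x \<oplus>\<^bsub>N\<^esub> f y"
  and bimod_hom_lact: "\<lbrakk>f \<in> bimod_hom L R M N; a \<in> carrier L; x \<in> carrier M\<rbrakk>
    \<Longrightarrow> f (lact M a x) = lact N a (f x)"
  and bimod_hom_ract: "\<lbrakk>f \<in> bimod_hom L R M N; r \<in> carrier R; x \<in> carrier M\<rbrakk>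
    \<Longrightarrow> f (ract M x r) = ract N (f x) r"
  by (auto simp: bimod_hom_def add_hom_closed add_hom_add)

lemma bimod_hom_id: "(\<lambda>x. x) \<in> bimod_hom L R M M"
  by (simp add: bimod_hom_def add_hom_id)

lemma bimodule_restrict:
  assumes "bimodule L R M" "subring L' L" "subring R' R"
  shows "bimodule (L\<lparr>carrier := L'\<rparr>) (R\<lparr>carrier := R'\<rparr>) M"
proof -
  interpret bimodule L R M by fact
  interpret L': ring "L\<lparr>carrier := L'\<rparr>" by (rule L.subring_is_ring) fact
  interpret R': ring "R\<lparr>carrier := R'\<rparr>" by (rule R.subring_is_ring) fact
  note sub = subsetD[OF subringE(1)[OF assms(2)]] subsetD[OF subringE(1)[OF assms(3)]]
  show ?thesis
    by unfold_locales
      (simp_all add: sub lact_closed lact_add_left lact_add_right lact_mult lact_one ract_closed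
        ract_add_right ract_add_left ract_mult ract_one lact_ract)
qed


section \<open>The bimodule structure of the tensor powers\<close>

context ring_pair
begin

text \<open>A chosen induced map, so that it can be named in definitions. By
  \<open>tensor_hom_eq\<close> it is determined on the carrier, for abelian \<open>Q\<close> and
  balanced \<phi>.\<close>

definition tensor_lift :: "('q, 'd) ring_scheme \<Rightarrow> nat \<Rightarrow> ('a list \<Rightarrow> 'q) \<Rightarrow> ('a list \<Rightarrow>\<^sub>0 int) set \<Rightarrow> 'q"
  where "tensor_lift Q n \<phi> = (SOME h. h \<in> add_hom (T n) Q \<and>
    (\<forall>xs. length xs = n \<longrightarrow> set xs \<subseteq> carrier A \<longrightarrow> h (pure xs) = \<phi> xs))"

lemma tensor_lift:
  assumes "abelian_group Q" "balanced Q n \<phi>"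
  shows tensor_lift_hom: "tensor_lift Q n \<phi> \<in> add_hom (T n) Q"
    and tensor_lift_pure: "\<lbrakk>length xs = n; set xs \<subseteq> carrier A\<rbrakk> \<Longrightarrow> tensor_lift Q n \<phi> (pure xs) = \<phi> xs"
proof -
  have "\<exists>h. h \<in> add_hom (T n) Q \<and> (\<forall>xs. length xs = n \<longrightarrow> set xs \<subseteq> carrier A \<longrightarrow> h (pure xs) = \<phi> xs)"
    using tensor_universal[OF assms] by metis
  from someI_ex[OF this] show "tensor_lift Q n \<phi> \<in> add_hom (T n) Q"
    "\<lbrakk>length xs = n; set xs \<subseteq> carrier A\<rbrakk> \<Longrightarrow> tensor_lift Q n \<phi> (pure xs) = \<phi> xs"
    unfolding tensor_lift_def by blast+
qed

lemma tensor_class_rep: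
  assumes "Poly_Mapping.keys c \<subseteq> tuples A n"
  shows "c \<in> tensor_class B A n c"
    and "x \<in> tensor_class B A n c \<Longrightarrow> Poly_Mapping.keys x \<subseteq> tuples A n \<and>
      tensor_class B A n x = tensor_class B A n c"
proof -
  let ?F = "free_Abelian_group (tuples A n)"
  interpret F: comm_group ?F by (rule abelian_free_Abelian_group)
  show "c \<in> tensor_class B A n c"
    unfolding tensor_class_def using assms by (intro F.rcos_self tensor_null_subgroup) simp
  assume x: "x \<in> tensor_class B A n c"
  have "tensor_null B A n #>\<^bsub>?F\<^esub> c \<subseteq> carrier ?F"
    by (intro F.r_coset_subset_G subgroup.subset[OF tensor_null_subgroup]) (simp add: assms)
  then have "x \<in> carrier ?F"
    by (rule subsetD) (use x in \<open>simp add: tensor_class_def\<close>)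
  moreover have "tensor_null B A n #>\<^bsub>?F\<^esub> c = tensor_null B A n #>\<^bsub>?F\<^esub> x"
    using x assms unfolding tensor_class_def by (intro F.repr_independence tensor_null_subgroup) auto
  ultimately show "Poly_Mapping.keys x \<subseteq> tuples A n \<and> tensor_class B A n x = tensor_class B A n c"
    by (simp add: tensor_class_def)
qed

text \<open>The actions of \<open>tensor_power\<close> are unions over all representatives of a
  coset. When the operation on tuples induces an additive map \<open>h\<close>, every representative
  contributes the same coset, and the union collapses to the value of \<open>h\<close>.\<close>

lemma tensor_class_UN:
  assumes F: "\<And>xs. xs \<in> tuples A n \<Longrightarrow> F xs \<in> tuples A n"
    and h: "h \<in> add_hom (T n) (T n)" "\<And>xs. xs \<in> tuples A n \<Longrightarrow> h (pure xs) = pure (F xs)"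
    and u: "u \<in> carrier (T n)"
  shows "(\<Union>x\<in>u. tensor_class B A n (frag_extend (\<lambda>xs. frag_of (F xs)) x)) = h u"
proof -
  obtain c where c: "Poly_Mapping.keys c \<subseteq> tuples A n" "u = tensor_class B A n c"
    using u by (auto simp: tensor_power_simps)
  have k: "Poly_Mapping.keys (frag_extend (\<lambda>xs. frag_of (F xs)) x) \<subseteq> tuples A n"
    if "Poly_Mapping.keys x \<subseteq> tuples A n" for x
    using that keys_frag_extend[of "\<lambda>xs. frag_of (F xs)" x] F by (force simp: keys_frag_of)
  have "tensor_class B A n (frag_extend (\<lambda>xs. frag_of (F xs)) x) = h (tensor_class B A n x)"
    if x: "Poly_Mapping.keys x \<subseteq> tuples A n" for x
  proof (rule free_hom_eq[OF abelian_group_T _ _ _ x])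
    show "(\<lambda>x. tensor_class B A n (frag_extend (\<lambda>xs. frag_of (F xs)) x))
        \<in> hom (free_Abelian_group (tuples A n)) (add_monoid (T n))"
      by (simp add: hom_def k tensor_class_closed frag_extend_add tensor_class_add)
    show "(\<lambda>x. h (tensor_class B A n x)) \<in> hom (free_Abelian_group (tuples A n)) (add_monoid (T n))"
      using h(1) by (auto simp: hom_def add_hom_closed add_hom_add tensor_class_closed tensor_class_add)
    show "tensor_class B A n (frag_extend (\<lambda>xs. frag_of (F xs)) (frag_of xs))
      = h (tensor_class B A n (frag_of xs))"
      if "xs \<in> tuples A n" for xs
      using h(2)[OF that] F[OF that] that by (simp add: pure_def tuples_def)
  qed
  then have "tensor_class B A n (frag_extend (\<lambda>xs. frag_of (F xs)) x) = h u" if "x \<in> u" for x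
    using tensor_class_rep(2)[OF c(1)] that c(2) by simp
  then show ?thesis
    using tensor_class_rep(1)[OF c(1)] c(2) by auto
qed

text \<open>The scalar touches only the first factor. In the checks of \<open>balanced\<close>, the
  split on \<open>xs\<close> asks whether the tested slot is that first one; there distributivity or
  associativity is used, and elsewhere the relation holds behind the modified factor.\<close>

lemma lact_T:
  assumes n: "n \<ge> 1" and a: "a \<in> carrier A"
  shows lact_T_hom: "(\<lambda>u. lact (T n) a u) \<in> add_hom (T n) (T n)"
    and lact_T_pure: "\<lbrakk>length xs + 1 = n; x \<in> carrier A; set xs \<subseteq> carrier A\<rbrakk>
      \<Longrightarrow> lact (T n) a (pure (x # xs)) = pure ((a \<otimes> x) # xs)"
proof -
  define \<phi> where "\<phi> xs = pure ((a \<otimes> hd xs) # tl xs)" for xs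
  have F: "(a \<otimes> hd xs) # tl xs \<in> tuples A n" if "xs \<in> tuples A n" for xs
    using that n a by (cases xs) (auto simp: tuples_def)
  have "balanced (T n) n \<phi>"
  proof (rule balancedI)
    fix xs assume "xs \<in> tuples A n"
    then show "\<phi> xs \<in> carrier (T n)"
      using F[of xs] by (auto simp: \<phi>_def tuples_def intro!: pure_closed)
  next
    fix xs b c ys
    assume *: "length xs + length ys + 1 = n" "set xs \<subseteq> carrier A" "set ys \<subseteq> carrier A" "b \<in> carrier A"
      "c \<in> carrier A"
    then show "\<phi> (xs @ (b \<oplus> c) # ys) = \<phi> (xs @ b # ys) \<oplus>\<^bsub>T n\<^esub> \<phi> (xs @ c # ys)"
      using a pure_add[of "[]" ys "a \<otimes> b" "a \<otimes> c" n] pure_add[of "(a \<otimes> hd xs) # tl xs" ys b c n]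
      by (cases xs) (auto simp: \<phi>_def r_distr)
  next
    fix xs b c d ys
    assume *: "length xs + length ys + 2 = n" "set xs \<subseteq> carrier A" "set ys \<subseteq> carrier A" "b \<in> carrier A"
      "d \<in> carrier A" "c \<in> B"
    then show "\<phi> (xs @ (b \<otimes> c) # d # ys) = \<phi> (xs @ b # (c \<otimes> d) # ys)"
      using a pure_balance[of "[]" ys "a \<otimes> b" d c] pure_balance[of "(a \<otimes> hd xs) # tl xs" ys b d c]
      by (cases xs) (auto simp: \<phi>_def m_assoc B_closed)
  qed
  note lift = tensor_lift[OF abelian_group_T this]
  have eq: "lact (T n) a u = tensor_lift (T n) n \<phi> u" if "u \<in> carrier (T n)" for u
    using tensor_class_UN[OF F lift(1) _ that, simplified tuples_def] lift(2)
    by (simp add: tensor_power_def Let_def \<phi>_def)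
  show "(\<lambda>u. lact (T n) a u) \<in> add_hom (T n) (T n)"
    using lift(1) abelian_groupE(1)[OF abelian_group_T]
      by (auto intro!: add_homI simp: eq add_hom_closed add_hom_add)
  assume "length xs + 1 = n" "x \<in> carrier A" "set xs \<subseteq> carrier A"
  then show "lact (T n) a (pure (x # xs)) = pure ((a \<otimes> x) # xs)"
    using lift(2)[of "x # xs"] eq[OF pure_closed, of "x # xs"] by (simp add: \<phi>_def)
qed

lemma ract_T:
  assumes n: "n \<ge> 1" and a: "a \<in> carrier A"
  shows ract_T_hom: "(\<lambda>u. ract (T n) u a) \<in> add_hom (T n) (T n)"
    and ract_T_pure: "\<lbrakk>length xs + 1 = n; x \<in> carrier A; set xs \<subseteq> carrier A\<rbrakk>
      \<Longrightarrow> ract (T n) (pure (xs @ [x])) a = pure (xs @ [x \<otimes> a])"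
proof -
  define \<phi> where "\<phi> xs = pure (butlast xs @ [last xs \<otimes> a])" for xs
  have F: "butlast xs @ [last xs \<otimes> a] \<in> tuples A n" if "xs \<in> tuples A n" for xs
    using that n a by (cases xs rule: rev_cases) (auto simp: tuples_def)
  have "balanced (T n) n \<phi>"
  proof (rule balancedI)
    fix xs assume "xs \<in> tuples A n"
    then show "\<phi> xs \<in> carrier (T n)"
      using F[of xs] by (auto simp: \<phi>_def tuples_def intro!: pure_closed)
  next
    fix xs b c ys
    assume *: "length xs + length ys + 1 = n" "set xs \<subseteq> carrier A" "set ys \<subseteq> carrier A" "b \<in> carrier A"
      "c \<in> carrier A"
    then show "\<phi> (xs @ (b \<oplus> c) # ys) = \<phi> (xs @ b # ys) \<oplus>\<^bsub>T n\<^esub> \<phi> (xs @ c # ys)"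
      using a pure_add[of xs "[]" "b \<otimes> a" "c \<otimes> a" n] pure_add[of xs "butlast ys @ [last ys \<otimes> a]" b c n]
      by (cases ys rule: rev_cases) (auto simp: \<phi>_def l_distr butlast_append)
  next
    fix xs b c d ys
    assume *: "length xs + length ys + 2 = n" "set xs \<subseteq> carrier A" "set ys \<subseteq> carrier A" "b \<in> carrier A"
      "d \<in> carrier A" "c \<in> B"
    then show "\<phi> (xs @ (b \<otimes> c) # d # ys) = \<phi> (xs @ b # (c \<otimes> d) # ys)"
      using a pure_balance[of xs "[]" b "d \<otimes> a" c] pure_balance[of xs "butlast ys @ [last ys \<otimes> a]" b d c]
      by (cases ys rule: rev_cases) (auto simp: \<phi>_def m_assoc B_closed butlast_append)
  qed
  note lift = tensor_lift[OF abelian_group_T this]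
  have eq: "ract (T n) u a = tensor_lift (T n) n \<phi> u" if "u \<in> carrier (T n)" for u
    using tensor_class_UN[OF F lift(1) _ that, simplified tuples_def] lift(2)
    by (simp add: tensor_power_def Let_def \<phi>_def)
  show "(\<lambda>u. ract (T n) u a) \<in> add_hom (T n) (T n)"
    using lift(1) abelian_groupE(1)[OF abelian_group_T]
      by (auto intro!: add_homI simp: eq add_hom_closed add_hom_add)
  assume "length xs + 1 = n" "x \<in> carrier A" "set xs \<subseteq> carrier A"
  then show "ract (T n) (pure (xs @ [x])) a = pure (xs @ [x \<otimes> a])"
    using lift(2)[of "xs @ [x]"] eq[OF pure_closed, of "xs @ [x]"] by (simp add: \<phi>_def)
qed

section \<open>The bimodule axioms for tensor powers\<close>

lemma pure_Cons_add:
  assumes "set xs \<subseteq> carrier A" "a \<in> carrier A" "a' \<in> carrier A" "n = Suc (length xs)"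
  shows "pure ((a \<oplus> a') # xs) = pure (a # xs) \<oplus>\<^bsub>T n\<^esub> pure (a' # xs)"
  using pure_add[of "[]" xs a a' n] assms by simp

lemma pure_snoc_add:
  assumes "set xs \<subseteq> carrier A" "a \<in> carrier A" "a' \<in> carrier A" "n = Suc (length xs)"
  shows "pure (xs @ [a \<oplus> a']) = pure (xs @ [a]) \<oplus>\<^bsub>T n\<^esub> pure (xs @ [a'])"
  using pure_add[of xs "[]" a a' n] assms by simp

lemma tensor_hom_eq_Cons:
  assumes "abelian_group Q" "f \<in> add_hom (T (Suc n)) Q" "g \<in> add_hom (T (Suc n)) Q"
    and "\<And>x xs. \<lbrakk>length xs = n; x \<in> carrier A; set xs \<subseteq> carrier A\<rbrakk> \<Longrightarrow> f (pure (x # xs)) = g (pure (x # xs))"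
    and "u \<in> carrier (T (Suc n))"
  shows "f u = g u"
  by (rule tensor_hom_eq[OF assms(1-3) _ assms(5)]) (auto simp: length_Suc_conv assms(4))

lemma tensor_hom_eq_snoc:
  assumes "abelian_group Q" "f \<in> add_hom (T (Suc n)) Q" "g \<in> add_hom (T (Suc n)) Q"
    and "\<And>x xs. \<lbrakk>length xs = n; x \<in> carrier A; set xs \<subseteq> carrier A\<rbrakk> \<Longrightarrow> f (pure (xs @ [x]))
      = g (pure (xs @ [x]))"
    and "u \<in> carrier (T (Suc n))"
  shows "f u = g u"
  by (rule tensor_hom_eq[OF assms(1-3) _ assms(5)]) (auto simp: length_Suc_conv_rev assms(4))

text \<open>Only positive lengths are covered: \<open>T 0\<close> is the free abelian group on the
  empty tuple, has no factor to act on, and is not the 0-th tensor power \<open>B\<close>, whose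
  place is taken by \<open>regular_bimodule\<close>.\<close>

lemma bimodule_T: "bimodule A A (T (Suc n))"
proof -
  interpret T: abelian_group "T (Suc n)" by (rule abelian_group_T)
  note hom = lact_T_hom[of "Suc n"] ract_T_hom[of "Suc n"]
  note cl = add_hom_closed[OF hom(1)] add_hom_closed[OF hom(2)]
  note eqs = lact_T_pure ract_T_pure
  note E = tensor_hom_eq_Cons[OF abelian_group_T] and E' = tensor_hom_eq_snoc[OF abelian_group_T]
  show ?thesis
  proof unfold_locales
    fix a b x assume a: "a \<in> carrier A" "b \<in> carrier A" and x: "x \<in> carrier (T (Suc n))"
    show "lact (T (Suc n)) (a \<oplus> b) x = lact (T (Suc n)) a x \<oplus>\<^bsub>T (Suc n)\<^esub> lact (T (Suc n)) b x"
      by (rule E[OF _ _ _ x]) (use a in \<open>auto intro!: hom add_hom_sum abelian_group_T simp: eqs pure_Cons_add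
        l_distr\<close>)
    show "lact (T (Suc n)) (a \<otimes> b) x = lact (T (Suc n)) a (lact (T (Suc n)) b x)"
      by (rule E[OF _ _ _ x]) (use a in \<open>auto intro!: hom add_hom_compose[OF hom(1) hom(1)]
        simp: eqs m_assoc\<close>)
    show "ract (T (Suc n)) x (a \<oplus> b) = ract (T (Suc n)) x a \<oplus>\<^bsub>T (Suc n)\<^esub> ract (T (Suc n)) x b"
      by (rule E'[OF _ _ _ x]) (use a in \<open>auto intro!: hom add_hom_sum abelian_group_T simp: eqs pure_snoc_add
        r_distr\<close>)
    show "ract (T (Suc n)) x (a \<otimes> b) = ract (T (Suc n)) (ract (T (Suc n)) x a) b"
      by (rule E'[OF _ _ _ x]) (use a in \<open>auto intro!: hom add_hom_compose[OF hom(2) hom(2)]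
        simp: eqs m_assoc\<close>)
    show "ract (T (Suc n)) (lact (T (Suc n)) a x) b = lact (T (Suc n)) a (ract (T (Suc n)) x b)"
    proof (rule E[OF _ _ _ x])
      fix y ys assume y: "length ys = n" "y \<in> carrier A" "set ys \<subseteq> carrier A"
      show "ract (T (Suc n)) (lact (T (Suc n)) a (pure (y # ys))) b
        = lact (T (Suc n)) a (ract (T (Suc n)) (pure (y # ys)) b)"
      \<comment> \<open>With a single factor the two actions meet in it and commute by
        associativity; otherwise they touch different factors.\<close>
      proof (cases ys rule: rev_cases)
        case Nil
        then show ?thesis using a y ract_T_pure[of "Suc n" b "[]"] by (simp add: eqs m_assoc)
      next
        case (snoc zs z)
        then show ?thesis using a y lact_T_pure[of "Suc n" a "zs @ [z]"]
          lact_T_pure[of "Suc n" a "zs @ [z \<otimes> b]"]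
          ract_T_pure[of "Suc n" b "(a \<otimes> y) # zs"] ract_T_pure[of "Suc n" b "y # zs"]
          by simp
      qed
    qed (use a in \<open>auto intro!: add_hom_compose[OF hom(2) hom(1)] add_hom_compose[OF hom(1) hom(2)]\<close>)
  next
    fix x assume x: "x \<in> carrier (T (Suc n))"
    show "lact (T (Suc n)) \<one> x = x"
      by (rule E[OF _ _ _ x]) (auto intro!: hom add_hom_id simp: eqs)
    show "ract (T (Suc n)) x \<one> = x"
      by (rule E'[OF _ _ _ x]) (auto intro!: hom add_hom_id simp: eqs)
  qed (use cl add_hom_add[OF hom(1)] add_hom_add[OF hom(2)] in auto)
qed

abbreviation BB :: "('a, 'b) ring_scheme"
  where "BB \<equiv> A\<lparr>carrier := B\<rparr>"

lemma bimodule_T_BB: "bimodule BB BB (T (Suc n))"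
  by (rule bimodule_restrict[OF bimodule_T B_subring B_subring])

end

section \<open>Divisibility and sums of compositions\<close>

lemma bimod_copies_simps [simp]:
  "carrier (bimod_copies k M) = {..<k} \<rightarrow>\<^sub>E carrier M"
  "\<zero>\<^bsub>bimod_copies k M\<^esub> = (\<lambda>i\<in>{..<k}. \<zero>\<^bsub>M\<^esub>)"
  "x \<oplus>\<^bsub>bimod_copies k M\<^esub> y = (\<lambda>i\<in>{..<k}. x i \<oplus>\<^bsub>M\<^esub> y i)"
  "lact (bimod_copies k M) a x = (\<lambda>i\<in>{..<k}. lact M a (x i))"
  "ract (bimod_copies k M) x r = (\<lambda>i\<in>{..<k}. ract M (x i) r)"
  by (simp_all add: bimod_copies_def)

lemma bimod_sum_simps [simp]:
  "carrier (bimod_sum M N) = carrier M \<times> carrier N"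
  "(x, y) \<oplus>\<^bsub>bimod_sum M N\<^esub> (x', y') = (x \<oplus>\<^bsub>M\<^esub> x', y \<oplus>\<^bsub>N\<^esub> y')"
  "lact (bimod_sum M N) a (x, y) = (lact M a x, lact N a y)"
  "ract (bimod_sum M N) (x, y) r = (ract M x r, ract N y r)"
  by (simp_all add: bimod_sum_def)

lemma bimodule_lact_hom: "\<lbrakk>bimodule L R M; a \<in> carrier L\<rbrakk> \<Longrightarrow> (\<lambda>x. lact M a x) \<in> add_hom M M"
  and bimodule_ract_hom: "\<lbrakk>bimodule L R M; r \<in> carrier R\<rbrakk> \<Longrightarrow> (\<lambda>x. ract M x r) \<in> add_hom M M"
  by (auto intro!: add_homI simp: bimodule.lact_closed bimodule.lact_add_right bimodule.ract_closed
      bimodule.ract_add_left)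

lemma bimodule_abelian_group: "bimodule L R M \<Longrightarrow> abelian_group M"
  by (rule bimodule.axioms(3))

lemma lact_zero: "\<lbrakk>bimodule L R M; a \<in> carrier L\<rbrakk> \<Longrightarrow> lact M a \<zero>\<^bsub>M\<^esub> = \<zero>\<^bsub>M\<^esub>"
  by (rule add_hom_zero[OF bimodule_abelian_group bimodule_abelian_group bimodule_lact_hom])

lemma ract_zero: "\<lbrakk>bimodule L R M; r \<in> carrier R\<rbrakk> \<Longrightarrow> ract M \<zero>\<^bsub>M\<^esub> r = \<zero>\<^bsub>M\<^esub>"
  by (rule add_hom_zero[OF bimodule_abelian_group bimodule_abelian_group bimodule_ract_hom])

lemma bimodule_copies:
  assumes "bimodule L R M"
  shows "bimodule L R (bimod_copies k M)"
proof -
  interpret bimodule L R M by fact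
  have cl: "x i \<in> carrier M" if "x \<in> {..<k} \<rightarrow>\<^sub>E carrier M" "i < k" for x i
    using that by auto
  have ext: "(\<lambda>i\<in>{..<k}. x i) = x" if "x \<in> {..<k} \<rightarrow>\<^sub>E carrier M" for x
    using that by (simp add: PiE_restrict)
  have "abelian_group (bimod_copies k M)"
  proof (rule abelian_groupI)
    fix x assume x: "x \<in> carrier (bimod_copies k M)"
    show "\<exists>y\<in>carrier (bimod_copies k M). y \<oplus>\<^bsub>bimod_copies k M\<^esub> x = \<zero>\<^bsub>bimod_copies k M\<^esub>"
      by (rule bexI[of _ "\<lambda>i\<in>{..<k}. \<ominus>\<^bsub>M\<^esub> x i"]) (use x cl in \<open>auto simp: l_neg intro!: restrict_ext\<close>)
    show "\<zero>\<^bsub>bimod_copies k M\<^esub> \<oplus>\<^bsub>bimod_copies k M\<^esub> x = x"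
      using x cl by (simp add: ext cong: restrict_cong)
    fix y assume y: "y \<in> carrier (bimod_copies k M)"
    show "x \<oplus>\<^bsub>bimod_copies k M\<^esub> y \<in> carrier (bimod_copies k M)"
      using x y cl by (simp add: restrict_PiE_iff)
    show "x \<oplus>\<^bsub>bimod_copies k M\<^esub> y = y \<oplus>\<^bsub>bimod_copies k M\<^esub> x"
      using x y cl by (simp add: a_comm cong: restrict_cong)
    fix z assume z: "z \<in> carrier (bimod_copies k M)"
    show "x \<oplus>\<^bsub>bimod_copies k M\<^esub> y \<oplus>\<^bsub>bimod_copies k M\<^esub> z
        = x \<oplus>\<^bsub>bimod_copies k M\<^esub> (y \<oplus>\<^bsub>bimod_copies k M\<^esub> z)"
      using x y z cl by (simp add: a_assoc cong: restrict_cong)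
  qed (simp add: restrict_PiE_iff)
  then interpret C: abelian_group "bimod_copies k M" .
  show ?thesis
    by unfold_locales
      (auto simp: cl lact_closed lact_add_left lact_add_right lact_mult lact_one ract_closed
        ract_add_right ract_add_left ract_mult ract_one lact_ract ext cong: restrict_cong)
qed

text \<open>The complement of a retract is the kernel of the retraction.\<close>

lemma bimod_divides_iff:
  assumes "bimodule L R M" "bimodule L R N"
  shows "bimod_divides L R M N \<longleftrightarrow>
    (\<exists>f\<in>bimod_hom L R M N. \<exists>g\<in>bimod_hom L R N M. \<forall>x\<in>carrier M. g (f x) = x)"
    (is "_ \<longleftrightarrow> ?rhs")
proof
  interpret M: bimodule L R M by fact
  interpret N: bimodule L R N by fact
  {
    assume "bimod_divides L R M N"
    then obtain M' :: "('a, 'c, 'f) bimodule" and F where "bimodule L R M'"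
      and F: "F \<in> bimod_iso L R N (bimod_sum M M')"
      unfolding bimod_divides_def by blast
    interpret M': bimodule L R M' by fact
    define G where "G = inv_into (carrier N) F"
    have bij: "bij_betw F (carrier N) (carrier M \<times> carrier M')"
      and Fadd: "\<And>x y. \<lbrakk>x \<in> carrier N; y \<in> carrier N\<rbrakk> \<Longrightarrow> F (x \<oplus>\<^bsub>N\<^esub> y) = F x \<oplus>\<^bsub>bimod_sum M M'\<^esub> F y"
      and Fl: "\<And>a x. \<lbrakk>a \<in> carrier L; x \<in> carrier N\<rbrakk> \<Longrightarrow> F (lact N a x) = lact (bimod_sum M M') a (F x)"
      and Fr: "\<And>a x. \<lbrakk>a \<in> carrier R; x \<in> carrier N\<rbrakk> \<Longrightarrow> F (ract N x a) = ract (bimod_sum M M') (F x) a"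
      using F by (auto simp: bimod_iso_def)
    have Fcl: "F x \<in> carrier M \<times> carrier M'" if "x \<in> carrier N" for x
      using bij that by (auto simp: bij_betw_def)
    have G: "G z \<in> carrier N" "F (G z) = z" if "z \<in> carrier M \<times> carrier M'" for z
      using bij that unfolding G_def bij_betw_def by (auto intro: inv_into_into f_inv_into_f)
    have GF: "G z = x" if "x \<in> carrier N" "F x = z" for x z
      using bij that unfolding G_def bij_betw_def by (auto intro: inv_into_f_f)
    let ?z = "\<zero>\<^bsub>M'\<^esub>"
    have "(\<lambda>x. G (x, ?z)) \<in> bimod_hom L R M N"
    proof (intro bimod_homI add_homI)
      fix x y assume "x \<in> carrier M" "y \<in> carrier M"
      then show "G (x \<oplus>\<^bsub>M\<^esub> y, ?z) = G (x, ?z) \<oplus>\<^bsub>N\<^esub> G (y, ?z)"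
        by (intro GF) (simp_all add: G Fadd)
    next
      fix a x assume "a \<in> carrier L" "x \<in> carrier M"
      then show "G (lact M a x, ?z) = lact N a (G (x, ?z))"
        by (intro GF) (simp_all add: G Fl N.lact_closed lact_zero[OF \<open>bimodule L R M'\<close>])
    next
      fix a x assume "a \<in> carrier R" "x \<in> carrier M"
      then show "G (ract M x a, ?z) = ract N (G (x, ?z)) a"
        by (intro GF) (simp_all add: G Fr N.ract_closed ract_zero[OF \<open>bimodule L R M'\<close>])
    qed (simp add: G)
    moreover have "(\<lambda>y. fst (F y)) \<in> bimod_hom L R N M"
    proof (intro bimod_homI add_homI)
      show "fst (F y) \<in> carrier M" if "y \<in> carrier N" for y
        using Fcl[OF that] by auto
      show "fst (F (x \<oplus>\<^bsub>N\<^esub> y)) = fst (F x) \<oplus>\<^bsub>M\<^esub> fst (F y)" if "x \<in> carrier N" "y \<in> carrier N" for x y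
        using Fadd[OF that] by (cases "F x"; cases "F y") simp
      show "fst (F (lact N a x)) = lact M a (fst (F x))" if "a \<in> carrier L" "x \<in> carrier N" for a x
        using Fl[OF that] by (cases "F x") simp
      show "fst (F (ract N x a)) = ract M (fst (F x)) a" if "a \<in> carrier R" "x \<in> carrier N" for a x
        using Fr[OF that] by (cases "F x") simp
    qed
    moreover have "\<forall>x\<in>carrier M. fst (F (G (x, ?z))) = x"
      by (simp add: G)
    ultimately show ?rhs
      by (intro bexI[of _ "\<lambda>x. G (x, ?z)"] bexI[of _ "\<lambda>y. fst (F y)"])
  }
  assume ?rhs
  then obtain f g where f: "f \<in> bimod_hom L R M N" and g: "g \<in> bimod_hom L R N M"
    and gf: "\<And>x. x \<in> carrier M \<Longrightarrow> g (f x) = x" by blast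
  note fs = bimod_hom_closed[OF f] bimod_hom_add[OF f] bimod_hom_lact[OF f] bimod_hom_ract[OF f]
  note gs = bimod_hom_closed[OF g] bimod_hom_add[OF g] bimod_hom_lact[OF g] bimod_hom_ract[OF g]
  have ab: "abelian_group M" "abelian_group N" by unfold_locales
  note z = add_hom_zero[OF ab(1,2) bimod_hom_add_hom[OF f]] add_hom_zero[OF ab(2,1) bimod_hom_add_hom[OF g]]
  note neg = add_hom_neg[OF ab(1,2) bimod_hom_add_hom[OF f]] add_hom_neg[OF ab(2,1) bimod_hom_add_hom[OF g]]
  define K where "K = N\<lparr>carrier := {y \<in> carrier N. g y = \<zero>\<^bsub>M\<^esub>}\<rparr>"
  have K [simp]: "y \<in> carrier K \<longleftrightarrow> y \<in> carrier N \<and> g y = \<zero>\<^bsub>M\<^esub>" "add K = add N" "\<zero>\<^bsub>K\<^esub> = \<zero>\<^bsub>N\<^esub>"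
    "lact K = lact N" "ract K = ract N" for y
    by (auto simp: K_def)
  have "abelian_group K"
  proof (rule abelian_groupI)
    fix x assume "x \<in> carrier K"
    then show "\<exists>y\<in>carrier K. y \<oplus>\<^bsub>K\<^esub> x = \<zero>\<^bsub>K\<^esub>"
      by (intro bexI[of _ "\<ominus>\<^bsub>N\<^esub> x"]) (auto simp: N.l_neg neg)
  qed (auto simp: gs z N.a_ac)
  then interpret K: abelian_group K .
  note lact_neg = add_hom_neg[OF ab(2,2) bimodule_lact_hom[OF assms(2)]]
    and ract_neg = add_hom_neg[OF ab(2,2) bimodule_ract_hom[OF assms(2)]]
  have bK: "bimodule L R K"
    by unfold_locales
      (auto simp: gs N.lact_closed N.lact_add_left N.lact_add_right N.lact_mult N.lact_one N.ract_closed
        N.ract_add_right N.ract_add_left N.ract_mult N.ract_one N.lact_ract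
        lact_zero[OF assms(1)] ract_zero[OF assms(1)])
  \<comment> \<open>The idempotent \<open>f\<close> after \<open>g\<close> splits \<open>y\<close>
    into \<open>f (g y)\<close>, recorded by \<open>g y\<close>, and a remainder in the kernel of
    \<open>g\<close>.\<close>
  define F where "F y = (g y, y \<oplus>\<^bsub>N\<^esub> \<ominus>\<^bsub>N\<^esub> f (g y))" for y
  have "bij_betw F (carrier N) (carrier (bimod_sum M K))"
  proof (rule bij_betw_byWitness[where f' = "\<lambda>(x, k). f x \<oplus>\<^bsub>N\<^esub> k"])
    show "\<forall>y\<in>carrier N. (case F y of (x, k) \<Rightarrow> f x \<oplus>\<^bsub>N\<^esub> k) = y"
      by (auto simp: F_def fs gs) (metis N.a_assoc N.a_comm N.a_inv_closed N.r_neg N.r_zero bimod_hom_closed f g)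
    show "\<forall>z\<in>carrier (bimod_sum M K). F (case z of (x, k) \<Rightarrow> f x \<oplus>\<^bsub>N\<^esub> k) = z"
      by (auto simp: F_def fs gs gf)
        (metis N.a_assoc N.a_comm N.a_inv_closed N.r_neg N.r_zero bimod_hom_closed f)
    show "F ` carrier N \<subseteq> carrier (bimod_sum M K)"
      by (auto simp: F_def fs gs gf neg M.r_neg)
    show "(\<lambda>(x, k). f x \<oplus>\<^bsub>N\<^esub> k) ` carrier (bimod_sum M K) \<subseteq> carrier N"
      by (auto simp: fs)
  qed
  moreover have "F (x \<oplus>\<^bsub>N\<^esub> y) = F x \<oplus>\<^bsub>bimod_sum M K\<^esub> F y" if "x \<in> carrier N" "y \<in> carrier N" for x y
    using that by (simp add: F_def fs gs N.minus_add N.a_ac)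
  moreover have "F (lact N a x) = lact (bimod_sum M K) a (F x)" if "a \<in> carrier L" "x \<in> carrier N" for a x
    using that by (simp add: F_def fs gs N.lact_add_right N.lact_closed lact_neg)
  moreover have "F (ract N x a) = ract (bimod_sum M K) (F x) a" if "a \<in> carrier R" "x \<in> carrier N" for a x
    using that by (simp add: F_def fs gs N.ract_add_left N.ract_closed ract_neg)
  ultimately have "F \<in> bimod_iso L R N (bimod_sum M K)"
    by (simp add: bimod_iso_def)
  with bK show "bimod_divides L R M N"
    unfolding bimod_divides_def by blast
qed

text \<open>The additive closure of the endomorphisms of \<open>M\<close> that pass through
  \<open>N\<close>; additive inverses need no rule, since the negative of a homomorphism is one. The
  rule \<open>ext\<close> is there because maps matter only on the carrier. Being inductive, the
  notion can be transported along additive constructions rule by rule.\<close>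

inductive factors ::
  "('l, 'a) ring_scheme \<Rightarrow> ('r, 'b) ring_scheme \<Rightarrow> ('l, 'r, 'm) bimodule \<Rightarrow> ('l, 'r, 'n) bimodule
    \<Rightarrow> ('m \<Rightarrow> 'm) \<Rightarrow> bool"
  for L R M N where
    comp: "\<lbrakk>f \<in> bimod_hom L R M N; g \<in> bimod_hom L R N M\<rbrakk> \<Longrightarrow> factors L R M N (\<lambda>x. g (f x))"
  | add: "\<lbrakk>factors L R M N h; factors L R M N k\<rbrakk> \<Longrightarrow> factors L R M N (\<lambda>x. h x \<oplus>\<^bsub>M\<^esub> k x)"
  | ext: "\<lbrakk>factors L R M N h; \<forall>x\<in>carrier M. k x = h x\<rbrakk> \<Longrightarrow> factors L R M N k"

lemma factors_add_hom:
  assumes "factors L R M N h" "abelian_group M"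
  shows "h \<in> add_hom M M"
  using assms(1)
proof induction
  case (comp f g)
  then show ?case by (rule add_hom_compose[OF bimod_hom_add_hom bimod_hom_add_hom])
next
  case (add h k)
  then show ?case by (intro add_hom_sum assms(2))
next
  case (ext h k)
  interpret abelian_group M by fact
  show ?case using ext by (auto intro!: add_homI simp: add_hom_closed add_hom_add)
qed

text \<open>A sum of compositions through \<open>N\<close> is one composition through several copies
  of \<open>N\<close>: collect the first maps into a vector and add up the second maps.\<close>

lemma factors_imp_copies:
  assumes "factors L R M N h" and M: "bimodule L R M" and N: "bimodule L R N"
  obtains r f g where "r \<ge> 1" "f \<in> bimod_hom L R M (bimod_copies r N)"
    "g \<in> bimod_hom L R (bimod_copies r N) M" "\<And>x. x \<in> carrier M \<Longrightarrow> h x = g (f x)"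
proof -
  interpret M: bimodule L R M by fact
  interpret N: bimodule L R N by fact
  have "\<exists>r\<ge>1. \<exists>f\<in>bimod_hom L R M (bimod_copies r N). \<exists>g\<in>bimod_hom L R (bimod_copies r N) M.
      \<forall>x\<in>carrier M. h x = g (f x)"
    using assms(1)
  proof induction
    case (comp f g)
    note fs = bimod_hom_closed[OF comp(1)] bimod_hom_add[OF comp(1)] bimod_hom_lact[OF comp(1)]
      bimod_hom_ract[OF comp(1)]
    note gs = bimod_hom_closed[OF comp(2)] bimod_hom_add[OF comp(2)] bimod_hom_lact[OF comp(2)]
      bimod_hom_ract[OF comp(2)]
    have "(\<lambda>x. \<lambda>i\<in>{..<1}. f x) \<in> bimod_hom L R M (bimod_copies 1 N)"
      by (intro bimod_homI add_homI) (auto simp: fs intro!: restrict_ext)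
    moreover have "(\<lambda>v. g (v 0)) \<in> bimod_hom L R (bimod_copies 1 N) M"
      by (intro bimod_homI add_homI) (auto simp: gs PiE_iff)
    ultimately show ?case
      by (intro exI[of _ 1] conjI bexI[of _ "\<lambda>x. \<lambda>i\<in>{..<1}. f x"] bexI[of _ "\<lambda>v. g (v 0)"]) auto
  next
    case (add h k)
    obtain r f g where 1: "r \<ge> 1" "f \<in> bimod_hom L R M (bimod_copies r N)"
      "g \<in> bimod_hom L R (bimod_copies r N) M" "\<And>x. x \<in> carrier M \<Longrightarrow> h x = g (f x)"
      using add.IH(1) by blast
    obtain s f' g' where 2: "s \<ge> 1" "f' \<in> bimod_hom L R M (bimod_copies s N)"
      "g' \<in> bimod_hom L R (bimod_copies s N) M" "\<And>x. x \<in> carrier M \<Longrightarrow> k x = g' (f' x)"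
      using add.IH(2) by blast
    \<comment> \<open>Concatenation of the two vectors: the first \<open>r\<close> coordinates
      belong to \<open>f\<close>, the remaining \<open>s\<close>, shifted by \<open>r\<close>, to
      \<open>f'\<close>. \<open>G\<close> cuts the vector again and adds the results.\<close>
    define F where "F x = (\<lambda>i\<in>{..<r+s}. if i < r then f x i else f' x (i - r))" for x
    define G where "G v = g (\<lambda>i\<in>{..<r}. v i) \<oplus>\<^bsub>M\<^esub> g' (\<lambda>i\<in>{..<s}. v (r + i))" for v
    have fcl: "i < r \<Longrightarrow> f x i \<in> carrier N" "i < s \<Longrightarrow> f' x i \<in> carrier N" if "x \<in> carrier M" for x i
      using bimod_hom_closed[OF 1(2) that] bimod_hom_closed[OF 2(2) that] by auto
    have "F \<in> bimod_hom L R M (bimod_copies (r + s) N)"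
    proof (intro bimod_homI add_homI)
      show "F x \<in> carrier (bimod_copies (r + s) N)" if "x \<in> carrier M" for x
        using fcl[OF that] by (auto simp: F_def)
    qed (auto simp: F_def bimod_hom_add[OF 1(2)] bimod_hom_add[OF 2(2)] bimod_hom_lact[OF 1(2)]
        bimod_hom_lact[OF 2(2)] bimod_hom_ract[OF 1(2)] bimod_hom_ract[OF 2(2)] intro!: restrict_ext)
    moreover have "G \<in> bimod_hom L R (bimod_copies (r + s) N) M"
    proof -
      let ?p = "\<lambda>v. \<lambda>i\<in>{..<r}. v i" and ?q = "\<lambda>v. \<lambda>i\<in>{..<s}. v (r + i)"
      have pq: "?p \<in> bimod_hom L R (bimod_copies (r + s) N) (bimod_copies r N)"
        "?q \<in> bimod_hom L R (bimod_copies (r + s) N) (bimod_copies s N)"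
        by (intro bimod_homI add_homI; auto intro!: restrict_ext simp: PiE_iff)+
      note gcl = bimod_hom_closed[OF 1(3) bimod_hom_closed[OF pq(1)]]
        bimod_hom_closed[OF 2(3) bimod_hom_closed[OF pq(2)]]
      show ?thesis
      proof (rule bimod_homI)
        show "G \<in> add_hom (bimod_copies (r + s) N) M"
          unfolding G_def
          by (intro add_hom_sum add_hom_compose[OF bimod_hom_add_hom[OF pq(1)] bimod_hom_add_hom[OF 1(3)]]
              add_hom_compose[OF bimod_hom_add_hom[OF pq(2)] bimod_hom_add_hom[OF 2(3)]]
                M.abelian_group_axioms)
        show "G (lact (bimod_copies (r + s) N) a v) = lact M a (G v)"
          if "a \<in> carrier L" "v \<in> carrier (bimod_copies (r + s) N)" for a v
          unfolding G_def bimod_hom_lact[OF pq(1) that] bimod_hom_lact[OF pq(2) that]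
          by (simp only: bimod_hom_lact[OF 1(3) that(1) bimod_hom_closed[OF pq(1) that(2)]]
              bimod_hom_lact[OF 2(3) that(1) bimod_hom_closed[OF pq(2) that(2)]]
              M.lact_add_right[OF that(1) gcl[OF that(2)]])
        show "G (ract (bimod_copies (r + s) N) v a) = ract M (G v) a"
          if "a \<in> carrier R" "v \<in> carrier (bimod_copies (r + s) N)" for a v
          unfolding G_def bimod_hom_ract[OF pq(1) that] bimod_hom_ract[OF pq(2) that]
          by (simp only: bimod_hom_ract[OF 1(3) that(1) bimod_hom_closed[OF pq(1) that(2)]]
              bimod_hom_ract[OF 2(3) that(1) bimod_hom_closed[OF pq(2) that(2)]]
              M.ract_add_left[OF gcl[OF that(2)] that(1)])
      qed
    qed
    moreover have "h x \<oplus>\<^bsub>M\<^esub> k x = G (F x)" if x: "x \<in> carrier M" for x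
    proof -
      have "(\<lambda>i\<in>{..<r}. F x i) = f x" "(\<lambda>i\<in>{..<s}. F x (r + i)) = f' x"
        using bimod_hom_closed[OF 1(2) x] bimod_hom_closed[OF 2(2) x]
        by (auto simp: F_def fun_eq_iff PiE_def extensional_def)
      then show ?thesis by (simp only: G_def 1(4)[OF x] 2(4)[OF x])
    qed
    ultimately show ?case
      using 1(1) by (intro exI[of _ "r + s"] conjI bexI[of _ F] bexI[of _ G]) auto
  next
    case (ext h k)
    then show ?case by simp
  qed
  then show thesis using that by blast
qed

text \<open>The identity of \<open>r N\<close> is the sum of the maps that project to one coordinate
  and include it back. The induction peels off the last coordinate, as \<open>factors\<close> has
  binary sums only.\<close>

lemma copies_imp_factors:
  assumes "bimodule L R M" "bimodule L R N" "r \<ge> 1"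
    and "f \<in> bimod_hom L R M (bimod_copies r N)" "g \<in> bimod_hom L R (bimod_copies r N) M"
  shows "factors L R M N (\<lambda>x. g (f x))"
proof -
  interpret M: bimodule L R M by fact
  interpret N: bimodule L R N by fact
  have proj: "(\<lambda>x. f x i) \<in> bimod_hom L R M N"
    if f: "f \<in> bimod_hom L R M (bimod_copies r N)" and "i < r" for r i f
  proof (intro bimod_homI add_homI)
    show "f x i \<in> carrier N" if "x \<in> carrier M" for x
      using bimod_hom_closed[OF f that] \<open>i < r\<close> by auto
  qed (use \<open>i < r\<close> in \<open>auto simp: bimod_hom_add[OF f] bimod_hom_lact[OF f] bimod_hom_ract[OF f]\<close>)
  define single where "single r j y = (\<lambda>i\<in>{..<r}. if i = j then y else \<zero>\<^bsub>N\<^esub>)" for r j :: nat and y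
  have inj: "single r j \<in> bimod_hom L R N (bimod_copies r N)" for r j
    unfolding single_def by (intro bimod_homI add_homI)
      (auto simp: lact_zero[OF assms(2)] ract_zero[OF assms(2)] intro!: restrict_ext)
  have comp: "(\<lambda>y. g (k y)) \<in> bimod_hom L R Q M"
    if "k \<in> bimod_hom L R Q P" "g \<in> bimod_hom L R P M" for k g and Q :: "('a, 'c, 'q) bimodule"
      and P :: "('a, 'c, 'p) bimodule"
    using that by (auto simp: bimod_hom_def add_hom_def)
  from assms(3-5) show ?thesis
  proof (induction r arbitrary: f g rule: nat_induct_at_least)
    case base
    have eq: "f x = single 1 0 (f x 0)" if "x \<in> carrier M" for x
      using bimod_hom_closed[OF base(1) that] by (auto simp: single_def fun_eq_iff PiE_def extensional_def)
    have "factors L R M N (\<lambda>x. (\<lambda>y. g (single 1 0 y)) (f x 0))"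
      by (intro factors.comp proj[OF base(1)] comp[OF inj base(2)]) simp
    then show ?case by (rule factors.ext) (metis eq)
  next
    case (Suc r)
    \<comment> \<open>A vector of length \<open>r + 1\<close> is its truncation padded by zero plus
      a vector supported at coordinate \<open>r\<close>.\<close>
    define pad where "pad v = (\<lambda>i\<in>{..<Suc r}. if i < r then v i else \<zero>\<^bsub>N\<^esub>)" for v
    define cut where "cut v = (\<lambda>i\<in>{..<r}. v i)" for v :: "nat \<Rightarrow> 'f"
    have pad: "pad \<in> bimod_hom L R (bimod_copies r N) (bimod_copies (Suc r) N)"
    proof (intro bimod_homI add_homI)
      show "pad v \<in> carrier (bimod_copies (Suc r) N)" if "v \<in> carrier (bimod_copies r N)" for v
      proof -
        have "v i \<in> carrier N" if "i < r" for i
          using PiE_mem[of v "{..<r}" "\<lambda>_. carrier N" i] \<open>v \<in> carrier (bimod_copies r N)\<close> that by simp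
        then show ?thesis
          by (simp add: pad_def restrict_def PiE_def Pi_def extensional_def)
      qed
      show "pad (v \<oplus>\<^bsub>bimod_copies r N\<^esub> w) = pad v \<oplus>\<^bsub>bimod_copies (Suc r) N\<^esub> pad w" for v w
        unfolding pad_def bimod_copies_simps by (rule restrict_ext) simp
      show "pad (lact (bimod_copies r N) a v) = lact (bimod_copies (Suc r) N) a (pad v)"
        if "a \<in> carrier L" for a v
        unfolding pad_def bimod_copies_simps
        by (rule restrict_ext) (simp add: lact_zero[OF assms(2) that])
      show "pad (ract (bimod_copies r N) v a) = ract (bimod_copies (Suc r) N) (pad v) a"
        if "a \<in> carrier R" for a v
        unfolding pad_def bimod_copies_simps
        by (rule restrict_ext) (simp add: ract_zero[OF assms(2) that])
    qed
    have cut: "(\<lambda>x. cut (f x)) \<in> bimod_hom L R M (bimod_copies r N)"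
    proof (intro bimod_homI add_homI)
      show "cut (f x) \<in> carrier (bimod_copies r N)" if "x \<in> carrier M" for x
      proof -
        have "f x i \<in> carrier N" if "i < r" for i
          using PiE_mem[OF bimod_hom_closed[OF Suc(3) \<open>x \<in> carrier M\<close>, simplified], of i] that by simp
        then show ?thesis
          by (simp add: cut_def restrict_def PiE_def Pi_def extensional_def)
      qed
    qed (auto simp: bimod_hom_add[OF Suc(3)] bimod_hom_lact[OF Suc(3)] bimod_hom_ract[OF Suc(3)]
      cut_def intro!: restrict_ext)
    have eq: "g (f x) = g (pad (cut (f x))) \<oplus>\<^bsub>M\<^esub> g (single (Suc r) r (f x r))" if x: "x \<in> carrier M" for x
    proof -
      have fx: "f x i \<in> carrier N" if "i < Suc r" for i
        using bimod_hom_closed[OF Suc(3) x] that by auto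
      have "f x = pad (cut (f x)) \<oplus>\<^bsub>bimod_copies (Suc r) N\<^esub> single (Suc r) r (f x r)"
        using bimod_hom_closed[OF Suc(3) x] fx
        by (auto simp: pad_def cut_def single_def fun_eq_iff PiE_def extensional_def less_Suc_eq)
      then show ?thesis
        using bimod_hom_add[OF Suc(4) bimod_hom_closed[OF pad bimod_hom_closed[OF cut x]]
          bimod_hom_closed[OF inj fx]]
        by (metis lessI)
    qed
    have "factors L R M N (\<lambda>x. (\<lambda>v. g (pad v)) (cut (f x)))"
      by (rule Suc.IH[OF cut comp[OF pad Suc(4)]])
    moreover have "factors L R M N (\<lambda>x. (\<lambda>y. g (single (Suc r) r y)) (f x r))"
      by (intro factors.comp proj[OF Suc(3)] comp[OF inj Suc(4)]) simp
    ultimately show ?case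
      by (rule factors.ext[OF factors.add]) (simp add: eq)
  qed
qed

lemma divides_copies_iff:
  assumes "bimodule L R M" "bimodule L R N"
  shows "(\<exists>r\<ge>1. bimod_divides L R M (bimod_copies r N)) \<longleftrightarrow> factors L R M N (\<lambda>x. x)"
proof
  assume "\<exists>r\<ge>1. bimod_divides L R M (bimod_copies r N)"
  then obtain r f g where "r \<ge> 1" "f \<in> bimod_hom L R M (bimod_copies r N)"
      "g \<in> bimod_hom L R (bimod_copies r N) M" "\<forall>x\<in>carrier M. g (f x) = x"
    using bimod_divides_iff[OF assms(1) bimodule_copies[OF assms(2)]] by blast
  then show "factors L R M N (\<lambda>x. x)"
    by (intro factors.ext[OF copies_imp_factors[OF assms]]) auto
next
  assume "factors L R M N (\<lambda>x. x)"
  from factors_imp_copies[OF this assms]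
  obtain r f g where "r \<ge> 1" "f \<in> bimod_hom L R M (bimod_copies r N)"
      "g \<in> bimod_hom L R (bimod_copies r N) M" "\<And>x. x \<in> carrier M \<Longrightarrow> x = g (f x)"
    by blast
  then show "\<exists>r\<ge>1. bimod_divides L R M (bimod_copies r N)"
    using bimod_divides_iff[OF assms(1) bimodule_copies[OF assms(2)]] by metis
qed

lemma H_equivalent_iff:
  assumes "bimodule L R M" "bimodule L R N"
  shows "H_equivalent L R M N \<longleftrightarrow> factors L R M N (\<lambda>x. x) \<and> factors L R N M (\<lambda>x. x)"
  unfolding divides_copies_iff[OF assms, symmetric] divides_copies_iff[OF assms(2,1), symmetric]
  by (auto simp: H_equivalent_def)

text \<open>Conjugates a sum of compositions by additive maps that need not be linear over either
  pair of scalar rings. Condition \<open>comm\<close> says that inserting \<open>j\<close> after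
  \<open>q\<close> in the middle is invisible once \<open>p\<close> is applied. For corners this
  composite is the identity; for retracts it is an idempotent that commutes with
  \<open>g\<close>.\<close>

lemma factors_transfer:
  assumes "factors L R M N h" "abelian_group M"
    and p: "p \<in> add_hom M M'" and i: "\<And>x. x \<in> carrier M' \<Longrightarrow> i x \<in> carrier M"
    and f: "\<And>f. f \<in> bimod_hom L R M N \<Longrightarrow> (\<lambda>x. q (f (i x))) \<in> bimod_hom L' R' M' N'"
    and g: "\<And>g. g \<in> bimod_hom L R N M \<Longrightarrow> (\<lambda>x. p (g (j x))) \<in> bimod_hom L' R' N' M'"
    and comm: "\<And>f g x. \<lbrakk>f \<in> bimod_hom L R M N; g \<in> bimod_hom L R N M; x \<in> carrier M'\<rbrakk>
      \<Longrightarrow> p (g (j (q (f (i x))))) = p (g (f (i x)))"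
  shows "factors L' R' M' N' (\<lambda>x. p (h (i x)))"
  using assms(1)
proof induction
  case (comp f' g')
  have "factors L' R' M' N' (\<lambda>x. (\<lambda>x. p (g' (j x))) ((\<lambda>x. q (f' (i x))) x))"
    by (intro factors.comp f g comp)
  then show ?case by (rule factors.ext) (simp add: comm comp)
next
  case (add h k)
  note hk = add_hom_closed[OF factors_add_hom[OF add.hyps(1) assms(2)]]
    add_hom_closed[OF factors_add_hom[OF add.hyps(2) assms(2)]]
  show ?case
    by (rule factors.ext[OF factors.add[OF add.IH]]) (simp add: add_hom_add[OF p] hk i)
next
  case (ext h k)
  then show ?case by (intro factors.ext[OF ext.IH]) (auto simp: i)
qed

section \<open>Adjoining a tensor factor\<close>

context ring_pair
begin

text \<open>The tensor \<open>a \<otimes> u\<close>. For positive \<open>n\<close> it lets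
  \<open>T (Suc n)\<close> be treated as \<open>A\<close> tensored over \<open>B\<close> with
  \<open>T n\<close>, although all tensor powers are formed in one step.\<close>

definition tcons :: "nat \<Rightarrow> 'a \<Rightarrow> ('a list \<Rightarrow>\<^sub>0 int) set \<Rightarrow> ('a list \<Rightarrow>\<^sub>0 int) set"
  where "tcons n a = tensor_lift (T (Suc n)) n (\<lambda>xs. pure (a # xs))"

definition tsnoc :: "nat \<Rightarrow> ('a list \<Rightarrow>\<^sub>0 int) set \<Rightarrow> 'a \<Rightarrow> ('a list \<Rightarrow>\<^sub>0 int) set"
  where "tsnoc n u a = tensor_lift (T (Suc n)) n (\<lambda>xs. pure (xs @ [a])) u"

lemma tcons:
  assumes a: "a \<in> carrier A"
  shows tcons_hom: "tcons n a \<in> add_hom (T n) (T (Suc n))"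
    and tcons_pure: "\<lbrakk>length xs = n; set xs \<subseteq> carrier A\<rbrakk> \<Longrightarrow> tcons n a (pure xs) = pure (a # xs)"
proof -
  have "balanced (T (Suc n)) n (\<lambda>xs. pure (a # xs))"
    using a pure_add[of "a # _"] pure_balance[of "a # _"]
    by (intro balancedI) (auto intro!: pure_closed simp: tuples_def)
  from tensor_lift[OF abelian_group_T this]
  show "tcons n a \<in> add_hom (T n) (T (Suc n))"
    "\<lbrakk>length xs = n; set xs \<subseteq> carrier A\<rbrakk> \<Longrightarrow> tcons n a (pure xs) = pure (a # xs)"
    by (simp_all add: tcons_def)
qed

lemma tsnoc:
  assumes a: "a \<in> carrier A"
  shows tsnoc_hom: "(\<lambda>u. tsnoc n u a) \<in> add_hom (T n) (T (Suc n))"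
    and tsnoc_pure: "\<lbrakk>length xs = n; set xs \<subseteq> carrier A\<rbrakk> \<Longrightarrow> tsnoc n (pure xs) a = pure (xs @ [a])"
proof -
  have "balanced (T (Suc n)) n (\<lambda>xs. pure (xs @ [a]))"
    using a pure_add[of _ "_ @ [a]"] pure_balance[of _ "_ @ [a]"]
    by (intro balancedI) (auto intro!: pure_closed simp: tuples_def)
  from tensor_lift[OF abelian_group_T this]
  show "(\<lambda>u. tsnoc n u a) \<in> add_hom (T n) (T (Suc n))"
    "\<lbrakk>length xs = n; set xs \<subseteq> carrier A\<rbrakk> \<Longrightarrow> tsnoc n (pure xs) a = pure (xs @ [a])"
    by (simp_all add: tsnoc_def)
qed

lemma tcons_add:
  assumes "a \<in> carrier A" "a' \<in> carrier A" "u \<in> carrier (T n)"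
  shows "tcons n (a \<oplus> a') u = tcons n a u \<oplus>\<^bsub>T (Suc n)\<^esub> tcons n a' u"
  by (rule tensor_hom_eq[OF abelian_group_T _ _ _ assms(3)])
    (use assms(1,2) in \<open>auto intro!: tcons_hom add_hom_sum abelian_group_T simp: tcons_pure pure_Cons_add\<close>)

lemma tsnoc_add:
  assumes "a \<in> carrier A" "a' \<in> carrier A" "u \<in> carrier (T n)"
  shows "tsnoc n u (a \<oplus> a') = tsnoc n u a \<oplus>\<^bsub>T (Suc n)\<^esub> tsnoc n u a'"
  by (rule tensor_hom_eq[OF abelian_group_T _ _ _ assms(3)])
    (use assms(1,2) in \<open>auto intro!: tsnoc_hom add_hom_sum abelian_group_T simp: tsnoc_pure pure_snoc_add\<close>)

lemma tcons_balance:
  assumes "a \<in> carrier A" "b \<in> B" "u \<in> carrier (T (Suc n))"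
  shows "tcons (Suc n) (a \<otimes> b) u = tcons (Suc n) a (lact (T (Suc n)) b u)"
proof (rule tensor_hom_eq_Cons[OF abelian_group_T _ _ _ assms(3)])
  show "(\<lambda>u. tcons (Suc n) a (lact (T (Suc n)) b u)) \<in> add_hom (T (Suc n)) (T (Suc (Suc n)))"
    using assms by (intro add_hom_compose[OF lact_T_hom tcons_hom]) (auto simp: B_closed)
  show "tcons (Suc n) (a \<otimes> b) (pure (x # xs)) = tcons (Suc n) a (lact (T (Suc n)) b (pure (x # xs)))"
    if "length xs = n" "x \<in> carrier A" "set xs \<subseteq> carrier A" for x xs
    using that assms pure_balance[of "[]" xs a x b] by (simp add: tcons_pure lact_T_pure B_closed)
qed (use assms in \<open>simp add: tcons_hom B_closed\<close>)

lemma tsnoc_balance: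
  assumes "a \<in> carrier A" "b \<in> B" "u \<in> carrier (T (Suc n))"
  shows "tsnoc (Suc n) (ract (T (Suc n)) u b) a = tsnoc (Suc n) u (b \<otimes> a)"
proof (rule tensor_hom_eq_snoc[OF abelian_group_T _ _ _ assms(3)])
  show "(\<lambda>u. tsnoc (Suc n) (ract (T (Suc n)) u b) a) \<in> add_hom (T (Suc n)) (T (Suc (Suc n)))"
    using assms by (intro add_hom_compose[OF ract_T_hom tsnoc_hom]) (auto simp: B_closed)
  show "tsnoc (Suc n) (ract (T (Suc n)) (pure (xs @ [x])) b) a = tsnoc (Suc n) (pure (xs @ [x])) (b \<otimes> a)"
    if "length xs = n" "x \<in> carrier A" "set xs \<subseteq> carrier A" for x xs
    using that assms pure_balance[of xs "[]" x a b] by (simp add: tsnoc_pure ract_T_pure B_closed)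
qed (use assms in \<open>simp add: tsnoc_hom B_closed\<close>)

lemma lact_tcons:
  assumes "a \<in> carrier A" "c \<in> carrier A" "u \<in> carrier (T n)"
  shows "lact (T (Suc n)) c (tcons n a u) = tcons n (c \<otimes> a) u"
  by (rule tensor_hom_eq[OF abelian_group_T _ _ _ assms(3)])
    (use assms in \<open>auto intro!: add_hom_compose[OF tcons_hom lact_T_hom]
      tcons_hom simp: tcons_pure lact_T_pure\<close>)

lemma ract_tsnoc:
  assumes "a \<in> carrier A" "c \<in> carrier A" "u \<in> carrier (T n)"
  shows "ract (T (Suc n)) (tsnoc n u a) c = tsnoc n u (a \<otimes> c)"
  by (rule tensor_hom_eq[OF abelian_group_T _ _ _ assms(3)])
    (use assms in \<open>auto intro!: add_hom_compose[OF tsnoc_hom ract_T_hom]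
      tsnoc_hom simp: tsnoc_pure ract_T_pure\<close>)

lemma ract_tcons:
  assumes "a \<in> carrier A" "c \<in> carrier A" "u \<in> carrier (T (Suc n))"
  shows "ract (T (Suc (Suc n))) (tcons (Suc n) a u) c = tcons (Suc n) a (ract (T (Suc n)) u c)"
proof (rule tensor_hom_eq_snoc[OF abelian_group_T _ _ _ assms(3)])
  show "(\<lambda>u. ract (T (Suc (Suc n))) (tcons (Suc n) a u) c) \<in> add_hom (T (Suc n)) (T (Suc (Suc n)))"
    using assms by (intro add_hom_compose[OF tcons_hom ract_T_hom]) auto
  show "(\<lambda>u. tcons (Suc n) a (ract (T (Suc n)) u c)) \<in> add_hom (T (Suc n)) (T (Suc (Suc n)))"
    using assms by (intro add_hom_compose[OF ract_T_hom tcons_hom]) auto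
  show "ract (T (Suc (Suc n))) (tcons (Suc n) a (pure (xs @ [x]))) c
      = tcons (Suc n) a (ract (T (Suc n)) (pure (xs @ [x])) c)"
    if "length xs = n" "x \<in> carrier A" "set xs \<subseteq> carrier A" for x xs
    using that assms ract_T_pure[of "Suc (Suc n)" c "a # xs" x] by (simp add: tcons_pure ract_T_pure)
qed

lemma lact_tsnoc:
  assumes "a \<in> carrier A" "c \<in> carrier A" "u \<in> carrier (T (Suc n))"
  shows "lact (T (Suc (Suc n))) c (tsnoc (Suc n) u a) = tsnoc (Suc n) (lact (T (Suc n)) c u) a"
proof (rule tensor_hom_eq_Cons[OF abelian_group_T _ _ _ assms(3)])
  show "(\<lambda>u. lact (T (Suc (Suc n))) c (tsnoc (Suc n) u a)) \<in> add_hom (T (Suc n)) (T (Suc (Suc n)))"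
    using assms by (intro add_hom_compose[OF tsnoc_hom lact_T_hom]) auto
  show "(\<lambda>u. tsnoc (Suc n) (lact (T (Suc n)) c u) a) \<in> add_hom (T (Suc n)) (T (Suc (Suc n)))"
    using assms by (intro add_hom_compose[OF lact_T_hom tsnoc_hom]) auto
  show "lact (T (Suc (Suc n))) c (tsnoc (Suc n) (pure (x # xs)) a)
      = tsnoc (Suc n) (lact (T (Suc n)) c (pure (x # xs))) a"
    if "length xs = n" "x \<in> carrier A" "set xs \<subseteq> carrier A" for x xs
    using that assms lact_T_pure[of "Suc (Suc n)" c "xs @ [a]" x] by (simp add: tsnoc_pure lact_T_pure)
qed

text \<open>The universal property of \<open>A\<close> tensored with \<open>T (Suc n)\<close> over
  \<open>B\<close>: the conditions on \<open>k\<close> make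
  \<open>a \<otimes> u \<mapsto> k a (f u)\<close> well defined and linear over \<open>B\<close> on
  both sides. \<open>Q\<close> and \<open>P\<close> are general because \<open>k\<close> will be
  \<open>tcons\<close>, the left action, or the product of \<open>a\<close> with a scalar in
  \<open>B\<close>.\<close>

lemma prefix_map:
  assumes P: "bimodule BB BB P" and f: "f \<in> bimod_hom BB BB (T (Suc n)) Q"
    and k_hom: "\<And>a. a \<in> carrier A \<Longrightarrow> k a \<in> add_hom Q P"
    and k_add: "\<And>a a' x. \<lbrakk>a \<in> carrier A; a' \<in> carrier A; x \<in> carrier Q\<rbrakk> \<Longrightarrow> k (a \<oplus> a') x = k a x \<oplus>\<^bsub>P\<^esub> k a' x"
    and k_bal: "\<And>a b x. \<lbrakk>a \<in> carrier A; b \<in> B; x \<in> carrier Q\<rbrakk> \<Longrightarrow> k (a \<otimes> b) x = k a (lact Q b x)"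
    and k_lact: "\<And>a b x. \<lbrakk>a \<in> carrier A; b \<in> B; x \<in> carrier Q\<rbrakk> \<Longrightarrow> lact P b (k a x) = k (b \<otimes> a) x"
    and k_ract: "\<And>a b x. \<lbrakk>a \<in> carrier A; b \<in> B; x \<in> carrier Q\<rbrakk> \<Longrightarrow> ract P (k a x) b = k a (ract Q x b)"
  obtains F where "F \<in> bimod_hom BB BB (T (Suc (Suc n))) P"
    "\<And>a u. \<lbrakk>a \<in> carrier A; u \<in> carrier (T (Suc n))\<rbrakk> \<Longrightarrow> F (tcons (Suc n) a u) = k a (f u)"
proof -
  let ?n = "Suc (Suc n)"
  note Pab = bimodule_abelian_group[OF P]
  note f_hom = bimod_hom_add_hom[OF f]
  note kf = add_hom_compose[OF f_hom k_hom]
  note kcl = add_hom_closed[OF k_hom]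
  have fp: "f (pure xs) \<in> carrier Q" if "length xs = Suc n" "set xs \<subseteq> carrier A" for xs
    by (intro add_hom_closed[OF f_hom] pure_closed that)
  define \<phi> where "\<phi> xs = k (hd xs) (f (pure (tl xs)))" for xs
  have "balanced P ?n \<phi>"
  proof (rule balancedI)
    fix xs assume "xs \<in> tuples A ?n"
    then show "\<phi> xs \<in> carrier P"
      by (cases xs) (auto simp: \<phi>_def tuples_def intro!: kcl fp)
  next
    fix xs b c ys
    assume *: "length xs + length ys + 1 = ?n" "set xs \<subseteq> carrier A" "set ys \<subseteq> carrier A" "b \<in> carrier A"
      "c \<in> carrier A"
    then show "\<phi> (xs @ (b \<oplus> c) # ys) = \<phi> (xs @ b # ys) \<oplus>\<^bsub>P\<^esub> \<phi> (xs @ c # ys)"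
      by (cases xs) (auto simp: \<phi>_def k_add fp pure_add[of _ _ _ _ "Suc n"] add_hom_add[OF f_hom]
          add_hom_add[OF k_hom] pure_closed)
  next
    fix xs b c d ys
    assume *: "length xs + length ys + 2 = ?n" "set xs \<subseteq> carrier A" "set ys \<subseteq> carrier A" "b \<in> carrier A"
      "d \<in> carrier A" "c \<in> B"
    show "\<phi> (xs @ (b \<otimes> c) # d # ys) = \<phi> (xs @ b # (c \<otimes> d) # ys)"
    \<comment> \<open>A scalar moved between the first two factors passes from \<open>k\<close> to
      \<open>f\<close>, which needs \<open>k_bal\<close> and left linearity of \<open>f\<close>. Any
      later move takes place inside the argument of \<open>f\<close>.\<close>
    proof (cases xs)
      case Nil
      have "pure ((c \<otimes> d) # ys) = lact (T (Suc n)) c (pure (d # ys))"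
        using * Nil by (simp add: lact_T_pure B_closed)
      then show ?thesis
        using * Nil by (simp add: \<phi>_def k_bal fp bimod_hom_lact[OF f] pure_closed)
    next
      case (Cons x zs)
      then show ?thesis using * pure_balance[of zs ys b d c] by (simp add: \<phi>_def)
    qed
  qed
  note lift = tensor_lift[OF Pab this]
  define F where "F = tensor_lift P ?n \<phi>"
  have F: "F \<in> add_hom (T ?n) P"
    "\<And>x xs. \<lbrakk>length xs = Suc n; x \<in> carrier A; set xs \<subseteq> carrier A\<rbrakk> \<Longrightarrow> F (pure (x # xs)) = k x (f (pure xs))"
    using lift by (simp_all add: F_def \<phi>_def)
  have "F \<in> bimod_hom BB BB (T ?n) P"
  proof (rule bimod_homI[OF F(1)])
    fix b u assume "b \<in> carrier BB" and u: "u \<in> carrier (T ?n)"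
    then have b: "b \<in> B" "b \<in> carrier A" by (simp_all add: B_closed)
    show "F (lact (T ?n) b u) = lact P b (F u)"
    proof (rule tensor_hom_eq_Cons[OF Pab _ _ _ u])
      show "(\<lambda>u. F (lact (T ?n) b u)) \<in> add_hom (T ?n) P"
        using b by (intro add_hom_compose[OF lact_T_hom F(1)]) auto
      show "(\<lambda>u. lact P b (F u)) \<in> add_hom (T ?n) P"
        using b by (intro add_hom_compose[OF F(1) bimodule_lact_hom[OF P]]) auto
    qed (use b in \<open>simp add: lact_T_pure F(2) k_lact fp\<close>)
    show "F (ract (T ?n) u b) = ract P (F u) b"
    proof (rule tensor_hom_eq_Cons[OF Pab _ _ _ u])
      show "(\<lambda>u. F (ract (T ?n) u b)) \<in> add_hom (T ?n) P"
        using b by (intro add_hom_compose[OF ract_T_hom F(1)]) auto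
      show "(\<lambda>u. ract P (F u) b) \<in> add_hom (T ?n) P"
        using b by (intro add_hom_compose[OF F(1) bimodule_ract_hom[OF P]]) auto
      show "F (ract (T ?n) (pure (x # xs)) b) = ract P (F (pure (x # xs))) b"
        if x: "length xs = Suc n" "x \<in> carrier A" "set xs \<subseteq> carrier A" for x xs
      proof -
        \<comment> \<open>The right action hits the last factor, which lies in \<open>xs\<close>
          because \<open>xs\<close> has positive length.\<close>
        obtain zs z where xs: "xs = zs @ [z]" using x(1) by (cases xs rule: rev_cases) auto
        have "F (ract (T ?n) (pure (x # xs)) b) = k x (f (ract (T (Suc n)) (pure xs) b))"
          using x b ract_T_pure[of ?n b "x # zs" z] ract_T_pure[of "Suc n" b zs z] unfolding xs
            by (simp add: F(2))
        then show ?thesis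
          using x b by (simp add: F(2) bimod_hom_ract[OF f] pure_closed k_ract fp)
      qed
    qed
  qed
  moreover have "F (tcons (Suc n) a u) = k a (f u)"
    if a: "a \<in> carrier A" and u: "u \<in> carrier (T (Suc n))" for a u
    by (rule tensor_hom_eq[OF Pab _ _ _ u])
      (use a in \<open>auto intro!: add_hom_compose[OF tcons_hom F(1)] kf simp: tcons_pure F(2)\<close>)
  ultimately show thesis by (rule that)
qed

text \<open>The mirror image of \<open>prefix_map\<close>, with \<open>T (Suc (Suc n))\<close> read
  as \<open>T (Suc n)\<close> tensored with \<open>A\<close> over \<open>B\<close>.\<close>

lemma suffix_map:
  assumes P: "bimodule BB BB P" and f: "f \<in> bimod_hom BB BB (T (Suc n)) Q"
    and k_hom: "\<And>a. a \<in> carrier A \<Longrightarrow> (\<lambda>x. k x a) \<in> add_hom Q P"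
    and k_add: "\<And>a a' x. \<lbrakk>a \<in> carrier A; a' \<in> carrier A; x \<in> carrier Q\<rbrakk> \<Longrightarrow> k x (a \<oplus> a') = k x a \<oplus>\<^bsub>P\<^esub> k x a'"
    and k_bal: "\<And>a b x. \<lbrakk>a \<in> carrier A; b \<in> B; x \<in> carrier Q\<rbrakk> \<Longrightarrow> k (ract Q x b) a = k x (b \<otimes> a)"
    and k_ract: "\<And>a b x. \<lbrakk>a \<in> carrier A; b \<in> B; x \<in> carrier Q\<rbrakk> \<Longrightarrow> ract P (k x a) b = k x (a \<otimes> b)"
    and k_lact: "\<And>a b x. \<lbrakk>a \<in> carrier A; b \<in> B; x \<in> carrier Q\<rbrakk> \<Longrightarrow> lact P b (k x a) = k (lact Q b x) a"
  obtains F where "F \<in> bimod_hom BB BB (T (Suc (Suc n))) P"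
    "\<And>a u. \<lbrakk>a \<in> carrier A; u \<in> carrier (T (Suc n))\<rbrakk> \<Longrightarrow> F (tsnoc (Suc n) u a) = k (f u) a"
proof -
  let ?n = "Suc (Suc n)"
  note Pab = bimodule_abelian_group[OF P]
  note f_hom = bimod_hom_add_hom[OF f]
  note kf = add_hom_compose[OF f_hom k_hom]
  note kcl = add_hom_closed[OF k_hom]
  have fp: "f (pure xs) \<in> carrier Q" if "length xs = Suc n" "set xs \<subseteq> carrier A" for xs
    by (intro add_hom_closed[OF f_hom] pure_closed that)
  define \<phi> where "\<phi> xs = k (f (pure (butlast xs))) (last xs)" for xs
  have "balanced P ?n \<phi>"
  proof (rule balancedI)
    fix xs assume "xs \<in> tuples A ?n"
    then show "\<phi> xs \<in> carrier P"
      by (cases xs rule: rev_cases) (auto simp: \<phi>_def tuples_def intro!: kcl fp)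
  next
    fix xs b c ys
    assume *: "length xs + length ys + 1 = ?n" "set xs \<subseteq> carrier A" "set ys \<subseteq> carrier A" "b \<in> carrier A"
      "c \<in> carrier A"
    then show "\<phi> (xs @ (b \<oplus> c) # ys) = \<phi> (xs @ b # ys) \<oplus>\<^bsub>P\<^esub> \<phi> (xs @ c # ys)"
      by (cases ys rule: rev_cases) (auto simp: \<phi>_def butlast_append k_add fp pure_add[of _ _ _ _ "Suc n"]
          add_hom_add[OF f_hom] add_hom_add[OF k_hom] pure_closed)
  next
    fix xs b c d ys
    assume *: "length xs + length ys + 2 = ?n" "set xs \<subseteq> carrier A" "set ys \<subseteq> carrier A" "b \<in> carrier A"
      "d \<in> carrier A" "c \<in> B"
    show "\<phi> (xs @ (b \<otimes> c) # d # ys) = \<phi> (xs @ b # (c \<otimes> d) # ys)"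
    proof (cases ys rule: rev_cases)
      case Nil
      have "pure (xs @ [b \<otimes> c]) = ract (T (Suc n)) (pure (xs @ [b])) c"
        using * Nil by (simp add: ract_T_pure B_closed)
      then show ?thesis
        using * Nil by (simp add: \<phi>_def butlast_append k_bal fp bimod_hom_ract[OF f] pure_closed)
    next
      case (snoc zs x)
      then show ?thesis using * pure_balance[of xs zs b d c] by (simp add: \<phi>_def butlast_append)
    qed
  qed
  note lift = tensor_lift[OF Pab this]
  define F where "F = tensor_lift P ?n \<phi>"
  have F: "F \<in> add_hom (T ?n) P"
    "\<And>x xs. \<lbrakk>length xs = Suc n; x \<in> carrier A; set xs \<subseteq> carrier A\<rbrakk> \<Longrightarrow> F (pure (xs @ [x])) = k (f (pure xs)) x"
    using lift by (simp_all add: F_def \<phi>_def)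
  have "F \<in> bimod_hom BB BB (T ?n) P"
  proof (rule bimod_homI[OF F(1)])
    fix b u assume "b \<in> carrier BB" and u: "u \<in> carrier (T ?n)"
    then have b: "b \<in> B" "b \<in> carrier A" by (simp_all add: B_closed)
    show "F (ract (T ?n) u b) = ract P (F u) b"
    proof (rule tensor_hom_eq_snoc[OF Pab _ _ _ u])
      show "(\<lambda>u. F (ract (T ?n) u b)) \<in> add_hom (T ?n) P"
        using b by (intro add_hom_compose[OF ract_T_hom F(1)]) auto
      show "(\<lambda>u. ract P (F u) b) \<in> add_hom (T ?n) P"
        using b by (intro add_hom_compose[OF F(1) bimodule_ract_hom[OF P]]) auto
    qed (use b in \<open>simp add: ract_T_pure F(2) k_ract fp\<close>)
    show "F (lact (T ?n) b u) = lact P b (F u)"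
    proof (rule tensor_hom_eq_snoc[OF Pab _ _ _ u])
      show "(\<lambda>u. F (lact (T ?n) b u)) \<in> add_hom (T ?n) P"
        using b by (intro add_hom_compose[OF lact_T_hom F(1)]) auto
      show "(\<lambda>u. lact P b (F u)) \<in> add_hom (T ?n) P"
        using b by (intro add_hom_compose[OF F(1) bimodule_lact_hom[OF P]]) auto
      show "F (lact (T ?n) b (pure (xs @ [x]))) = lact P b (F (pure (xs @ [x])))"
        if x: "length xs = Suc n" "x \<in> carrier A" "set xs \<subseteq> carrier A" for x xs
      proof -
        obtain zs z where xs: "xs = z # zs" using x(1) by (cases xs) auto
        have "F (lact (T ?n) b (pure (xs @ [x]))) = k (f (lact (T (Suc n)) b (pure xs))) x"
          using x b lact_T_pure[of ?n b "zs @ [x]" z] lact_T_pure[of "Suc n" b zs z] F(2)[of "(b \<otimes> z) # zs" x]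
          unfolding xs by simp
        then show ?thesis
          using x b by (simp add: F(2) bimod_hom_lact[OF f] pure_closed k_lact fp)
      qed
    qed
  qed
  moreover have "F (tsnoc (Suc n) u a) = k (f u) a"
    if a: "a \<in> carrier A" and u: "u \<in> carrier (T (Suc n))" for a u
    by (rule tensor_hom_eq[OF Pab _ _ _ u])
      (use a in \<open>auto intro!: add_hom_compose[OF tsnoc_hom F(1)] kf simp: tsnoc_pure F(2)\<close>)
  ultimately show thesis by (rule that)
qed

text \<open>Tensoring with \<open>A\<close> on the left is an additive functor, so it carries a sum
  of compositions through \<open>T (Suc l)\<close> to one through the next tensor power, and
  \<open>h\<close> to \<open>a \<otimes> u \<mapsto> a \<otimes> h u\<close>.\<close>

lemma factors_tcons:
  assumes "factors BB BB (T (Suc k)) (T (Suc l)) h"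
  shows "\<exists>H. factors BB BB (T (Suc (Suc k))) (T (Suc (Suc l))) H \<and>
    (\<forall>a\<in>carrier A. \<forall>u\<in>carrier (T (Suc k)). H (tcons (Suc k) a u) = tcons (Suc k) a (h u))"
  using assms
proof induction
  case (comp f g)
  \<comment> \<open>The lengths \<open>i\<close> and \<open>j\<close> are general because the lift
    is applied in both directions, to \<open>f\<close> and to \<open>g\<close>.\<close>
  have lift: "\<exists>F\<in>bimod_hom BB BB (T (Suc (Suc i))) (T (Suc (Suc j))).
      \<forall>a\<in>carrier A. \<forall>u\<in>carrier (T (Suc i)). F (tcons (Suc i) a u) = tcons (Suc j) a (f u)"
    if "f \<in> bimod_hom BB BB (T (Suc i)) (T (Suc j))" for i j f
    by (rule prefix_map[OF bimodule_T_BB that, of "tcons (Suc j)"])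
      (auto simp: tcons_hom tcons_add tcons_balance lact_tcons ract_tcons B_closed)
  obtain F where F: "F \<in> bimod_hom BB BB (T (Suc (Suc k))) (T (Suc (Suc l)))"
    "\<And>a u. \<lbrakk>a \<in> carrier A; u \<in> carrier (T (Suc k))\<rbrakk> \<Longrightarrow> F (tcons (Suc k) a u) = tcons (Suc l) a (f u)"
    using lift[OF comp(1)] by blast
  obtain G where G: "G \<in> bimod_hom BB BB (T (Suc (Suc l))) (T (Suc (Suc k)))"
    "\<And>a u. \<lbrakk>a \<in> carrier A; u \<in> carrier (T (Suc l))\<rbrakk> \<Longrightarrow> G (tcons (Suc l) a u) = tcons (Suc k) a (g u)"
    using lift[OF comp(2)] by blast
  show ?case
    by (rule exI[of _ "\<lambda>x. G (F x)"])
      (auto intro: factors.comp[OF F(1) G(1)] simp: F(2) G(2) bimod_hom_closed[OF comp(1)])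
next
  case (add h h')
  then obtain H H' where H: "factors BB BB (T (Suc (Suc k))) (T (Suc (Suc l))) H"
    "\<forall>a\<in>carrier A. \<forall>u\<in>carrier (T (Suc k)). H (tcons (Suc k) a u) = tcons (Suc k) a (h u)"
    "factors BB BB (T (Suc (Suc k))) (T (Suc (Suc l))) H'"
    "\<forall>a\<in>carrier A. \<forall>u\<in>carrier (T (Suc k)). H' (tcons (Suc k) a u) = tcons (Suc k) a (h' u)"
    by blast
  note cl = add_hom_closed[OF factors_add_hom[OF add.hyps(1) abelian_group_T]]
    add_hom_closed[OF factors_add_hom[OF add.hyps(2) abelian_group_T]]
  show ?case
    by (rule exI[of _ "\<lambda>x. H x \<oplus>\<^bsub>T (Suc (Suc k))\<^esub> H' x"])
      (auto intro: factors.add[OF H(1,3)] simp: H(2,4) add_hom_add[OF tcons_hom] cl)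
next
  case (ext h h')
  then show ?case by simp
qed

lemma factors_tsnoc:
  assumes "factors BB BB (T (Suc k)) (T (Suc l)) h"
  shows "\<exists>H. factors BB BB (T (Suc (Suc k))) (T (Suc (Suc l))) H \<and>
    (\<forall>a\<in>carrier A. \<forall>u\<in>carrier (T (Suc k)). H (tsnoc (Suc k) u a) = tsnoc (Suc k) (h u) a)"
  using assms
proof induction
  case (comp f g)
  have lift: "\<exists>F\<in>bimod_hom BB BB (T (Suc (Suc i))) (T (Suc (Suc j))).
      \<forall>a\<in>carrier A. \<forall>u\<in>carrier (T (Suc i)). F (tsnoc (Suc i) u a) = tsnoc (Suc j) (f u) a"
    if "f \<in> bimod_hom BB BB (T (Suc i)) (T (Suc j))" for i j f
    by (rule suffix_map[OF bimodule_T_BB that, of "tsnoc (Suc j)"])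
      (auto simp: tsnoc_hom tsnoc_add tsnoc_balance lact_tsnoc ract_tsnoc B_closed)
  obtain F where F: "F \<in> bimod_hom BB BB (T (Suc (Suc k))) (T (Suc (Suc l)))"
    "\<And>a u. \<lbrakk>a \<in> carrier A; u \<in> carrier (T (Suc k))\<rbrakk> \<Longrightarrow> F (tsnoc (Suc k) u a) = tsnoc (Suc l) (f u) a"
    using lift[OF comp(1)] by blast
  obtain G where G: "G \<in> bimod_hom BB BB (T (Suc (Suc l))) (T (Suc (Suc k)))"
    "\<And>a u. \<lbrakk>a \<in> carrier A; u \<in> carrier (T (Suc l))\<rbrakk> \<Longrightarrow> G (tsnoc (Suc l) u a) = tsnoc (Suc k) (g u) a"
    using lift[OF comp(2)] by blast
  show ?case
    by (rule exI[of _ "\<lambda>x. G (F x)"])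
      (auto intro: factors.comp[OF F(1) G(1)] simp: F(2) G(2) bimod_hom_closed[OF comp(1)])
next
  case (add h h')
  then obtain H H' where H: "factors BB BB (T (Suc (Suc k))) (T (Suc (Suc l))) H"
    "\<forall>a\<in>carrier A. \<forall>u\<in>carrier (T (Suc k)). H (tsnoc (Suc k) u a) = tsnoc (Suc k) (h u) a"
    "factors BB BB (T (Suc (Suc k))) (T (Suc (Suc l))) H'"
    "\<forall>a\<in>carrier A. \<forall>u\<in>carrier (T (Suc k)). H' (tsnoc (Suc k) u a) = tsnoc (Suc k) (h' u) a"
    by blast
  note cl = add_hom_closed[OF factors_add_hom[OF add.hyps(1) abelian_group_T]]
    add_hom_closed[OF factors_add_hom[OF add.hyps(2) abelian_group_T]]
  show ?case
    by (rule exI[of _ "\<lambda>x. H x \<oplus>\<^bsub>T (Suc (Suc k))\<^esub> H' x"])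
      (auto intro: factors.add[OF H(1,3)] simp: H(2,4) add_hom_add[OF tsnoc_hom] cl)
next
  case (ext h h')
  then show ?case by simp
qed

section \<open>Factorizations through the scalar ring\<close>

lemma bimodule_regular: "bimodule BB BB (regular_bimodule BB)"
proof -
  interpret BB: ring BB by (rule B_ring)
  have "abelian_group (regular_bimodule BB)"
    using BB.a_ac BB.add.l_inv_ex BB.add.m_closed BB.zero_closed BB.l_zero
      by (intro abelian_groupI) (auto simp: regular_bimodule_def)
  then interpret reg: abelian_group "regular_bimodule BB" .
  show ?thesis
    using BB.l_distr BB.r_distr BB.m_assoc BB.m_closed BB.l_one BB.r_one
    by unfold_locales (auto simp: regular_bimodule_def)
qed

lemma regular_simps [simp]:
  "carrier (regular_bimodule BB) = B" "add (regular_bimodule BB) = add A"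
  "lact (regular_bimodule BB) = monoid.mult A" "ract (regular_bimodule BB) = monoid.mult A"
  by (simp_all add: regular_bimodule_def)

lemma balanced_1:
  assumes "abelian_group Q" "f \<in> add_hom A Q"
  shows "balanced Q (Suc 0) (\<lambda>xs. f (hd xs))"
  using add_hom_closed[OF assms(2)] add_hom_add[OF assms(2)]
  by (intro balancedI) (auto simp: tuples_def length_Suc_conv)

lemma pure_1:
  assumes "a \<in> carrier A" "x \<in> carrier A"
  shows "pure [a \<oplus> x] = pure [a] \<oplus>\<^bsub>T (Suc 0)\<^esub> pure [x]"
    and "lact (T (Suc 0)) a (pure [x]) = pure [a \<otimes> x]"
    and "ract (T (Suc 0)) (pure [x]) a = pure [x \<otimes> a]"
  using assms pure_Cons_add[of "[]" a x] lact_T_pure[of "Suc 0" a "[]"] ract_T_pure[of "Suc 0" a "[]"]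
  by simp_all

text \<open>The bottom case of \<open>factors_tcons\<close>. Tensoring \<open>B\<close> with
  \<open>A\<close> gives \<open>A\<close> itself, so a factorization through \<open>B\<close> turns
  into one through \<open>T 1\<close>. The first map becomes
  \<open>a \<otimes> u \<mapsto> a (f u)\<close>: the scalar is absorbed by the new factor.\<close>

lemma factors_tcons_0:
  assumes "factors BB BB (T (Suc 0)) (regular_bimodule BB) h"
  shows "\<exists>H. factors BB BB (T (Suc (Suc 0))) (T (Suc 0)) H \<and>
    (\<forall>a\<in>carrier A. \<forall>u\<in>carrier (T (Suc 0)). H (tcons (Suc 0) a u) = tcons (Suc 0) a (h u))"
  using assms
proof induction
  case (comp f g)
  have fB: "f u \<in> B" if "u \<in> carrier (T (Suc 0))" for u
    using bimod_hom_closed[OF comp(1) that] by simp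
  obtain F where F: "F \<in> bimod_hom BB BB (T (Suc (Suc 0))) (T (Suc 0))"
    "\<And>a u. \<lbrakk>a \<in> carrier A; u \<in> carrier (T (Suc 0))\<rbrakk> \<Longrightarrow> F (tcons (Suc 0) a u) = pure [a \<otimes> f u]"
    by (rule prefix_map[OF bimodule_T_BB[of 0] comp(1), of "\<lambda>a b. pure [a \<otimes> b]"])
      (auto simp: pure_1 B_closed r_distr l_distr m_assoc pure_closed intro!: add_homI)
  \<comment> \<open>A bimodule map out of \<open>B\<close> is determined by its value
    \<open>c\<close> at 1, and \<open>b c = g b = c b\<close> for \<open>b\<close> in
    \<open>B\<close>.\<close>
  define c where "c = g \<one>"
  have c: "c \<in> carrier (T (Suc 0))"
    unfolding c_def by (rule bimod_hom_closed[OF comp(2)]) (simp add: B_one)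
  have gl: "lact (T (Suc 0)) b c = g b" and gr: "ract (T (Suc 0)) c b = g b" if "b \<in> B" for b
    using bimod_hom_lact[OF comp(2), of b \<one>] bimod_hom_ract[OF comp(2), of b \<one>] that
    by (simp_all add: c_def B_one B_closed)
  have "(\<lambda>y. tcons (Suc 0) y c) \<in> add_hom A (T (Suc (Suc 0)))"
    by (intro add_homI add_hom_closed[OF tcons_hom c] tcons_add c)
  note lift = tensor_lift[OF abelian_group_T balanced_1[OF abelian_group_T this]]
  define G where "G = tensor_lift (T (Suc (Suc 0))) (Suc 0) (\<lambda>xs. tcons (Suc 0) (hd xs) c)"
  have G: "G \<in> add_hom (T (Suc 0)) (T (Suc (Suc 0)))" "\<And>y. y \<in> carrier A \<Longrightarrow> G (pure [y]) = tcons (Suc 0) y c"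
    using lift(1) lift(2)[of "[_]"] by (simp_all add: G_def)
  have G_hom: "G \<in> bimod_hom BB BB (T (Suc 0)) (T (Suc (Suc 0)))"
  proof (rule bimod_homI[OF G(1)])
    fix b u assume "b \<in> carrier BB" and u: "u \<in> carrier (T (Suc 0))"
    then have b: "b \<in> B" "b \<in> carrier A" by (simp_all add: B_closed)
    show "G (lact (T (Suc 0)) b u) = lact (T (Suc (Suc 0))) b (G u)"
      by (rule tensor_hom_eq_Cons[OF abelian_group_T _ _ _ u])
        (use b c in \<open>auto intro!: add_hom_compose[OF lact_T_hom G(1)] add_hom_compose[OF G(1) lact_T_hom]
          simp: lact_T_pure G(2) lact_tcons\<close>)
    show "G (ract (T (Suc 0)) u b) = ract (T (Suc (Suc 0))) (G u) b"
    proof (rule tensor_hom_eq_Cons[OF abelian_group_T _ _ _ u])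
      show "(\<lambda>u. G (ract (T (Suc 0)) u b)) \<in> add_hom (T (Suc 0)) (T (Suc (Suc 0)))"
        using b by (intro add_hom_compose[OF ract_T_hom G(1)]) auto
      show "(\<lambda>u. ract (T (Suc (Suc 0))) (G u) b) \<in> add_hom (T (Suc 0)) (T (Suc (Suc 0)))"
        using b by (intro add_hom_compose[OF G(1) ract_T_hom]) auto
      \<comment> \<open>Right linearity is where \<open>c\<close> has to commute with
        \<open>B\<close>:
        \<open>x b \<otimes> c = x \<otimes> b c = x \<otimes> c b\<close>.\<close>
      show "G (ract (T (Suc 0)) (pure (x # xs)) b) = ract (T (Suc (Suc 0))) (G (pure (x # xs))) b"
        if "length xs = 0" "x \<in> carrier A" for x xs
        using that b c ract_T_pure[of "Suc 0" b "[]" x]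
        by (simp add: G(2) ract_tcons tcons_balance gl gr)
    qed
  qed
  \<comment> \<open>The scalar \<open>f u\<close> returns through the tensor sign: \<open>a (f u)
    \<otimes> c = a \<otimes> (f u) c = a \<otimes> g (f u)\<close>.\<close>
  have "G (F (tcons (Suc 0) a u)) = tcons (Suc 0) a (g (f u))" if "a \<in> carrier A"
    "u \<in> carrier (T (Suc 0))" for a u
    using that fB[OF that(2)] c by (simp add: F(2) G(2) B_closed tcons_balance gl)
  then show ?case
    by (intro exI[of _ "\<lambda>x. G (F x)"]) (auto intro: factors.comp[OF F(1) G_hom])
next
  case (add h h')
  then obtain H H' where H: "factors BB BB (T (Suc (Suc 0))) (T (Suc 0)) H"
    "\<forall>a\<in>carrier A. \<forall>u\<in>carrier (T (Suc 0)). H (tcons (Suc 0) a u) = tcons (Suc 0) a (h u)"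
    "factors BB BB (T (Suc (Suc 0))) (T (Suc 0)) H'"
    "\<forall>a\<in>carrier A. \<forall>u\<in>carrier (T (Suc 0)). H' (tcons (Suc 0) a u) = tcons (Suc 0) a (h' u)"
    by blast
  note cl = add_hom_closed[OF factors_add_hom[OF add.hyps(1) abelian_group_T]]
    add_hom_closed[OF factors_add_hom[OF add.hyps(2) abelian_group_T]]
  show ?case
    by (rule exI[of _ "\<lambda>x. H x \<oplus>\<^bsub>T (Suc (Suc 0))\<^esub> H' x"])
      (auto intro: factors.add[OF H(1,3)] simp: H(2,4) add_hom_add[OF tcons_hom] cl)
next
  case (ext h h')
  then show ?case by simp
qed

text \<open>The mirror image, with \<open>G\<close> sending \<open>y\<close> to
  \<open>c \<otimes> y\<close>. Now it is left linearity that uses that \<open>c\<close> commutes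
  with \<open>B\<close>.\<close>

lemma factors_tsnoc_0:
  assumes "factors BB BB (T (Suc 0)) (regular_bimodule BB) h"
  shows "\<exists>H. factors BB BB (T (Suc (Suc 0))) (T (Suc 0)) H \<and>
    (\<forall>a\<in>carrier A. \<forall>u\<in>carrier (T (Suc 0)). H (tsnoc (Suc 0) u a) = tsnoc (Suc 0) (h u) a)"
  using assms
proof induction
  case (comp f g)
  have fB: "f u \<in> B" if "u \<in> carrier (T (Suc 0))" for u
    using bimod_hom_closed[OF comp(1) that] by simp
  obtain F where F: "F \<in> bimod_hom BB BB (T (Suc (Suc 0))) (T (Suc 0))"
    "\<And>a u. \<lbrakk>a \<in> carrier A; u \<in> carrier (T (Suc 0))\<rbrakk> \<Longrightarrow> F (tsnoc (Suc 0) u a) = pure [f u \<otimes> a]"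
    by (rule suffix_map[OF bimodule_T_BB[of 0] comp(1), of "\<lambda>b a. pure [b \<otimes> a]"])
      (auto simp: pure_1 B_closed r_distr l_distr m_assoc pure_closed intro!: add_homI)
  define c where "c = g \<one>"
  have c: "c \<in> carrier (T (Suc 0))"
    unfolding c_def by (rule bimod_hom_closed[OF comp(2)]) (simp add: B_one)
  have gl: "lact (T (Suc 0)) b c = g b" and gr: "ract (T (Suc 0)) c b = g b" if "b \<in> B" for b
    using bimod_hom_lact[OF comp(2), of b \<one>] bimod_hom_ract[OF comp(2), of b \<one>] that
    by (simp_all add: c_def B_one B_closed)
  have "(\<lambda>y. tsnoc (Suc 0) c y) \<in> add_hom A (T (Suc (Suc 0)))"
    by (intro add_homI add_hom_closed[OF tsnoc_hom c] tsnoc_add c)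
  note lift = tensor_lift[OF abelian_group_T balanced_1[OF abelian_group_T this]]
  define G where "G = tensor_lift (T (Suc (Suc 0))) (Suc 0) (\<lambda>xs. tsnoc (Suc 0) c (hd xs))"
  have G: "G \<in> add_hom (T (Suc 0)) (T (Suc (Suc 0)))" "\<And>y. y \<in> carrier A \<Longrightarrow> G (pure [y]) = tsnoc (Suc 0) c y"
    using lift(1) lift(2)[of "[_]"] by (simp_all add: G_def)
  have G_hom: "G \<in> bimod_hom BB BB (T (Suc 0)) (T (Suc (Suc 0)))"
  proof (rule bimod_homI[OF G(1)])
    fix b u assume "b \<in> carrier BB" and u: "u \<in> carrier (T (Suc 0))"
    then have b: "b \<in> B" "b \<in> carrier A" by (simp_all add: B_closed)
    show "G (lact (T (Suc 0)) b u) = lact (T (Suc (Suc 0))) b (G u)"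
      by (rule tensor_hom_eq_Cons[OF abelian_group_T _ _ _ u])
        (use b c in \<open>auto intro!: add_hom_compose[OF lact_T_hom G(1)] add_hom_compose[OF G(1) lact_T_hom]
          simp: lact_T_pure G(2) lact_tsnoc gl simp flip: tsnoc_balance gr\<close>)
    show "G (ract (T (Suc 0)) u b) = ract (T (Suc (Suc 0))) (G u) b"
    proof (rule tensor_hom_eq_Cons[OF abelian_group_T _ _ _ u])
      show "(\<lambda>u. G (ract (T (Suc 0)) u b)) \<in> add_hom (T (Suc 0)) (T (Suc (Suc 0)))"
        using b by (intro add_hom_compose[OF ract_T_hom G(1)]) auto
      show "(\<lambda>u. ract (T (Suc (Suc 0))) (G u) b) \<in> add_hom (T (Suc 0)) (T (Suc (Suc 0)))"
        using b by (intro add_hom_compose[OF G(1) ract_T_hom]) auto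
      show "G (ract (T (Suc 0)) (pure (x # xs)) b) = ract (T (Suc (Suc 0))) (G (pure (x # xs))) b"
        if "length xs = 0" "x \<in> carrier A" for x xs
        using that b c ract_T_pure[of "Suc 0" b "[]" x] by (simp add: G(2) ract_tsnoc)
    qed
  qed
  have "G (F (tsnoc (Suc 0) u a)) = tsnoc (Suc 0) (g (f u)) a" if "a \<in> carrier A"
    "u \<in> carrier (T (Suc 0))" for a u
    using that fB[OF that(2)] c by (simp add: F(2) G(2) B_closed gr flip: tsnoc_balance)
  then show ?case
    by (intro exI[of _ "\<lambda>x. G (F x)"]) (auto intro: factors.comp[OF F(1) G_hom])
next
  case (add h h')
  then obtain H H' where H: "factors BB BB (T (Suc (Suc 0))) (T (Suc 0)) H"
    "\<forall>a\<in>carrier A. \<forall>u\<in>carrier (T (Suc 0)). H (tsnoc (Suc 0) u a) = tsnoc (Suc 0) (h u) a"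
    "factors BB BB (T (Suc (Suc 0))) (T (Suc 0)) H'"
    "\<forall>a\<in>carrier A. \<forall>u\<in>carrier (T (Suc 0)). H' (tsnoc (Suc 0) u a) = tsnoc (Suc 0) (h' u) a"
    by blast
  note cl = add_hom_closed[OF factors_add_hom[OF add.hyps(1) abelian_group_T]]
    add_hom_closed[OF factors_add_hom[OF add.hyps(2) abelian_group_T]]
  show ?case
    by (rule exI[of _ "\<lambda>x. H x \<oplus>\<^bsub>T (Suc (Suc 0))\<^esub> H' x"])
      (auto intro: factors.add[OF H(1,3)] simp: H(2,4) add_hom_add[OF tsnoc_hom] cl)
next
  case (ext h h')
  then show ?case by simp
qed

text \<open>Says that applying \<epsilon> to the last \<open>k\<close> factors, behind
  \<open>p\<close> untouched ones, is a sum of maps through length \<open>m\<close>. Each of the two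
  summands of the identity will be of this kind or of the mirrored one. The existence of
  \<open>H\<close> includes that the operation on tuples respects the tensor relations.\<close>

definition prefix_factors :: "nat \<Rightarrow> nat \<Rightarrow> nat \<Rightarrow> ('a \<Rightarrow> 'a) \<Rightarrow> bool"
  where "prefix_factors p k m \<epsilon> \<longleftrightarrow> (\<exists>H. factors BB BB (T (p + k)) (T m) H \<and>
    (\<forall>xs ys. length xs = p \<longrightarrow> length ys = k \<longrightarrow> set xs \<subseteq> carrier A \<longrightarrow> set ys \<subseteq> carrier A \<longrightarrow>
      H (pure (xs @ ys)) = pure (xs @ map \<epsilon> ys)))"

definition suffix_factors :: "nat \<Rightarrow> nat \<Rightarrow> nat \<Rightarrow> ('a \<Rightarrow> 'a) \<Rightarrow> bool"
  where "suffix_factors q k m \<epsilon> \<longleftrightarrow> (\<exists>H. factors BB BB (T (k + q)) (T m) H \<and>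
    (\<forall>xs ys. length xs = k \<longrightarrow> length ys = q \<longrightarrow> set xs \<subseteq> carrier A \<longrightarrow> set ys \<subseteq> carrier A \<longrightarrow>
      H (pure (xs @ ys)) = pure (map \<epsilon> xs @ ys)))"

lemma
  assumes "\<And>x. x \<in> carrier A \<Longrightarrow> f x = g x"
  shows prefix_factors_cong: "prefix_factors p k m f \<Longrightarrow> prefix_factors p k m g"
    and suffix_factors_cong: "suffix_factors p k m f \<Longrightarrow> suffix_factors p k m g"
proof -
  have "map g ys = map f ys" if "set ys \<subseteq> carrier A" for ys
    using that assms by (intro map_cong) auto
  then show "prefix_factors p k m f \<Longrightarrow> prefix_factors p k m g"
    "suffix_factors p k m f \<Longrightarrow> suffix_factors p k m g"
    unfolding prefix_factors_def suffix_factors_def by (simp_all del: map_eq_conv)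
qed

text \<open>Each use of \<open>factors_tcons\<close> puts one more untouched factor in front and
  lengthens the intermediate tensor power by one.\<close>

lemma prefix_factors_mono:
  assumes "prefix_factors p (Suc k) (Suc l) \<epsilon>" and \<epsilon>: "\<And>x. x \<in> carrier A \<Longrightarrow> \<epsilon> x \<in> carrier A"
  shows "prefix_factors (p + r) (Suc k) (Suc (l + r)) \<epsilon>"
proof (induction r)
  case 0 then show ?case using assms by simp
next
  case (Suc r)
  from Suc obtain h where h: "factors BB BB (T (Suc (p + r + k))) (T (Suc (l + r))) h"
    "\<And>xs ys. \<lbrakk>length xs = p + r; length ys = Suc k; set xs \<subseteq> carrier A; set ys \<subseteq> carrier A\<rbrakk>
      \<Longrightarrow> h (pure (xs @ ys)) = pure (xs @ map \<epsilon> ys)"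
    unfolding prefix_factors_def by auto
  obtain H where H: "factors BB BB (T (Suc (Suc (p + r + k)))) (T (Suc (Suc (l + r)))) H"
    "\<And>a u. \<lbrakk>a \<in> carrier A; u \<in> carrier (T (Suc (p + r + k)))\<rbrakk>
      \<Longrightarrow> H (tcons (Suc (p + r + k)) a u) = tcons (Suc (p + r + k)) a (h u)"
    using factors_tcons[OF h(1)] by blast
  have "H (pure (xs @ ys)) = pure (xs @ map \<epsilon> ys)"
    if xs: "length xs = p + Suc r" and ys: "length ys = Suc k" "set xs \<subseteq> carrier A"
      "set ys \<subseteq> carrier A" for xs ys
  proof -
    obtain z zs where xs': "xs = z # zs" using xs by (cases xs) auto
    have "set (zs @ map \<epsilon> ys) \<subseteq> carrier A" using ys xs' \<epsilon> by auto
    then show ?thesis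
      using H(2)[of z "pure (zs @ ys)"] xs ys h(2)[of zs ys]
      unfolding xs' by (simp add: tcons_pure pure_closed)
  qed
  then show ?case
    unfolding prefix_factors_def using H(1) by (intro exI[of _ H]) auto
qed

lemma suffix_factors_mono:
  assumes "suffix_factors q (Suc k) (Suc l) \<epsilon>" and \<epsilon>: "\<And>x. x \<in> carrier A \<Longrightarrow> \<epsilon> x \<in> carrier A"
  shows "suffix_factors (q + r) (Suc k) (Suc (l + r)) \<epsilon>"
proof (induction r)
  case 0 then show ?case using assms by simp
next
  case (Suc r)
  from Suc obtain h where h: "factors BB BB (T (Suc (k + q + r))) (T (Suc (l + r))) h"
    "\<And>xs ys. \<lbrakk>length xs = Suc k; length ys = q + r; set xs \<subseteq> carrier A; set ys \<subseteq> carrier A\<rbrakk>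
      \<Longrightarrow> h (pure (xs @ ys)) = pure (map \<epsilon> xs @ ys)"
    unfolding suffix_factors_def by (auto simp: add.assoc)
  obtain H where H: "factors BB BB (T (Suc (Suc (k + q + r)))) (T (Suc (Suc (l + r)))) H"
    "\<And>a u. \<lbrakk>a \<in> carrier A; u \<in> carrier (T (Suc (k + q + r)))\<rbrakk>
      \<Longrightarrow> H (tsnoc (Suc (k + q + r)) u a) = tsnoc (Suc (k + q + r)) (h u) a"
    using factors_tsnoc[OF h(1)] by blast
  have "H (pure (xs @ ys)) = pure (map \<epsilon> xs @ ys)"
    if ys: "length ys = q + Suc r" and xs: "length xs = Suc k" "set xs \<subseteq> carrier A"
      "set ys \<subseteq> carrier A" for xs ys
  proof -
    obtain z zs where ys': "ys = zs @ [z]" using ys by (cases ys rule: rev_cases) auto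
    have "set (map \<epsilon> xs @ zs) \<subseteq> carrier A" using xs ys' \<epsilon> by auto
    then show ?thesis
      using H(2)[of z "pure (xs @ zs)"] xs ys h(2)[of xs zs]
        tsnoc_pure[of z "xs @ zs" "Suc (k + q + r)"] tsnoc_pure[of z "map \<epsilon> xs @ zs" "Suc (k + q + r)"]
      unfolding ys' by (simp add: pure_closed)
  qed
  then show ?case
    unfolding suffix_factors_def using H(1) by (intro exI[of _ H]) (auto simp: add.assoc)
qed

text \<open>The map \<open>u \<mapsto> 1 \<otimes> u\<close> is split by the multiplication
  \<open>a \<otimes> u \<mapsto> a u\<close>. Hence between positive lengths one half of
  H-equivalence is automatic.\<close>

lemma tensor_divides_Suc: "factors BB BB (T (Suc n)) (T (Suc (Suc n))) (\<lambda>x. x)"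
proof -
  interpret M: bimodule A A "T (Suc n)" by (rule bimodule_T)
  have f: "tcons (Suc n) \<one> \<in> bimod_hom BB BB (T (Suc n)) (T (Suc (Suc n)))"
  proof (rule bimod_homI[OF tcons_hom])
    fix b u assume "b \<in> carrier BB" and u: "u \<in> carrier (T (Suc n))"
    then have b: "b \<in> B" "b \<in> carrier A" by (simp_all add: B_closed)
    show "tcons (Suc n) \<one> (lact (T (Suc n)) b u) = lact (T (Suc (Suc n))) b (tcons (Suc n) \<one> u)"
      using tcons_balance[of \<one> b u n] b u by (simp add: lact_tcons)
    show "tcons (Suc n) \<one> (ract (T (Suc n)) u b) = ract (T (Suc (Suc n))) (tcons (Suc n) \<one> u) b"
      using b u by (simp add: ract_tcons)
  qed simp
  obtain g where g: "g \<in> bimod_hom BB BB (T (Suc (Suc n))) (T (Suc n))"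
    "\<And>a u. \<lbrakk>a \<in> carrier A; u \<in> carrier (T (Suc n))\<rbrakk> \<Longrightarrow> g (tcons (Suc n) a u) = lact (T (Suc n)) a u"
    by (rule prefix_map[OF bimodule_T_BB[of n] bimod_hom_id, where n = n and
      k = "\<lambda>a u. lact (T (Suc n)) a u"])
      (auto simp: lact_T_hom M.lact_add_left M.lact_mult B_closed M.lact_ract)
  show ?thesis
    by (rule factors.ext[OF factors.comp[OF f g(1)]]) (simp add: g(2) M.lact_one)
qed

text \<open>Since \<open>e y = \<epsilon> y = (\<epsilon> y) e\<close>, a copy of \<open>e\<close>
  remains available after each factor and crosses the next tensor sign, leaving \<epsilon> behind,
  until the last factor is reached. The condition is imposed only on the entries of the tensor, so
  that it can also be met by diagonal entries with \<open>e'\<close> in place of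
  \<open>e\<close>.\<close>

lemma pure_push_right:
  assumes "e \<in> B" "set ps \<subseteq> carrier A" "x \<in> carrier A" "set xs \<subseteq> carrier A"
    and "\<And>y. y \<in> set (x # xs) \<Longrightarrow> e \<otimes> y = \<epsilon> y \<and> \<epsilon> y \<otimes> e = \<epsilon> y"
  shows "pure (ps @ (e \<otimes> x) # xs) = pure (ps @ map \<epsilon> (x # xs))"
  using assms
proof (induction xs arbitrary: ps x)
  case (Cons y ys)
  have cl: "\<epsilon> x \<in> carrier A"
    using Cons.prems(1,3) Cons.prems(5)[of x] by (metis B_closed list.set_intros(1) m_closed)
  have "pure (ps @ (e \<otimes> x) # y # ys) = pure (ps @ (\<epsilon> x \<otimes> e) # y # ys)"
    using Cons.prems(5)[of x] by simp
  also have "\<dots> = pure ((ps @ [\<epsilon> x]) @ (e \<otimes> y) # ys)"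
    using Cons.prems cl by (subst pure_balance) auto
  also have "\<dots> = pure ((ps @ [\<epsilon> x]) @ map \<epsilon> (y # ys))"
    using Cons.prems cl by (intro Cons.IH) auto
  finally show ?case by simp
qed simp

text \<open>The mirror image; the induction runs from the end of \<open>xs\<close> because
  \<open>e\<close> now travels towards the front.\<close>

lemma pure_push_left:
  assumes "e \<in> B" "set ps \<subseteq> carrier A" "x \<in> carrier A" "set xs \<subseteq> carrier A"
    and "\<And>y. y \<in> set (xs @ [x]) \<Longrightarrow> y \<otimes> e = \<epsilon> y \<and> e \<otimes> \<epsilon> y = \<epsilon> y"
  shows "pure (xs @ (x \<otimes> e) # ps) = pure (map \<epsilon> (xs @ [x]) @ ps)"
  using assms
proof (induction xs arbitrary: ps x rule: rev_induct)
  case (snoc y ys)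
  have cl: "\<epsilon> x \<in> carrier A"
    using snoc.prems(1,3) snoc.prems(5)[of x] by (metis B_closed in_set_conv_decomp m_closed)
  have "pure ((ys @ [y]) @ (x \<otimes> e) # ps) = pure (ys @ y # (e \<otimes> \<epsilon> x) # ps)"
    using snoc.prems(5)[of x] by simp
  also have "\<dots> = pure (ys @ (y \<otimes> e) # \<epsilon> x # ps)"
    using snoc.prems cl by (subst pure_balance) auto
  also have "\<dots> = pure (map \<epsilon> (ys @ [y]) @ \<epsilon> x # ps)"
    using snoc.prems cl by (intro snoc.IH) auto
  finally show ?case by simp
qed simp

end


section \<open>Functoriality of the tensor powers\<close>

text \<open>The map \<open>\<phi>\<close> need not preserve the unit: the inclusion of a corner \<open>e A e\<close> is the main example.\<close>

locale ring_pair_map = C: ring_pair C D + A: ring_pair A B for C D A B +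
  fixes \<phi>
  assumes add_hom: "\<phi> \<in> add_hom C A"
    and mult: "\<lbrakk>x \<in> carrier C; y \<in> carrier C\<rbrakk> \<Longrightarrow> \<phi> (x \<otimes>\<^bsub>C\<^esub> y) = \<phi> x \<otimes>\<^bsub>A\<^esub> \<phi> y"
    and maps_sub: "b \<in> D \<Longrightarrow> \<phi> b \<in> B"
begin

definition tmap
  where "tmap n = C.tensor_lift (A.T n) n (\<lambda>xs. A.pure (map \<phi> xs))"

lemma maps_closed: "x \<in> carrier C \<Longrightarrow> \<phi> x \<in> carrier A"
  by (rule add_hom_closed[OF add_hom])

lemma maps_list_closed: "set xs \<subseteq> carrier C \<Longrightarrow> set (map \<phi> xs) \<subseteq> carrier A"
  using maps_closed by auto

lemma tmap:
  shows tmap_hom: "tmap n \<in> add_hom (C.T n) (A.T n)"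
    and tmap_pure: "\<lbrakk>length xs = n; set xs \<subseteq> carrier C\<rbrakk> \<Longrightarrow> tmap n (C.pure xs) = A.pure (map \<phi> xs)"
proof -
  have "C.balanced (A.T n) n (\<lambda>xs. A.pure (map \<phi> xs))"
  proof (rule C.balancedI)
    fix xs assume "xs \<in> tuples C n"
    then show "A.pure (map \<phi> xs) \<in> carrier (A.T n)"
      by (auto intro!: A.pure_closed maps_closed simp: tuples_def)
  next
    fix xs b c ys
    assume *: "length xs + length ys + 1 = n" "set xs \<subseteq> carrier C" "set ys \<subseteq> carrier C" "b \<in> carrier C"
      "c \<in> carrier C"
    then show "A.pure (map \<phi> (xs @ (b \<oplus>\<^bsub>C\<^esub> c) # ys))
      = A.pure (map \<phi> (xs @ b # ys)) \<oplus>\<^bsub>A.T n\<^esub> A.pure (map \<phi> (xs @ c # ys))"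
      using A.pure_add[of "map \<phi> xs" "map \<phi> ys" "\<phi> b" "\<phi> c" n] maps_list_closed[of xs] maps_list_closed[of ys]
      by (simp add: add_hom_add[OF add_hom] maps_closed)
  next
    fix xs b c d ys
    assume *: "length xs + length ys + 2 = n" "set xs \<subseteq> carrier C" "set ys \<subseteq> carrier C" "b \<in> carrier C"
      "d \<in> carrier C" "c \<in> D"
    then show "A.pure (map \<phi> (xs @ (b \<otimes>\<^bsub>C\<^esub> c) # d # ys)) = A.pure (map \<phi> (xs @ b # (c \<otimes>\<^bsub>C\<^esub> d) # ys))"
      using A.pure_balance[of "map \<phi> xs" "map \<phi> ys" "\<phi> b" "\<phi> d"
        "\<phi> c"] maps_list_closed[of xs] maps_list_closed[of ys]
      by (simp add: mult maps_closed maps_sub C.B_closed)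
  qed
  from C.tensor_lift[OF A.abelian_group_T this]
  show "tmap n \<in> add_hom (C.T n) (A.T n)"
    "\<lbrakk>length xs = n; set xs \<subseteq> carrier C\<rbrakk> \<Longrightarrow> tmap n (C.pure xs) = A.pure (map \<phi> xs)"
    by (simp_all add: tmap_def)
qed

text \<open>The scalar \<open>a\<close> need not be \<phi> of \<open>c\<close>. For a corner
  embedding \<open>i\<close> with projection \<open>p\<close>, an element \<open>b\<close> of
  \<open>B\<close> acts on the image as \<open>p b\<close> does, although \<open>i (p b)\<close> may
  differ from \<open>b\<close>.\<close>

lemma tmap_lact_gen:
  assumes "a \<in> carrier A" "c \<in> carrier C" "u \<in> carrier (C.T (Suc n))"
    and "\<And>x. x \<in> carrier C \<Longrightarrow> \<phi> (c \<otimes>\<^bsub>C\<^esub> x) = a \<otimes>\<^bsub>A\<^esub> \<phi> x"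
  shows "tmap (Suc n) (lact (C.T (Suc n)) c u) = lact (A.T (Suc n)) a (tmap (Suc n) u)"
proof (rule C.tensor_hom_eq_Cons[OF A.abelian_group_T _ _ _ assms(3)])
  show "(\<lambda>u. tmap (Suc n) (lact (C.T (Suc n)) c u)) \<in> add_hom (C.T (Suc n)) (A.T (Suc n))"
    using assms by (intro add_hom_compose[OF C.lact_T_hom tmap_hom]) auto
  show "(\<lambda>u. lact (A.T (Suc n)) a (tmap (Suc n) u)) \<in> add_hom (C.T (Suc n)) (A.T (Suc n))"
    using assms by (intro add_hom_compose[OF tmap_hom A.lact_T_hom]) auto
  show "tmap (Suc n) (lact (C.T (Suc n)) c (C.pure (x # xs)))
    = lact (A.T (Suc n)) a (tmap (Suc n) (C.pure (x # xs)))"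
    if "length xs = n" "x \<in> carrier C" "set xs \<subseteq> carrier C" for x xs
    using that assms maps_list_closed[of xs]
    by (simp add: C.lact_T_pure tmap_pure A.lact_T_pure maps_closed)
qed

lemma tmap_ract_gen:
  assumes "a \<in> carrier A" "c \<in> carrier C" "u \<in> carrier (C.T (Suc n))"
    and "\<And>x. x \<in> carrier C \<Longrightarrow> \<phi> (x \<otimes>\<^bsub>C\<^esub> c) = \<phi> x \<otimes>\<^bsub>A\<^esub> a"
  shows "tmap (Suc n) (ract (C.T (Suc n)) u c) = ract (A.T (Suc n)) (tmap (Suc n) u) a"
proof (rule C.tensor_hom_eq_snoc[OF A.abelian_group_T _ _ _ assms(3)])
  show "(\<lambda>u. tmap (Suc n) (ract (C.T (Suc n)) u c)) \<in> add_hom (C.T (Suc n)) (A.T (Suc n))"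
    using assms by (intro add_hom_compose[OF C.ract_T_hom tmap_hom]) auto
  show "(\<lambda>u. ract (A.T (Suc n)) (tmap (Suc n) u) a) \<in> add_hom (C.T (Suc n)) (A.T (Suc n))"
    using assms by (intro add_hom_compose[OF tmap_hom A.ract_T_hom]) auto
  show "tmap (Suc n) (ract (C.T (Suc n)) (C.pure (xs @ [x])) c)
    = ract (A.T (Suc n)) (tmap (Suc n) (C.pure (xs @ [x]))) a"
    if "length xs = n" "x \<in> carrier C" "set xs \<subseteq> carrier C" for x xs
    using that assms maps_list_closed[of xs]
    by (simp add: C.ract_T_pure tmap_pure A.ract_T_pure maps_closed)
qed

lemma tmap_lact:
  "\<lbrakk>c \<in> carrier C; u \<in> carrier (C.T (Suc n))\<rbrakk>
    \<Longrightarrow> tmap (Suc n) (lact (C.T (Suc n)) c u) = lact (A.T (Suc n)) (\<phi> c) (tmap (Suc n) u)"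
  by (rule tmap_lact_gen) (auto simp: maps_closed mult)

lemma tmap_ract:
  "\<lbrakk>c \<in> carrier C; u \<in> carrier (C.T (Suc n))\<rbrakk>
    \<Longrightarrow> tmap (Suc n) (ract (C.T (Suc n)) u c) = ract (A.T (Suc n)) (tmap (Suc n) u) (\<phi> c)"
  by (rule tmap_ract_gen) (auto simp: maps_closed mult)

end

lemma tmap_retract:
  assumes "ring_pair_map C D A B i" "ring_pair_map A B C D p"
    and "\<And>x. x \<in> carrier C \<Longrightarrow> p (i x) = x" and "u \<in> carrier (tensor_power D C n)"
  shows "ring_pair_map.tmap A B C D p n (ring_pair_map.tmap C D A B i n u) = u"
proof -
  interpret i: ring_pair_map C D A B i by fact
  interpret p: ring_pair_map A B C D p by fact
  show ?thesis
  proof (rule i.C.tensor_hom_eq[OF i.C.abelian_group_T add_hom_compose[OF i.tmap_hom p.tmap_hom]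
    add_hom_id _ assms(4)])
    fix xs assume xs: "length xs = n" "set xs \<subseteq> carrier C"
    have "map (\<lambda>x. p (i x)) xs = map (\<lambda>x. x) xs"
      using xs(2) assms(3) by (intro map_cong) auto
    then show "p.tmap n (i.tmap n (i.C.pure xs)) = i.C.pure xs"
      using xs i.maps_list_closed[OF xs(2)] by (simp add: i.tmap_pure p.tmap_pure o_def)
  qed
qed

section \<open>Depth and restriction of scalars\<close>

text \<open>Linearity over larger scalar rings implies linearity over smaller ones; this is how even
  depth yields odd depth.\<close>

lemma factors_restrict:
  assumes "factors L R M N h" "carrier L' \<subseteq> carrier L" "carrier R' \<subseteq> carrier R"
  shows "factors L' R' M N h"
  using assms(1)
proof induction
  case (comp f g)
  then have "f \<in> bimod_hom L' R' M N" "g \<in> bimod_hom L' R' N M"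
    using assms(2,3) by (auto simp: bimod_hom_def)
  then show ?case by (rule factors.comp)
qed (auto intro: factors.add factors.ext)

lemma Inf_enat_mem: "S \<noteq> {} \<Longrightarrow> Inf S \<in> S" for S :: "enat set"
  by (auto simp: Inf_enat_def intro: LeastI)

context ring_pair
begin

lemma depth_odd_0_iff:
  "depth_odd B A 0 \<longleftrightarrow> factors BB BB (T (Suc 0)) (regular_bimodule BB) (\<lambda>x. x) \<and>
    factors BB BB (regular_bimodule BB) (T (Suc 0)) (\<lambda>x. x)"
  using H_equivalent_iff[OF bimodule_T_BB[of 0] bimodule_regular] by (simp add: depth_odd_def Let_def)

text \<open>One direction suffices, the other being \<open>tensor_divides_Suc\<close>. At index 0
  both directions have to be kept.\<close>

lemma depth_odd_Suc_iff:
  "depth_odd B A (Suc m) \<longleftrightarrow> factors BB BB (T (Suc (Suc m))) (T (Suc m)) (\<lambda>x. x)"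
  using H_equivalent_iff[OF bimodule_T_BB[of "Suc m"] bimodule_T_BB[of m]] tensor_divides_Suc[of m]
  by (simp add: depth_odd_def Let_def)

lemma depth_even_imp_odd:
  assumes "left_depth_even B A m \<or> right_depth_even B A m" "m \<ge> 1"
  shows "depth_odd B A m"
proof -
  obtain k where m: "m = Suc k" using assms(2) by (cases m) auto
  \<comment> \<open>Lets \<open>bimodule_restrict\<close> be applied on one side only, the whole
    ring being the subring on the other side.\<close>
  have A: "A\<lparr>carrier := carrier A\<rparr> = A" by simp
  have sub: "carrier BB \<subseteq> carrier A" using B_closed by auto
  note l = bimodule_restrict[OF bimodule_T B_subring carrier_is_subring, unfolded A]
  note r = bimodule_restrict[OF bimodule_T carrier_is_subring B_subring, unfolded A]
  have "factors BB A (T (Suc (Suc k))) (T (Suc k)) (\<lambda>x. x) \<or>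
      factors A BB (T (Suc (Suc k))) (T (Suc k)) (\<lambda>x. x)"
    using assms(1) H_equivalent_iff[OF l[of "Suc k"] l[of k]] H_equivalent_iff[OF r[of "Suc k"] r[of k]]
    by (auto simp: left_depth_even_def right_depth_even_def m)
  then have "factors BB BB (T (Suc (Suc k))) (T (Suc k)) (\<lambda>x. x)"
    by (auto intro: factors_restrict[OF _ order_refl sub] factors_restrict[OF _ sub order_refl])
  then show ?thesis by (simp add: m depth_odd_Suc_iff)
qed

text \<open>The minimum depth, if finite, is attained. Whether it is \<open>2 m + 1\<close> or
  \<open>2 m\<close>, the least odd number above it is \<open>2 m + 1\<close>, and in the even case
  depth \<open>2 m\<close> implies depth \<open>2 m + 1\<close>.\<close>

lemma min_odd_depth_cases:
  obtains "min_odd_depth B A = \<infinity>" | m where "min_odd_depth B A = enat (2 * m + 1)" "depth_odd B A m"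
proof (cases "min_depth B A")
  case infinity
  then have "min_odd_depth B A = \<infinity>"
    by (simp add: min_odd_depth_def top_enat_def)
  then show thesis by (rule that)
next
  case (enat d)
  let ?S = "{enat (2 * m + 1) | m. depth_odd B A m} \<union>
    {enat (2 * m) | m. m \<ge> 1 \<and> (left_depth_even B A m \<or> right_depth_even B A m)}"
  have "?S \<noteq> {}"
  proof
    assume "?S = {}"
    then have "min_depth B A = \<infinity>"
      unfolding min_depth_def by (simp only: Inf_enat_def simp_thms if_True)
    then show False using enat by simp
  qed
  then have "Inf ?S \<in> ?S" by (rule Inf_enat_mem)
  then have d: "enat d \<in> ?S"
    using enat by (simp add: min_depth_def)
  have odd_eq: "min_odd_depth B A = enat k" if "odd k" "d \<le> k" "\<And>j. odd j \<Longrightarrow> d \<le> j \<Longrightarrow> k \<le> j" for k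
    unfolding min_odd_depth_def enat
    by (rule antisym) (use that in \<open>auto intro!: Inf_lower Inf_greatest\<close>)
  obtain m where m: "depth_odd B A m" "d = 2 * m + 1 \<or> d = 2 * m"
    using d depth_even_imp_odd by auto
  have "min_odd_depth B A = enat (2 * m + 1)"
    by (rule odd_eq) (use m(2) in \<open>auto elim!: oddE\<close>)
  then show thesis using m(1) by (rule that)
qed

lemma min_depth_le: "depth_odd B A m \<Longrightarrow> min_depth B A \<le> enat (2 * m + 1)"
  unfolding min_depth_def by (rule Inf_lower) auto

lemma min_odd_depth_le: "depth_odd B A m \<Longrightarrow> min_odd_depth B A \<le> enat (2 * m + 1)"
  unfolding min_odd_depth_def using min_depth_le[of m] by (intro Inf_lower) auto

end


section \<open>Retracts of rings\<close>

text \<open>\<open>M'\<close> is a retract of \<open>M\<close> over the map \<open>i\<close> of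
  scalars, with the idempotent \<open>j\<close> after \<open>p\<close> prescribed as
  \<open>u \<mapsto> e u + u e'\<close>. When \<open>e\<close> and \<open>e'\<close> are scalars,
  this idempotent is expressed by the actions and so is natural in \<open>M\<close>, even where it
  is not itself linear.\<close>

definition bimod_retract where
  "bimod_retract D i e e' M' M j p \<longleftrightarrow> j \<in> add_hom M' M \<and> p \<in> add_hom M M' \<and>
    (\<forall>x\<in>carrier M'. p (j x) = x) \<and>
    (\<forall>u\<in>carrier M. j (p u) = lact M e u \<oplus>\<^bsub>M\<^esub> ract M u e') \<and>
    (\<forall>c\<in>carrier D. \<forall>x\<in>carrier M'. j (lact M' c x) = lact M (i c) (j x) \<and> j (ract M' x c)
      = ract M (j x) (i c)) \<and>
    (\<forall>c\<in>carrier D. \<forall>u\<in>carrier M. p (lact M (i c) u) = lact M' c (p u) \<and> p (ract M u (i c)) = ract M' (p u) c)"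

lemma factors_retract_hom:
  assumes M: "bimod_retract D i e e' M' M j p" and N: "bimod_retract D i e e' N' N j' p'"
    and i: "\<And>c. c \<in> carrier D \<Longrightarrow> i c \<in> carrier B"
    and f: "f \<in> bimod_hom B B M N"
  shows "(\<lambda>x. p' (f (j x))) \<in> bimod_hom D D M' N'"
proof (rule bimod_homI)
  have j: "j \<in> add_hom M' M" and p': "p' \<in> add_hom N N'"
    using M N by (auto simp: bimod_retract_def)
  show "(\<lambda>x. p' (f (j x))) \<in> add_hom M' N'"
    by (rule add_hom_compose[OF add_hom_compose[OF j bimod_hom_add_hom[OF f]] p'])
  fix c x assume c: "c \<in> carrier D" and x: "x \<in> carrier M'"
  have jx: "j x \<in> carrier M" using add_hom_closed[OF j x] .
  then have fx: "f (j x) \<in> carrier N" by (rule bimod_hom_closed[OF f])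
  show "p' (f (j (lact M' c x))) = lact N' c (p' (f (j x)))"
    "p' (f (j (ract M' x c))) = ract N' (p' (f (j x))) c"
    using M N c x fx bimod_hom_lact[OF f i[OF c] jx] bimod_hom_ract[OF f i[OF c] jx]
    by (auto simp: bimod_retract_def)
qed

text \<open>A homomorphism \<open>M \<rightarrow> N\<close> commutes with \<open>u \<mapsto> e u + u e'\<close>, that is, with the projections onto the retracts.\<close>

lemma factors_retract:
  assumes M: "bimod_retract D i e e' M' M j p" and N: "bimod_retract D i e e' N' N j' p'"
    and i: "\<And>c. c \<in> carrier D \<Longrightarrow> i c \<in> carrier B" and e: "e \<in> carrier B" "e' \<in> carrier B"
    and bimod: "bimodule B B M" "bimodule B B N"
    and "factors B B M N (\<lambda>x. x)"
  shows "factors D D M' N' (\<lambda>x. x)"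
proof -
  have j: "j \<in> add_hom M' M" and p: "p \<in> add_hom M M'"
    and pj: "\<And>x. x \<in> carrier M' \<Longrightarrow> p (j x) = x"
    and jp: "\<And>u. u \<in> carrier M \<Longrightarrow> j (p u) = lact M e u \<oplus>\<^bsub>M\<^esub> ract M u e'"
    and jp': "\<And>u. u \<in> carrier N \<Longrightarrow> j' (p' u) = lact N e u \<oplus>\<^bsub>N\<^esub> ract N u e'"
    using M N by (auto simp: bimod_retract_def)
  have "p (g (j' (p' (f (j x))))) = p (g (f (j x)))"
    if f: "f \<in> bimod_hom B B M N" and g: "g \<in> bimod_hom B B N M" and x: "x \<in> carrier M'" for f g x
  proof -
    let ?y = "f (j x)"
    have y: "?y \<in> carrier N" by (intro bimod_hom_closed[OF f] add_hom_closed[OF j x])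
    then have gy: "g ?y \<in> carrier M" by (rule bimod_hom_closed[OF g])
    have "g (j' (p' ?y)) = j (p (g ?y))"
      using y gy e bimod by (simp add: jp jp' bimod_hom_add[OF g] bimod_hom_lact[OF g] bimod_hom_ract[OF g]
          bimodule.lact_closed bimodule.ract_closed)
    then show ?thesis using add_hom_closed[OF p gy] by (simp add: pj)
  qed
  then have "factors D D M' N' (\<lambda>x. p (j x))"
    using factors_transfer[where q = p' and j = j', OF assms(8) bimodule_abelian_group[OF bimod(1)]
      p, of j D D N']
      factors_retract_hom[OF M N i] factors_retract_hom[OF N M i] add_hom_closed[OF j] by blast
  then show ?thesis by (rule factors.ext) (simp add: pj)
qed

text \<open>The conditions \<open>ip_T\<close> and \<open>ip_B\<close> make the tensor powers over
  \<open>C\<close> and the scalar ring \<open>D\<close> retracts of their counterparts for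
  \<open>A\<close> in the sense of \<open>bimod_retract\<close>, with the same \<open>e\<close> and
  \<open>e'\<close>. Depth 1 and higher odd depths then transfer by the same argument.\<close>

lemma depth_odd_retract:
  assumes "ring_pair_map C D A B i" "ring_pair_map A B C D p"
    and pi: "\<And>x. x \<in> carrier C \<Longrightarrow> p (i x) = x"
    and e: "e \<in> B" "e' \<in> B"
    and ip_T: "\<And>n u. u \<in> carrier (tensor_power B A (Suc n)) \<Longrightarrow>
      ring_pair_map.tmap C D A B i (Suc n) (ring_pair_map.tmap A B C D p (Suc n) u)
        = lact (tensor_power B A (Suc n)) e u \<oplus>\<^bsub>tensor_power B A (Suc n)\<^esub>
          ract (tensor_power B A (Suc n)) u e'"
    and ip_B: "\<And>b. b \<in> B \<Longrightarrow> i (p b) = e \<otimes>\<^bsub>A\<^esub> b \<oplus>\<^bsub>A\<^esub> b \<otimes>\<^bsub>A\<^esub> e'"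
    and "depth_odd B A m"
  shows "depth_odd D C m"
proof -
  interpret i: ring_pair_map C D A B i by fact
  interpret p: ring_pair_map A B C D p by fact
  have T: "bimod_retract i.C.BB i e e' (i.C.T (Suc n)) (i.A.T (Suc n)) (i.tmap (Suc n)) (p.tmap (Suc n))"
    for n
    unfolding bimod_retract_def
    using tmap_retract[OF assms(1,2) pi, of _ "Suc n"]
    by (auto simp: i.tmap_hom p.tmap_hom ip_T i.tmap_lact p.tmap_lact i.tmap_ract p.tmap_ract i.C.B_closed
        i.maps_closed pi)
  have reg: "bimod_retract i.C.BB i e e' (regular_bimodule i.C.BB) (regular_bimodule i.A.BB) i p"
    unfolding bimod_retract_def
    by (auto intro!: add_homI simp: i.maps_sub p.maps_sub i.C.B_closed i.A.B_closed add_hom_add[OF i.add_hom]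
      add_hom_add[OF p.add_hom] pi ip_B i.mult p.mult i.maps_closed)
  have i: "i c \<in> carrier i.A.BB" if "c \<in> carrier i.C.BB" for c
    using that by (simp add: i.maps_sub)
  have e': "e \<in> carrier i.A.BB" "e' \<in> carrier i.A.BB" using e by simp_all
  show ?thesis
  proof (cases m)
    case 0
    then show ?thesis
      using assms(8) factors_retract[OF T reg i e' i.A.bimodule_T_BB i.A.bimodule_regular]
        factors_retract[OF reg T i e' i.A.bimodule_regular i.A.bimodule_T_BB]
      by (simp add: i.C.depth_odd_0_iff i.A.depth_odd_0_iff)
  next
    case (Suc k)
    then show ?thesis
      using assms(8) factors_retract[OF T T i e' i.A.bimodule_T_BB i.A.bimodule_T_BB]
      by (simp add: i.C.depth_odd_Suc_iff i.A.depth_odd_Suc_iff)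
  qed
qed

text \<open>By \<open>il\<close> and \<open>ir\<close>, \<open>B\<close> acts on the image of
  \<open>C\<close> through \<open>p\<close>. A bimodule map over \<open>D\<close> thus becomes one
  over \<open>B\<close> after conjugation with the tensor powers of \<open>i\<close> and
  \<open>p\<close>. On tuples the inflated identity replaces every factor \<open>x\<close> by
  \<open>i (p x)\<close>.\<close>

lemma corner_factors:
  assumes "ring_pair_map C D A B i" "ring_pair_map A B C D p"
    and pi: "\<And>x. x \<in> carrier C \<Longrightarrow> p (i x) = x"
    and il: "\<And>b x. \<lbrakk>b \<in> B; x \<in> carrier C\<rbrakk> \<Longrightarrow> b \<otimes>\<^bsub>A\<^esub> i x = i (p b \<otimes>\<^bsub>C\<^esub> x)"
    and ir: "\<And>b x. \<lbrakk>b \<in> B; x \<in> carrier C\<rbrakk> \<Longrightarrow> i x \<otimes>\<^bsub>A\<^esub> b = i (x \<otimes>\<^bsub>C\<^esub> p b)"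
  defines "tp \<equiv> ring_pair_map.tmap A B C D p" and "ti \<equiv> ring_pair_map.tmap C D A B i"
  shows "factors (C\<lparr>carrier := D\<rparr>) (C\<lparr>carrier := D\<rparr>) (tensor_power D C (Suc k)) (tensor_power D C (Suc l)) h
      \<Longrightarrow> factors (A\<lparr>carrier := B\<rparr>) (A\<lparr>carrier := B\<rparr>) (tensor_power B A (Suc k)) (tensor_power B A (Suc l))
        (\<lambda>u. ti (Suc k) (h (tp (Suc k) u)))" (is "?f \<Longrightarrow> ?f'")
    and "factors (C\<lparr>carrier := D\<rparr>) (C\<lparr>carrier := D\<rparr>) (tensor_power D C (Suc k)) (regular_bimodule (C\<lparr>carrier
      := D\<rparr>)) h
      \<Longrightarrow> factors (A\<lparr>carrier := B\<rparr>) (A\<lparr>carrier := B\<rparr>) (tensor_power B A (Suc k)) (regular_bimodule (A\<lparr>carrier :=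
        B\<rparr>))
        (\<lambda>u. ti (Suc k) (h (tp (Suc k) u)))" (is "?g \<Longrightarrow> ?g'")
proof -
  interpret i: ring_pair_map C D A B i by fact
  interpret p: ring_pair_map A B C D p by fact
  have lact: "i.tmap (Suc n) (lact (i.C.T (Suc n)) (p b) u) = lact (i.A.T (Suc n)) b (i.tmap (Suc n) u)"
    if "b \<in> B" "u \<in> carrier (i.C.T (Suc n))" for n b u
    using that by (intro i.tmap_lact_gen) (auto simp: il p.maps_closed i.A.B_closed)
  have ract: "i.tmap (Suc n) (ract (i.C.T (Suc n)) u (p b)) = ract (i.A.T (Suc n)) (i.tmap (Suc n) u) b"
    if "b \<in> B" "u \<in> carrier (i.C.T (Suc n))" for n b u
    using that by (intro i.tmap_ract_gen) (auto simp: ir p.maps_closed i.A.B_closed)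
  have retract: "p.tmap n (i.tmap n u) = u" if "u \<in> carrier (i.C.T n)" for n u
    by (rule tmap_retract[OF assms(1,2) pi that])
  have TT: "(\<lambda>x. i.tmap (Suc b) (f (p.tmap (Suc a) x)))
    \<in> bimod_hom i.A.BB i.A.BB (i.A.T (Suc a)) (i.A.T (Suc b))"
    if f: "f \<in> bimod_hom i.C.BB i.C.BB (i.C.T (Suc a)) (i.C.T (Suc b))" for f a b
  proof (rule bimod_homI)
    show "(\<lambda>x. i.tmap (Suc b) (f (p.tmap (Suc a) x))) \<in> add_hom (i.A.T (Suc a)) (i.A.T (Suc b))"
      by (rule add_hom_compose[OF add_hom_compose[OF p.tmap_hom bimod_hom_add_hom[OF f]] i.tmap_hom])
  qed (simp_all add: i.A.B_closed p.tmap_lact p.tmap_ract bimod_hom_lact[OF f] bimod_hom_ract[OF f] p.maps_sub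
      add_hom_closed[OF p.tmap_hom] lact ract bimod_hom_closed[OF f])
  have TB: "(\<lambda>x. i (f (p.tmap (Suc a) x))) \<in> bimod_hom i.A.BB i.A.BB (i.A.T (Suc a)) (regular_bimodule
    i.A.BB)"
    if f: "f \<in> bimod_hom i.C.BB i.C.BB (i.C.T (Suc a)) (regular_bimodule i.C.BB)" for f a
  proof (rule bimod_homI)
    have "i \<in> add_hom (regular_bimodule i.C.BB) (regular_bimodule i.A.BB)"
      by (auto intro!: add_homI simp: i.maps_sub i.C.B_closed add_hom_add[OF i.add_hom])
    then show "(\<lambda>x. i (f (p.tmap (Suc a) x))) \<in> add_hom (i.A.T (Suc a)) (regular_bimodule i.A.BB)"
      by (rule add_hom_compose[OF add_hom_compose[OF p.tmap_hom bimod_hom_add_hom[OF f]]])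
  qed (use bimod_hom_closed[OF f] in \<open>simp_all add: i.A.B_closed i.C.B_closed p.tmap_lact p.tmap_ract
    bimod_hom_lact[OF f]
      bimod_hom_ract[OF f] p.maps_sub add_hom_closed[OF p.tmap_hom] il ir\<close>)
  have BT: "(\<lambda>x. i.tmap (Suc a) (f (p x))) \<in> bimod_hom i.A.BB i.A.BB (regular_bimodule i.A.BB) (i.A.T (Suc
    a))"
    if f: "f \<in> bimod_hom i.C.BB i.C.BB (regular_bimodule i.C.BB) (i.C.T (Suc a))" for f a
  proof (rule bimod_homI)
    have "p \<in> add_hom (regular_bimodule i.A.BB) (regular_bimodule i.C.BB)"
      by (auto intro!: add_homI simp: p.maps_sub i.A.B_closed add_hom_add[OF p.add_hom])
    then show "(\<lambda>x. i.tmap (Suc a) (f (p x))) \<in> add_hom (regular_bimodule i.A.BB) (i.A.T (Suc a))"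
      by (rule add_hom_compose[OF add_hom_compose[OF _ bimod_hom_add_hom[OF f]] i.tmap_hom])
    fix b x assume "b \<in> carrier i.A.BB" and "x \<in> carrier (regular_bimodule i.A.BB)"
    then have *: "b \<in> B" "x \<in> B" "p b \<in> D" "p x \<in> D" by (simp_all add: p.maps_sub)
    then have "f (p x) \<in> carrier (i.C.T (Suc a))" using bimod_hom_closed[OF f] by simp
    then show "i.tmap (Suc a) (f (p (lact (regular_bimodule i.A.BB) b x)))
      = lact (i.A.T (Suc a)) b (i.tmap (Suc a) (f (p x)))"
      "i.tmap (Suc a) (f (p (ract (regular_bimodule i.A.BB) x b)))
        = ract (i.A.T (Suc a)) (i.tmap (Suc a) (f (p x))) b"
      using * bimod_hom_lact[OF f, of "p b" "p x"] bimod_hom_ract[OF f, of "p b" "p x"]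
      by (simp_all add: i.A.B_closed p.mult lact ract)
  qed
  \<comment> \<open>Here the transfer goes from \<open>C\<close> to \<open>A\<close>: the maps
    induced by \<open>p\<close> enter, those induced by \<open>i\<close> leave. The composite
    inserted in the middle is the identity since \<open>p (i x) = x\<close>.\<close>
  show ?f' if ?f
    unfolding ti_def tp_def
    by (rule factors_transfer[OF that i.C.abelian_group_T i.tmap_hom add_hom_closed[OF p.tmap_hom] TT TT])
      (use bimod_hom_closed in \<open>fastforce simp: retract add_hom_closed[OF p.tmap_hom]\<close>)+
  show ?g' if ?g
    unfolding ti_def tp_def
    by (rule factors_transfer[OF that i.C.abelian_group_T i.tmap_hom add_hom_closed[OF p.tmap_hom] TB BT])
      (use bimod_hom_closed in \<open>fastforce simp: pi i.C.B_closed add_hom_closed[OF p.tmap_hom]\<close>)+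
qed

text \<open>Depth \<open>2 m + 1\<close> of the corner shortens \<open>m + 1\<close> factors to
  \<open>m\<close>; next to \<open>r + 1\<close> untouched factors the total length drops from
  \<open>m + r + 2\<close> to \<open>m + r + 1\<close>. For \<open>m = 0\<close> the corner shortens
  to its scalars, which an adjacent untouched factor absorbs; there is one because
  \<open>r + 1\<close> is positive.\<close>

lemma corner_tensor_factors:
  assumes "ring_pair_map C D A B i" "ring_pair_map A B C D p"
    and pi: "\<And>x. x \<in> carrier C \<Longrightarrow> p (i x) = x"
    and il: "\<And>b x. \<lbrakk>b \<in> B; x \<in> carrier C\<rbrakk> \<Longrightarrow> b \<otimes>\<^bsub>A\<^esub> i x = i (p b \<otimes>\<^bsub>C\<^esub> x)"
    and ir: "\<And>b x. \<lbrakk>b \<in> B; x \<in> carrier C\<rbrakk> \<Longrightarrow> i x \<otimes>\<^bsub>A\<^esub> b = i (x \<otimes>\<^bsub>C\<^esub> p b)"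
    and "depth_odd D C m"
  shows "ring_pair.prefix_factors A B (Suc r) (Suc m) (Suc (m + r)) (\<lambda>x. i (p x))"
    and "ring_pair.suffix_factors A B (Suc r) (Suc m) (Suc (m + r)) (\<lambda>x. i (p x))"
proof -
  interpret i: ring_pair_map C D A B i by fact
  interpret p: ring_pair_map A B C D p by fact
  have cl: "i (p x) \<in> carrier A" if "x \<in> carrier A" for x
    using that by (simp add: i.maps_closed p.maps_closed)
  have ip: "i.tmap n (p.tmap n (i.A.pure xs)) = i.A.pure (map (\<lambda>x. i (p x)) xs)"
    if "length xs = n" "set xs \<subseteq> carrier A" for n xs
    using that p.maps_list_closed[OF that(2)] by (simp add: p.tmap_pure i.tmap_pure o_def)
  have "i.A.prefix_factors (Suc r) (Suc m) (Suc (m + r)) (\<lambda>x. i (p x)) \<and>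
    i.A.suffix_factors (Suc r) (Suc m) (Suc (m + r)) (\<lambda>x. i (p x))"
  proof (cases m)
    case 0
    then have "factors i.C.BB i.C.BB (i.C.T (Suc 0)) (regular_bimodule i.C.BB) (\<lambda>x. x)"
      using assms(6) i.C.depth_odd_0_iff by simp
    note corner_factors(2)[OF assms(1-5) this]
    then have f: "factors i.A.BB i.A.BB (i.A.T (Suc 0)) (regular_bimodule i.A.BB) (\<lambda>u. i.tmap (Suc 0) (p.tmap
      (Suc 0) u))"
      by blast
    obtain H where H: "factors i.A.BB i.A.BB (i.A.T (Suc (Suc 0))) (i.A.T (Suc 0)) H"
      "\<And>a u. \<lbrakk>a \<in> carrier A; u \<in> carrier (i.A.T (Suc 0))\<rbrakk>
        \<Longrightarrow> H (i.A.tcons (Suc 0) a u) = i.A.tcons (Suc 0) a (i.tmap (Suc 0) (p.tmap (Suc 0) u))"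
      using i.A.factors_tcons_0[OF f] by blast
    have "H (i.A.pure (xs @ ys)) = i.A.pure (xs @ map (\<lambda>x. i (p x)) ys)"
      if len: "length xs = Suc 0" "length ys = Suc 0" and "set xs \<subseteq> carrier A" "set ys \<subseteq> carrier A" for xs ys
    proof -
      obtain x y where "xs = [x]" "ys = [y]" using len by (auto simp: length_Suc_conv)
      then show ?thesis
        using H(2)[of x "i.A.pure [y]"] that ip[of "[y]"] cl by (simp add: i.A.tcons_pure i.A.pure_closed)
    qed
    then have 1: "i.A.prefix_factors (Suc 0) (Suc 0) (Suc 0) (\<lambda>x. i (p x))"
      unfolding i.A.prefix_factors_def using H(1) by (intro exI[of _ H]) auto
    obtain H where H: "factors i.A.BB i.A.BB (i.A.T (Suc (Suc 0))) (i.A.T (Suc 0)) H"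
      "\<And>a u. \<lbrakk>a \<in> carrier A; u \<in> carrier (i.A.T (Suc 0))\<rbrakk>
        \<Longrightarrow> H (i.A.tsnoc (Suc 0) u a) = i.A.tsnoc (Suc 0) (i.tmap (Suc 0) (p.tmap (Suc 0) u)) a"
      using i.A.factors_tsnoc_0[OF f] by blast
    have "H (i.A.pure (xs @ ys)) = i.A.pure (map (\<lambda>x. i (p x)) xs @ ys)"
      if len: "length xs = Suc 0" "length ys = Suc 0" and "set xs \<subseteq> carrier A" "set ys \<subseteq> carrier A" for xs ys
    proof -
      obtain x y where "xs = [x]" "ys = [y]" using len by (auto simp: length_Suc_conv)
      then show ?thesis
        using H(2)[of y "i.A.pure [x]"] that ip[of "[x]"] cl by (simp add: i.A.tsnoc_pure i.A.pure_closed)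
    qed
    then have 2: "i.A.suffix_factors (Suc 0) (Suc 0) (Suc 0) (\<lambda>x. i (p x))"
      unfolding i.A.suffix_factors_def using H(1) by (intro exI[of _ H]) auto
    show ?thesis
      using i.A.prefix_factors_mono[OF 1 cl, of r] i.A.suffix_factors_mono[OF 2 cl, of r] by (simp add: 0)
  next
    case (Suc k)
    then have "factors i.C.BB i.C.BB (i.C.T (Suc m)) (i.C.T (Suc k)) (\<lambda>x. x)"
      using assms(6) i.C.depth_odd_Suc_iff by simp
    note corner_factors(1)[OF assms(1-5) this]
    then have f: "factors i.A.BB i.A.BB (i.A.T (Suc m)) (i.A.T (Suc k)) (\<lambda>u. i.tmap (Suc m) (p.tmap (Suc m)
      u))"
      by blast
    have 1: "i.A.prefix_factors 0 (Suc m) (Suc k) (\<lambda>x. i (p x))"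
      unfolding i.A.prefix_factors_def
      by (intro exI[of _ "\<lambda>u. i.tmap (Suc m) (p.tmap (Suc m) u)"]) (simp add: f ip)
    have 2: "i.A.suffix_factors 0 (Suc m) (Suc k) (\<lambda>x. i (p x))"
      unfolding i.A.suffix_factors_def
      by (intro exI[of _ "\<lambda>u. i.tmap (Suc m) (p.tmap (Suc m) u)"]) (simp add: f ip)
    show ?thesis
      \<comment> \<open>All \<open>r + 1\<close> untouched factors are added here. In the case
        \<open>m = 0\<close> one of them was already spent on absorbing the scalars, so only
        \<open>r\<close> were added.\<close>
      using i.A.prefix_factors_mono[OF 1 cl, of "Suc r"] i.A.suffix_factors_mono[OF 2 cl, of "Suc r"]
        by (simp add: Suc)
  qed
  then show "i.A.prefix_factors (Suc r) (Suc m) (Suc (m + r)) (\<lambda>x. i (p x))"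
    "i.A.suffix_factors (Suc r) (Suc m) (Suc (m + r)) (\<lambda>x. i (p x))"
    by auto
qed

section \<open>Complementary idempotents\<close>

context ring_pair
begin

text \<open>The equations in \<open>idem\<close> are what \<open>e A e' = 0\<close> amounts to here:
  the first lets \<open>e\<close> be pushed to the right end of the tensor, the second lets
  \<open>e'\<close> be pushed to the left end.\<close>

lemma split_divides:
  assumes e: "e \<in> B" "e' \<in> B" "e \<oplus> e' = \<one>"
    and idem: "\<And>x. x \<in> carrier A \<Longrightarrow> (e \<otimes> x) \<otimes> e = e \<otimes> x" "\<And>x. x \<in> carrier A \<Longrightarrow> e' \<otimes> (x \<otimes> e') = x \<otimes> e'"
    and pf: "prefix_factors (Suc b) (Suc a) m (\<lambda>x. e \<otimes> x)"
      and sf: "suffix_factors (Suc a) (Suc b) m (\<lambda>x. x \<otimes> e')"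
  shows "factors BB BB (T (Suc b + Suc a)) (T m) (\<lambda>x. x)"
proof -
  let ?n = "Suc b + Suc a"
  note cl = B_closed[OF e(1)] B_closed[OF e(2)]
  obtain H where H: "factors BB BB (T ?n) (T m) H"
    "\<And>xs ys. \<lbrakk>length xs = Suc b; length ys = Suc a; set xs \<subseteq> carrier A; set ys \<subseteq> carrier A\<rbrakk>
      \<Longrightarrow> H (pure (xs @ ys)) = pure (xs @ map (\<lambda>x. e \<otimes> x) ys)"
    using pf unfolding prefix_factors_def by blast
  obtain K where K: "factors BB BB (T ?n) (T m) K"
    "\<And>xs ys. \<lbrakk>length xs = Suc b; length ys = Suc a; set xs \<subseteq> carrier A; set ys \<subseteq> carrier A\<rbrakk>
      \<Longrightarrow> K (pure (xs @ ys)) = pure (map (\<lambda>x. x \<otimes> e') xs @ ys)"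
    using sf unfolding suffix_factors_def by blast
  have "u = H u \<oplus>\<^bsub>T ?n\<^esub> K u" if u: "u \<in> carrier (T ?n)" for u
  proof (rule tensor_hom_eq[OF abelian_group_T add_hom_id _ _ u])
    show "(\<lambda>u. H u \<oplus>\<^bsub>T ?n\<^esub> K u) \<in> add_hom (T ?n) (T ?n)"
      by (intro add_hom_sum factors_add_hom[OF H(1)] factors_add_hom[OF K(1)] abelian_group_T)
    fix zs assume zs: "length zs = ?n" "set zs \<subseteq> carrier A"
    \<comment> \<open>The cut comes after \<open>b + 1\<close> factors: \<open>ps\<close> and
      \<open>x\<close> form the left block, \<open>y\<close> and \<open>ys\<close> the right one.
      The decomposition of 1 is inserted to the right of \<open>x\<close>.\<close>
    define ps x where "ps = take b zs" and "x = zs ! b"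
    define y ys where "y = zs ! Suc b" and "ys = drop (Suc (Suc b)) zs"
    have split: "zs = ps @ x # y # ys"
      using zs(1) id_take_nth_drop[of b zs] Cons_nth_drop_Suc[of "Suc b" zs]
      by (simp add: ps_def x_def y_def ys_def)
    have len: "length ps = b" "length ys = a"
      using zs(1) by (simp_all add: ps_def ys_def)
    have mem: "set ps \<subseteq> carrier A" "x \<in> carrier A" "y \<in> carrier A" "set ys \<subseteq> carrier A"
      using zs(2) unfolding split by auto
    have x: "x \<otimes> e \<oplus> x \<otimes> e' = x"
      using mem(2) cl e(3) by (simp flip: r_distr)
    have "pure zs = pure (ps @ (x \<otimes> e \<oplus> x \<otimes> e') # y # ys)"
      by (simp add: x split)
    also have "\<dots> = pure (ps @ (x \<otimes> e) # y # ys) \<oplus>\<^bsub>T ?n\<^esub> pure (ps @ (x \<otimes> e') # y # ys)"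
      using mem cl len by (intro pure_add) auto
    also have "pure (ps @ (x \<otimes> e) # y # ys) = pure ((ps @ [x]) @ (e \<otimes> y) # ys)"
      using mem e by (subst pure_balance) auto
    also have "\<dots> = pure ((ps @ [x]) @ map (\<lambda>x. e \<otimes> x) (y # ys))"
      using mem e idem(1) by (intro pure_push_right) auto
    also have "\<dots> = H (pure zs)"
      using H(2)[of "ps @ [x]" "y # ys"] mem len by (simp add: split)
    also have "pure (ps @ (x \<otimes> e') # y # ys) = pure (map (\<lambda>x. x \<otimes> e') (ps @ [x]) @ y # ys)"
      using mem e idem(2) by (intro pure_push_left) auto
    also have "\<dots> = K (pure zs)"
      using K(2)[of "ps @ [x]" "y # ys"] mem len by (simp add: split)
    finally show "pure zs = H (pure zs) \<oplus>\<^bsub>T ?n\<^esub> K (pure zs)" .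
  qed
  then show ?thesis by (intro factors.ext[OF factors.add[OF H(1) K(1)]]) auto
qed

text \<open>\<open>d\<close> stands for the diagonal part of a matrix and \<open>h\<close> for its
  tensor power. Writing \<open>1 = e + e'\<close> in front of a tensor of entries \<open>d x\<close>
  and pushing both idempotents to the right turns every factor into \<open>e x\<close> in one term
  and into \<open>x e'\<close> in the other. The first term is the tensor of the \<open>x\<close>
  multiplied by \<open>e\<close> from the left, the second the same tensor multiplied by
  \<open>e'\<close> from the right.\<close>

lemma diagonal_split:
  assumes e: "e \<in> B" "e' \<in> B" "e \<oplus> e' = \<one>"
    and idem: "\<And>x. x \<in> carrier A \<Longrightarrow> (e \<otimes> x) \<otimes> e = e \<otimes> x" "\<And>x. x \<in> carrier A \<Longrightarrow> e' \<otimes> (x \<otimes> e') = x \<otimes> e'"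
      "e' \<otimes> e' = e'"
    and d: "\<And>x. x \<in> carrier A \<Longrightarrow> d x \<in> carrier A" "\<And>x. x \<in> carrier A \<Longrightarrow> e \<otimes> d x = e \<otimes> x"
      "\<And>x. x \<in> carrier A \<Longrightarrow> e' \<otimes> d x = x \<otimes> e'"
    and h: "h \<in> add_hom (T (Suc n)) (T (Suc n))"
      "\<And>xs. \<lbrakk>length xs = Suc n; set xs \<subseteq> carrier A\<rbrakk> \<Longrightarrow> h (pure xs) = pure (map d xs)"
    and u: "u \<in> carrier (T (Suc n))"
  shows "h u = lact (T (Suc n)) e u \<oplus>\<^bsub>T (Suc n)\<^esub> ract (T (Suc n)) u e'"
proof (rule tensor_hom_eq_Cons[OF abelian_group_T h(1) _ _ u])
  note cl = B_closed[OF e(1)] B_closed[OF e(2)]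
  show "(\<lambda>u. lact (T (Suc n)) e u \<oplus>\<^bsub>T (Suc n)\<^esub> ract (T (Suc n)) u e') \<in> add_hom (T (Suc n)) (T (Suc n))"
    by (intro add_hom_sum abelian_group_T lact_T_hom ract_T_hom cl) auto
  fix x xs assume x: "length xs = n" "x \<in> carrier A" "set xs \<subseteq> carrier A"
  note push = pure_push_right[where ps = "[]", unfolded append_Nil]
  have dcl: "set (map d zs) \<subseteq> carrier A" if "set zs \<subseteq> carrier A" for zs
    using that d(1) by auto
  have e'd: "e' \<otimes> d y \<otimes> e' = e' \<otimes> d y" if "y \<in> carrier A" for y
    using that cl idem(3) d(3) by (simp add: m_assoc)
  have "pure (map d (x # xs)) = pure ((e \<otimes> d x \<oplus> e' \<otimes> d x) # map d xs)"
    using x d(1) cl e(3) by (simp flip: l_distr)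
  also have "\<dots> = pure ((e \<otimes> d x) # map d xs) \<oplus>\<^bsub>T (Suc n)\<^esub> pure ((e' \<otimes> d x) # map d xs)"
    using x d(1) cl dcl[OF x(3)] by (intro pure_Cons_add) auto
  also have "pure ((e \<otimes> d x) # map d xs) = pure (map (\<lambda>y. e \<otimes> y) (d x # map d xs))"
    using x d(1) dcl[OF x(3)] e idem(1) by (intro push) auto
  also have "map (\<lambda>y. e \<otimes> y) (d x # map d xs) = map (\<lambda>y. e \<otimes> y) (x # xs)"
    using x d(2) by auto
  also have "pure (map (\<lambda>y. e \<otimes> y) (x # xs)) = pure ((e \<otimes> x) # xs)"
    using x e idem(1) by (intro push[symmetric]) auto
  also have "\<dots> = lact (T (Suc n)) e (pure (x # xs))"
    using x cl by (simp add: lact_T_pure)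
  also have "pure ((e' \<otimes> d x) # map d xs) = pure (map (\<lambda>y. e' \<otimes> y) (d x # map d xs))"
    using x d(1) dcl[OF x(3)] e e'd by (intro push) auto
  also have "map (\<lambda>y. e' \<otimes> y) (d x # map d xs) = map (\<lambda>y. y \<otimes> e') (x # xs)"
    using x d(3) by auto
  \<comment> \<open>Conversely, an \<open>e'\<close> at the right end spreads over all factors by
    being pushed to the left.\<close>
  also have "pure (map (\<lambda>y. y \<otimes> e') (x # xs)) = ract (T (Suc n)) (pure (x # xs)) e'"
  proof -
    obtain zs z where z: "x # xs = zs @ [z]" by (cases "x # xs" rule: rev_cases) auto
    have "set (x # xs) \<subseteq> carrier A" using x by simp
    then have "z \<in> carrier A" "set zs \<subseteq> carrier A" unfolding z by auto
    moreover have "length zs = n" using x(1) z by (metis length_append_singleton length_Cons nat.inject)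
    ultimately have "pure (zs @ (z \<otimes> e') # []) = pure (map (\<lambda>y. y \<otimes> e') (zs @ [z]) @ [])"
      "ract (T (Suc n)) (pure (zs @ [z])) e' = pure (zs @ [z \<otimes> e'])"
      using e idem(2) cl by (intro pure_push_left ract_T_pure; auto)+
    then show ?thesis unfolding z by simp
  qed
  finally show "h (pure (x # xs)) = lact (T (Suc n)) e (pure (x # xs))
    \<oplus>\<^bsub>T (Suc n)\<^esub> ract (T (Suc n)) (pure (x # xs)) e'"
    using h(2)[of "x # xs"] x by simp
qed

end


section \<open>The triangular matrix ring\<close>

lemma triangular_ring_simps [simp]:
  "carrier (triangular_ring R M S) = carrier R \<times> carrier M \<times> carrier S"
  "(r, x, s) \<otimes>\<^bsub>triangular_ring R M S\<^esub> (r', x', s') =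
    (r \<otimes>\<^bsub>R\<^esub> r', ract M x r' \<oplus>\<^bsub>M\<^esub> lact M s x', s \<otimes>\<^bsub>S\<^esub> s')"
  "(r, x, s) \<oplus>\<^bsub>triangular_ring R M S\<^esub> (r', x', s') = (r \<oplus>\<^bsub>R\<^esub> r', x \<oplus>\<^bsub>M\<^esub> x', s \<oplus>\<^bsub>S\<^esub> s')"
  "\<one>\<^bsub>triangular_ring R M S\<^esub> = (\<one>\<^bsub>R\<^esub>, \<zero>\<^bsub>M\<^esub>, \<one>\<^bsub>S\<^esub>)"
  "\<zero>\<^bsub>triangular_ring R M S\<^esub> = (\<zero>\<^bsub>R\<^esub>, \<zero>\<^bsub>M\<^esub>, \<zero>\<^bsub>S\<^esub>)"
  by (simp_all add: triangular_ring_def)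

lemma RDirProd_simps [simp]:
  "carrier (RDirProd R S) = carrier R \<times> carrier S"
  "(r, s) \<otimes>\<^bsub>RDirProd R S\<^esub> (r', s') = (r \<otimes>\<^bsub>R\<^esub> r', s \<otimes>\<^bsub>S\<^esub> s')"
  "(r, s) \<oplus>\<^bsub>RDirProd R S\<^esub> (r', s') = (r \<oplus>\<^bsub>R\<^esub> r', s \<oplus>\<^bsub>S\<^esub> s')"
  "\<one>\<^bsub>RDirProd R S\<^esub> = (\<one>\<^bsub>R\<^esub>, \<one>\<^bsub>S\<^esub>)"
  "\<zero>\<^bsub>RDirProd R S\<^esub> = (\<zero>\<^bsub>R\<^esub>, \<zero>\<^bsub>S\<^esub>)"
  by (simp_all add: RDirProd_def DirProd_def monoid.defs)

section \<open>The diagonal subring, its idempotents and the two corners\<close>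

locale triangular = R: ring_pair R R' + S: ring_pair S S' + M: bimodule S R M
  for R :: "('r, 'a) ring_scheme" and R' and S :: "('s, 'b) ring_scheme" and S'
    and M :: "('s, 'r, 'm) bimodule"
begin

abbreviation "A \<equiv> triangular_ring R M S"
abbreviation "B \<equiv> diagonal_matrices R' M S'"
abbreviation "P \<equiv> RDirProd R S"

lemma lact_ring_zero: "x \<in> carrier M \<Longrightarrow> lact M \<zero>\<^bsub>S\<^esub> x = \<zero>\<^bsub>M\<^esub>"
  using add_hom_zero[of S M "\<lambda>a. lact M a x"] by (simp add: add_hom_def M.lact_closed M.lact_add_left
      S.abelian_group_axioms M.abelian_group_axioms)

lemma ract_ring_zero: "x \<in> carrier M \<Longrightarrow> ract M x \<zero>\<^bsub>R\<^esub> = \<zero>\<^bsub>M\<^esub>"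
  using add_hom_zero[of R M "\<lambda>a. ract M x a"] by (simp add: add_hom_def M.ract_closed M.ract_add_right
      R.abelian_group_axioms M.abelian_group_axioms)

lemmas zeros = lact_ring_zero ract_ring_zero lact_zero[OF M.bimodule_axioms] ract_zero[OF M.bimodule_axioms]

lemma ring_A: "ring A"
proof (rule ringI)
  show "abelian_group A"
  proof (rule abelian_groupI)
    fix x assume "x \<in> carrier A"
    then obtain r m s where "x = (r, m, s)" "r \<in> carrier R" "m \<in> carrier M" "s \<in> carrier S" by auto
    then show "\<exists>y\<in>carrier A. y \<oplus>\<^bsub>A\<^esub> x = \<zero>\<^bsub>A\<^esub>"
      by (intro bexI[of _ "(\<ominus>\<^bsub>R\<^esub> r, \<ominus>\<^bsub>M\<^esub> m, \<ominus>\<^bsub>S\<^esub> s)"]) (simp_all add: R.l_neg M.l_neg S.l_neg)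
  qed (auto simp: R.a_ac M.a_ac S.a_ac)
  show "Group.monoid A"
    by (rule monoidI)
      (auto simp: R.m_assoc S.m_assoc M.ract_closed M.lact_closed M.lact_add_right M.ract_add_left
        M.lact_mult M.ract_mult M.lact_one M.ract_one M.lact_ract M.a_ac zeros)
qed (auto simp: R.l_distr S.l_distr R.r_distr S.r_distr M.ract_closed M.lact_closed M.lact_add_right
    M.ract_add_left M.lact_add_left M.ract_add_right M.a_ac)

lemma ring_P: "ring P"
  by (rule RDirProd_ring[OF R.ring_axioms S.ring_axioms])

lemma diagonal_iff: "b \<in> B \<longleftrightarrow> (\<exists>r\<in>R'. \<exists>s\<in>S'. b = (r, \<zero>\<^bsub>M\<^esub>, s))"
  by (auto simp: diagonal_matrices_def)

lemma subring_B: "subring B A"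
proof -
  interpret A: ring A by (rule ring_A)
  note R' = subringE[OF R.B_subring] and S' = subringE[OF S.B_subring]
  show ?thesis
  proof (rule A.subringI)
    show "\<ominus>\<^bsub>A\<^esub> h \<in> B" if "h \<in> B" for h
    proof -
      obtain r s where h: "h = (r, \<zero>\<^bsub>M\<^esub>, s)" "r \<in> R'" "s \<in> S'" using \<open>h \<in> B\<close> diagonal_iff by auto
      then have "\<ominus>\<^bsub>A\<^esub> h = (\<ominus>\<^bsub>R\<^esub> r, \<zero>\<^bsub>M\<^esub>, \<ominus>\<^bsub>S\<^esub> s)"
        by (intro A.minus_equality) (simp_all add: R.B_closed S.B_closed R.l_neg S.l_neg)
      then show ?thesis using h R'(5) S'(5) by (auto simp: diagonal_iff)
    qed
  qed (use R'(3,6,7) S'(3,6,7) in \<open>auto simp: diagonal_iff zeros S.B_closed R.B_closed\<close>)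
qed

lemma subring_P: "subring (R' \<times> S') P"
proof -
  interpret P: ring P by (rule ring_P)
  note R' = subringE[OF R.B_subring] and S' = subringE[OF S.B_subring]
  show ?thesis
  proof (rule P.subringI)
    show "\<ominus>\<^bsub>P\<^esub> h \<in> R' \<times> S'" if "h \<in> R' \<times> S'" for h
    proof -
      obtain r s where h: "h = (r, s)" "r \<in> R'" "s \<in> S'" using \<open>h \<in> R' \<times> S'\<close> by auto
      then have "\<ominus>\<^bsub>P\<^esub> h = (\<ominus>\<^bsub>R\<^esub> r, \<ominus>\<^bsub>S\<^esub> s)"
        by (intro P.minus_equality) (simp_all add: R.B_closed S.B_closed R.l_neg S.l_neg)
      then show ?thesis using h R'(5) S'(5) by auto
    qed
  qed (use R'(3,6,7) S'(3,6,7) in \<open>auto simp: R.B_closed S.B_closed\<close>)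
qed

sublocale A: ring_pair A B
  by (intro ring_pair.intro ring_pair_axioms.intro ring_A subring_B)

sublocale P: ring_pair P "R' \<times> S'"
  by (intro ring_pair.intro ring_pair_axioms.intro ring_P subring_P)

text \<open>The corner embeddings are multiplicative but do not send 1 to 1 in general. The
  projections are multiplicative because in a triangular product the diagonal entries depend only on
  diagonal entries.\<close>

lemma map_R: "ring_pair_map R R' A B (\<lambda>r. (r, \<zero>\<^bsub>M\<^esub>, \<zero>\<^bsub>S\<^esub>))" "ring_pair_map A B R R' fst"
  and map_S: "ring_pair_map S S' A B (\<lambda>s. (\<zero>\<^bsub>R\<^esub>, \<zero>\<^bsub>M\<^esub>, s))" "ring_pair_map A B S S' (\<lambda>x. snd (snd x))"
  and map_P: "ring_pair_map P (R' \<times> S') A B (\<lambda>(r, s). (r, \<zero>\<^bsub>M\<^esub>, s))"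
    "ring_pair_map A B P (R' \<times> S') (\<lambda>(r, x, s). (r, s))"
  using subringE(2)[OF R.B_subring] subringE(2)[OF S.B_subring]
  by (intro ring_pair_map.intro ring_pair_map_axioms.intro add_homI
      R.ring_pair_axioms S.ring_pair_axioms A.ring_pair_axioms P.ring_pair_axioms;
      auto simp: zeros diagonal_iff R.B_closed S.B_closed)+

definition "e = (\<one>\<^bsub>R\<^esub>, \<zero>\<^bsub>M\<^esub>, \<zero>\<^bsub>S\<^esub>)"
definition "e' = (\<zero>\<^bsub>R\<^esub>, \<zero>\<^bsub>M\<^esub>, \<one>\<^bsub>S\<^esub>)"

lemma idempotents:
  "e \<in> B" "e' \<in> B" "e \<oplus>\<^bsub>A\<^esub> e' = \<one>\<^bsub>A\<^esub>" "e' \<otimes>\<^bsub>A\<^esub> e' = e'"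
  "x \<in> carrier A \<Longrightarrow> (e \<otimes>\<^bsub>A\<^esub> x) \<otimes>\<^bsub>A\<^esub> e = e \<otimes>\<^bsub>A\<^esub> x"
  "x \<in> carrier A \<Longrightarrow> e' \<otimes>\<^bsub>A\<^esub> (x \<otimes>\<^bsub>A\<^esub> e') = x \<otimes>\<^bsub>A\<^esub> e'"
  using subringE(2,3)[OF R.B_subring] subringE(2,3)[OF S.B_subring]
  by (auto simp: e_def e'_def diagonal_iff zeros M.lact_one M.ract_one)

lemma e_mult: "x \<in> carrier A \<Longrightarrow> e \<otimes>\<^bsub>A\<^esub> x = (fst x, \<zero>\<^bsub>M\<^esub>, \<zero>\<^bsub>S\<^esub>)"
  and mult_e': "x \<in> carrier A \<Longrightarrow> x \<otimes>\<^bsub>A\<^esub> e' = (\<zero>\<^bsub>R\<^esub>, \<zero>\<^bsub>M\<^esub>, snd (snd x))"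
  by (auto simp: e_def e'_def zeros)

text \<open>Forgetting the lower left entry is a ring homomorphism onto the diagonal ring, split by
  the diagonal embedding. The composite \<open>d\<close> on \<open>A\<close> has the form required
  by \<open>diagonal_split\<close>, which supplies the retracts.\<close>

lemma depth_odd_P:
  assumes "depth_odd B A m"
  shows "depth_odd (R' \<times> S') P m"
proof -
  interpret i: ring_pair_map P "R' \<times> S'" A B "\<lambda>(r, s). (r, \<zero>\<^bsub>M\<^esub>, s)" by (rule map_P)
  interpret p: ring_pair_map A B P "R' \<times> S'" "\<lambda>(r, x, s). (r, s)" by (rule map_P)
  define d where "d x = (fst x, \<zero>\<^bsub>M\<^esub>, snd (snd x))" for x :: "'r \<times> 'm \<times> 's"
  show ?thesis
  proof (rule depth_odd_retract[OF map_P _ idempotents(1,2) _ _ assms])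
    fix n u assume u: "u \<in> carrier (A.T (Suc n))"
    show "i.tmap (Suc n) (p.tmap (Suc n) u) = lact (A.T (Suc n)) e u \<oplus>\<^bsub>A.T (Suc n)\<^esub> ract (A.T (Suc n)) u e'"
    proof (rule A.diagonal_split[where d = d, OF idempotents(1-3) idempotents(5,6,4) _ _ _ _ _ u])
      show "(\<lambda>u. i.tmap (Suc n) (p.tmap (Suc n) u)) \<in> add_hom (A.T (Suc n)) (A.T (Suc n))"
        by (rule add_hom_compose[OF p.tmap_hom i.tmap_hom])
      show "i.tmap (Suc n) (p.tmap (Suc n) (A.pure xs)) = A.pure (map d xs)"
        if "length xs = Suc n" "set xs \<subseteq> carrier A" for xs
      proof -
        have "(\<lambda>(r, s). (r, \<zero>\<^bsub>M\<^esub>, s)) \<circ> (\<lambda>(r, x, s). (r, s)) = d"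
          by (auto simp: d_def)
        then show ?thesis
          using that p.maps_list_closed[OF that(2)] by (simp add: p.tmap_pure i.tmap_pure)
      qed
      fix x assume "x \<in> carrier A"
      then show "d x \<in> carrier A" "e \<otimes>\<^bsub>A\<^esub> d x = e \<otimes>\<^bsub>A\<^esub> x" "e' \<otimes>\<^bsub>A\<^esub> d x = x \<otimes>\<^bsub>A\<^esub> e'"
        by (auto simp: d_def e_def e'_def zeros)
    qed
  next
    fix b assume "b \<in> B"
    then show "(case case b of (r, x, s) \<Rightarrow> (r, s) of (r, s) \<Rightarrow> (r, \<zero>\<^bsub>M\<^esub>, s)) = e \<otimes>\<^bsub>A\<^esub> b \<oplus>\<^bsub>A\<^esub> b \<otimes>\<^bsub>A\<^esub> e'"
      by (auto simp: diagonal_iff e_def e'_def zeros R.B_closed S.B_closed)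
  qed auto
qed

text \<open>The block of length \<open>a + 1\<close> coming from \<open>R\<close> stands behind
  \<open>b + 1\<close> untouched factors, the block of length \<open>b + 1\<close> coming from
  \<open>S\<close> in front of \<open>a + 1\<close> untouched ones. Both shortenings pass through
  the same length \<open>a + b + 1\<close>, so their sum is a legitimate factorization of the
  identity.\<close>

lemma depth_odd_A:
  assumes a: "depth_odd R' R a" and b: "depth_odd S' S b"
  shows "depth_odd B A (Suc (a + b))"
proof -
  have "A.prefix_factors (Suc b) (Suc a) (Suc (a + b)) (\<lambda>x. (fst x, \<zero>\<^bsub>M\<^esub>, \<zero>\<^bsub>S\<^esub>))"
    by (rule corner_tensor_factors(1)[OF map_R _ _ _ a]) (auto simp: diagonal_iff zeros R.B_closed S.B_closed)
  from A.prefix_factors_cong[OF _ this]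
  have pf: "A.prefix_factors (Suc b) (Suc a) (Suc (a + b)) (\<lambda>x. e \<otimes>\<^bsub>A\<^esub> x)"
    by (simp add: e_mult del: triangular_ring_simps)
  have "A.suffix_factors (Suc a) (Suc b) (Suc (b + a)) (\<lambda>x. (\<zero>\<^bsub>R\<^esub>, \<zero>\<^bsub>M\<^esub>, snd (snd x)))"
    by (rule corner_tensor_factors(2)[OF map_S _ _ _ b]) (auto simp: diagonal_iff zeros R.B_closed S.B_closed)
  from A.suffix_factors_cong[OF _ this]
  have sf: "A.suffix_factors (Suc a) (Suc b) (Suc (a + b)) (\<lambda>x. x \<otimes>\<^bsub>A\<^esub> e')"
    by (simp add: mult_e' add.commute del: triangular_ring_simps)
  show ?thesis
    using A.split_divides[OF idempotents(1-3,5,6) pf sf] by (simp add: A.depth_odd_Suc_iff add.commute)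
qed

end

section \<open>The two depth inequalities\<close>

theorem theorem3p4:
  fixes R :: "'r ring" and S :: "'s ring" and M :: "('s, 'r, 'm) bimodule"
    and R' :: "'r set" and S' :: "'s set"
  assumes "ring R" and "ring S"
    and "subring R' R" and "subring S' S"
    and "bimodule S R M" and "carrier M \<noteq> {\<zero>\<^bsub>M\<^esub>}"
  shows "min_depth (R' \<times> S') (RDirProd R S)
        \<le> min_odd_depth (diagonal_matrices R' M S') (triangular_ring R M S)
    \<and> min_odd_depth (diagonal_matrices R' M S') (triangular_ring R M S)
        \<le> min_odd_depth R' R + min_odd_depth S' S + 1"
proof -
  interpret triangular R R' S S' M
    using assms by (intro triangular.intro ring_pair.intro ring_pair_axioms.intro)
  have "min_depth (R' \<times> S') P \<le> min_odd_depth B A"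
  proof (rule A.min_odd_depth_cases)
    fix m assume "min_odd_depth B A = enat (2 * m + 1)" "depth_odd B A m"
    then show ?thesis using P.min_depth_le[OF depth_odd_P] by simp
  qed simp
  moreover have "min_odd_depth B A \<le> min_odd_depth R' R + min_odd_depth S' S + 1"
  proof (rule R.min_odd_depth_cases; rule S.min_odd_depth_cases)
    fix a b
    assume "min_odd_depth R' R = enat (2 * a + 1)" "depth_odd R' R a"
      and "min_odd_depth S' S = enat (2 * b + 1)" "depth_odd S' S b"
    then show ?thesis
      using A.min_odd_depth_le[OF depth_odd_A, of a b] by (simp add: one_enat_def)
  qed auto
  ultimately show ?thesis ..
qed

end
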